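(* Let $I$ be a monomial ideal of $\mathcal O_n$ of finite colength. Then, for all $i=1,\dots,n$, $$\mathcal L_0^{(i)}(I)=\max\left\{\frac{\ell(v,I)}{v_{\min}}: v\in S^{(i)}\right\}.$$
   Context: $\mathcal O_n$ is the ring of complex analytic function germs $(\mathbb C^n,0)\to\mathbb C$, with maximal ideal $\mathfrak m$. Ideals are understood to be proper. A monomial ideal is one generated by monomials; finite colength means finite length quotient. For $v=(v_1,\dots,v_n)\in\mathbb R^n_{\geq 0}$: $v_{\min}=\min\{v_1,\dots,v_n\}$ and $A(v)=\{j:v_j=v_{\min}\}$. For $i\in\{1,\dots,n\}$, $S^{(i)}=\{v\in\mathbb R_{>0}^n:\#A(v)\geq n+1-i\}$. The Newton polyhedron $\Gamma_+(I)$ of an ideal $I$ with generating system $g_1,\dots,g_r$ is the convex hull of $\Gamma_+(g_1)\cup\dots\cup\Gamma_+(g_r)$, where for a nonzero germ $h=\sum_k a_kx^k$, $\Gamma_+(h)$ is the convex hull of $\{k+u: a_k\neq 0,\ u\in\mathbb R^n_{\geq 0}\}$ and $\Gamma_+(0)=\emptyset$. Put $\ell(v,I)=\min\{\langle v,k\rangle:k\in\Gamma_+(I)\}$ with the standard scalar product. Relative Łojasiewicz exponents. Let $(R,\mathfrak m)$ be a Noetherian local ring of dimension $n$. For ideals $I_1,\dots,I_n$ of finite colength, $e(I_1,\dots,I_n)$ is the coefficient of $x_1\cdots x_n$ in the polynomial $P\in\mathbb Q[x_1,\dots,x_n]$ of degree $n$ such that $P(r_1,\dots,r_n)$ equals the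 length of $R/I_1^{r_1}\cdots I_n^{r_n}$ for all large $r_1,\dots,r_n$. For ideals of finite colength put $$r_0(I_1,\dots,I_n)=\min\{r\in\mathbb Z_{\geq0}: e(I_1,\dots,I_n)=e(I_1+\mathfrak m^r,\dots,I_n+\mathfrak m^r)\},\quad \mathcal L_0(I_1,\dots,I_n)=\inf_{s\geq1}\frac{r_0(I_1^s,\dots,I_n^s)}{s}.$$ For an ideal $I$ of finite colength, $\mathcal L_0^{(i)}(I)=\mathcal L_0(I,\dots,I,\mathfrak m,\dots,\mathfrak m)$ with $I$ repeated $i$ times and $\mathfrak m$ repeated $n-i$ times. *)

theory Defs
  imports
    "HOL-Analysis.Analysis"
    "HOL-Library.Poly_Mapping"
    "HOL-Algebra.QuotRing"
    "HOL-Algebra.Ideal_Product"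
begin

section \<open>Germs of analytic functions at the origin\<close>

definition monomial_fun :: "nat ^ 'n \<Rightarrow> complex ^ 'n \<Rightarrow> complex" where
  "monomial_fun k x = (\<Prod>j\<in>UNIV. (x $ j) ^ (k $ j))"

text \<open>Summation over all multi-indices is unordered, i.e. the convergence is absolute.\<close>

definition has_taylor :: "(complex ^ 'n \<Rightarrow> complex) \<Rightarrow> (nat ^ 'n \<Rightarrow> complex) \<Rightarrow> bool" where
  "has_taylor f a \<longleftrightarrow>
     (\<forall>\<^sub>F x in nhds 0. ((\<lambda>k. a k * monomial_fun k x) has_sum f x) UNIV)"

definition analytic_fun_ring :: "(complex ^ 'n \<Rightarrow> complex) ring" where
  "analytic_fun_ring =
     \<lparr>carrier = {f. \<exists>a. has_taylor f a},
      mult = (\<lambda>f g x. f x * g x), one = (\<lambda>x. 1),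
      ring.zero = (\<lambda>x. 0), add = (\<lambda>f g x. f x + g x)\<rparr>"

definition null_germ_ideal :: "(complex ^ 'n \<Rightarrow> complex) set" where
  "null_germ_ideal = {f. \<forall>\<^sub>F x in nhds 0. f x = 0}"

text \<open>A germ is a coset of functions modulo those that vanish near the origin.
  The number of variables is \<open>CARD('n)\<close>.\<close>

definition germ_ring :: "((complex ^ 'n \<Rightarrow> complex) set) ring" where
  "germ_ring = analytic_fun_ring Quot null_germ_ideal"

definition germ_of :: "(complex ^ 'n \<Rightarrow> complex) \<Rightarrow> (complex ^ 'n \<Rightarrow> complex) set" where
  "germ_of f = null_germ_ideal +>\<^bsub>analytic_fun_ring\<^esub> f"

definition taylor :: "(complex ^ 'n \<Rightarrow> complex) set \<Rightarrow> nat ^ 'n \<Rightarrow> complex" where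
  "taylor h = (THE a. \<exists>f\<in>h. has_taylor f a)"

definition monomial_ideal :: "(complex ^ 'n \<Rightarrow> complex) set set \<Rightarrow> bool" where
  "monomial_ideal I \<longleftrightarrow> (\<exists>K. I = Idl\<^bsub>germ_ring\<^esub> ((\<lambda>k. germ_of (monomial_fun k)) ` K))"


section \<open>Newton polyhedra\<close>

definition exponent_vec :: "nat ^ 'n \<Rightarrow> real ^ 'n" where
  "exponent_vec k = (\<chi> j. real (k $ j))"

definition newton_germ :: "(complex ^ 'n \<Rightarrow> complex) set \<Rightarrow> (real ^ 'n) set" where
  "newton_germ h =
     convex hull {exponent_vec k + u | k u. taylor h k \<noteq> 0 \<and> (\<forall>j. 0 \<le> u $ j)}"

text \<open>The result does not depend on the finite generating system \<open>G\<close>.\<close>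

definition newton_polyhedron :: "(complex ^ 'n \<Rightarrow> complex) set set \<Rightarrow> (real ^ 'n) set" where
  "newton_polyhedron I =
     (THE \<Gamma>. \<exists>G. finite G \<and> G \<subseteq> carrier germ_ring \<and> I = Idl\<^bsub>germ_ring\<^esub> G \<and>
        \<Gamma> = convex hull (\<Union>g\<in>G. newton_germ g))"

definition newton_ell :: "real ^ 'n \<Rightarrow> (complex ^ 'n \<Rightarrow> complex) set set \<Rightarrow> real" where
  "newton_ell v I = (LEAST c. \<exists>k\<in>newton_polyhedron I. c = v \<bullet> k)"

definition vec_min :: "real ^ 'n \<Rightarrow> real" where
  "vec_min v = Min (range (\<lambda>j. v $ j))"

definition argmin_set :: "real ^ 'n \<Rightarrow> 'n set" where
  "argmin_set v = {j. v $ j = vec_min v}"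

definition S_set :: "nat \<Rightarrow> (real ^ 'n) set" where
  "S_set i = {v. (\<forall>j. 0 < v $ j) \<and> CARD('n) + 1 - i \<le> card (argmin_set v)}"


section \<open>Length and mixed multiplicities\<close>

text \<open>For an ideal \<open>J\<close> of \<open>R\<close>, the \<open>R\<close>-submodules of the quotient are exactly the ideals of
  the ring \<open>R Quot J\<close>, so the length of the quotient as an \<open>R\<close>-module is the supremum of the
  lengths of chains of ideals of \<open>R Quot J\<close>.\<close>

definition ring_length :: "('a, 'b) ring_scheme \<Rightarrow> enat" where
  "ring_length A =
     Sup {enat k | k. \<exists>C. (\<forall>j\<le>k. ideal (C j) A) \<and> (\<forall>j<k. C j \<subset> C (Suc j))}"

definition colength :: "('a, 'b) ring_scheme \<Rightarrow> 'a set \<Rightarrow> enat" where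
  "colength R J = ring_length (R Quot J)"

definition finite_colength :: "('a, 'b) ring_scheme \<Rightarrow> 'a set \<Rightarrow> bool" where
  "finite_colength R J \<longleftrightarrow> colength R J \<noteq> \<infinity>"

definition ideal_pow :: "('a, 'b) ring_scheme \<Rightarrow> 'a set \<Rightarrow> nat \<Rightarrow> 'a set" where
  "ideal_pow R I k = I [^]\<^bsub>ideals_set R\<^esub> k"

definition ideal_power_prod ::
    "('a, 'b) ring_scheme \<Rightarrow> 'a set list \<Rightarrow> (nat \<Rightarrow> nat) \<Rightarrow> 'a set" where
  "ideal_power_prod R Is r =
     foldr (\<lambda>j J. ideal_prod R (ideal_pow R (Is ! j) (r j)) J) [0..<length Is] (carrier R)"

text \<open>Polynomials in the variables \<open>x\<^sub>j\<close> (\<open>j :: nat\<close>) are finitely supported maps from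
  exponents to coefficients; the ideals of a list are indexed from \<open>0\<close>.\<close>

type_synonym rat_mpoly = "(nat \<Rightarrow>\<^sub>0 nat) \<Rightarrow>\<^sub>0 rat"

definition mpoly_eval :: "rat_mpoly \<Rightarrow> (nat \<Rightarrow> rat) \<Rightarrow> rat" where
  "mpoly_eval P x =
     (\<Sum>m\<in>Poly_Mapping.keys P. Poly_Mapping.lookup P m *
        (\<Prod>j\<in>Poly_Mapping.keys m. x j ^ Poly_Mapping.lookup m j))"

text \<open>The degree is bounded by \<open>n\<close>, the number of ideals, rather than required to equal \<open>n\<close>.
  For proper ideals of finite colength in an \<open>n\<close>-dimensional local ring it is exactly \<open>n\<close>;
  with the bound, the mixed multiplicity of \<open>n\<close> copies of the unit ideal is \<open>0\<close>.\<close>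

definition is_length_poly :: "('a, 'b) ring_scheme \<Rightarrow> 'a set list \<Rightarrow> rat_mpoly \<Rightarrow> bool" where
  "is_length_poly R Is P \<longleftrightarrow>
     (\<forall>m\<in>Poly_Mapping.keys P. Poly_Mapping.keys m \<subseteq> {..<length Is} \<and>
        (\<Sum>j\<in>Poly_Mapping.keys m. Poly_Mapping.lookup m j) \<le> length Is) \<and>
     (\<exists>N. \<forall>r. (\<forall>j<length Is. N \<le> r j) \<longrightarrow>
        mpoly_eval P (\<lambda>j. of_nat (r j)) = of_nat (the_enat (colength R (ideal_power_prod R Is r))))"

definition mixed_mult :: "('a, 'b) ring_scheme \<Rightarrow> 'a set list \<Rightarrow> rat" where
  "mixed_mult R Is =
     Poly_Mapping.lookup (THE P. is_length_poly R Is P)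
       (\<Sum>j<length Is. Poly_Mapping.single j 1)"


section \<open>Relative Lojasiewicz exponents\<close>

definition max_ideal :: "('a, 'b) ring_scheme \<Rightarrow> 'a set" where
  "max_ideal R = (THE M. maximalideal M R)"

text \<open>Since \<open>I + \<mm>\<^sup>0\<close> is the unit ideal, \<open>r = 0\<close> compares with the mixed multiplicity \<open>0\<close>.\<close>

definition r0 :: "('a, 'b) ring_scheme \<Rightarrow> 'a set list \<Rightarrow> nat" where
  "r0 R Is =
     (LEAST r. mixed_mult R Is =
        mixed_mult R (map (\<lambda>I. set_add R I (ideal_pow R (max_ideal R) r)) Is))"

definition lojasiewicz :: "('a, 'b) ring_scheme \<Rightarrow> 'a set list \<Rightarrow> real" where
  "lojasiewicz R Is =
     (INF s\<in>{1..}. real (r0 R (map (\<lambda>I. ideal_pow R I s) Is)) / real s)"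

definition rel_lojasiewicz :: "('a, 'b) ring_scheme \<Rightarrow> nat \<Rightarrow> nat \<Rightarrow> 'a set \<Rightarrow> real" where
  "rel_lojasiewicz R n i I = lojasiewicz R (replicate i I @ replicate (n - i) (max_ideal R))"

end

theory Submission
  imports Defs
begin

text \<open>Both sides equal \<open>M\<close>, the largest order of the restriction of \<open>I\<close> to a coordinate subspace
  \<open>x\<^sub>W = 0\<close> with fewer than \<open>i\<close> equations. For the right-hand side one lets the entries of \<open>v\<close> outside
  \<open>A(v)\<close> be large. For the left-hand side one shows that, for a monomial ideal \<open>J\<close> of finite colength,
  replacing \<open>J\<close> by \<open>J + \<mm>\<^sup>r\<close> preserves the mixed multiplicity of \<open>i\<close> copies of \<open>J\<close> and \<open>n - i\<close> copies of
  \<open>\<mm>\<^sup>s\<close> exactly if all these restrictions of \<open>J\<close> have order at most \<open>r\<close>; for \<open>J = I\<^sup>s\<close> this means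
  \<open>r \<ge> sM\<close>.

  The difference of the two colength polynomials counts the monomials of \<open>J'\<^sup>a\<mm>\<^sup>b\<close> outside
  \<open>J\<^sup>a\<mm>\<^sup>b\<close>, where \<open>J' = J + \<mm>\<^sup>r\<close>. It is the Hilbert function of a bigraded module over an Artinian ring,
  so its leading coefficients are nonnegative, which makes mixed multiplicities monotone. If all the
  orders are at most \<open>r\<close>, a monomial in the gap has at most \<open>n - i\<close> exponents that are large compared
  with \<open>a\<close>, and the gap is \<open>O(a\<^bsup>i+1\<^esup>b\<^bsup>n-i-1\<^esup>)\<close> for \<open>b \<ge> ca\<close>. If the order along some \<open>x\<^sub>W = 0\<close> with
  \<open>i - 1\<close> equations exceeds \<open>r\<close>, the gap contains a box of size proportional to \<open>a\<^sup>ib\<^bsup>n-i\<^esup>\<close>.\<close>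

section \<open>Bivariate Hilbert functions\<close>

text \<open>The estimates for the gap are limits along rays \<open>b = c a\<close>. They control the
  value at \<open>(1, c)\<close> of the whole leading form with coefficients \<open>L i\<close> at
  \<open>a^i b^(n-i)\<close>, not a single coefficient. Nonnegativity separates the coefficients:
  nothing can cancel, so a growth bound in \<open>c\<close> applies to each of them. Hence the gap
  is not handled as a difference of two polynomials but written as a sum of shifted Hilbert
  functions of polynomial rings, whose leading coefficients count summands.

  Two variables suffice, because the colength polynomial depends only on the sum of the first
  \<open>i\<close> and the sum of the last \<open>n - i\<close> exponents. Two cases need separate
  care. For \<open>i = n\<close> the second sum is empty, so only the row \<open>b = 0\<close> is
  seen, and its leading term has to be matched with the generic one (\<open>hlead_column\<close>).
  And in \<open>r0\<close> the added power also reaches the copies of the maximal ideal's power; if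
  \<open>r < s\<close>, all the ideals become equal and a comparison of volumes decides
  (\<open>hlead_mm_less\<close>).\<close>

text \<open>\<open>bin p x\<close> is the number of monomials of degree \<open>x\<close> in \<open>p\<close> variables. Hence \<open>piece (p, c, q, d)\<close> is
  the Hilbert function of a polynomial ring with \<open>p\<close> variables of bidegree \<open>(1, 0)\<close> and \<open>q\<close> variables of
  bidegree \<open>(0, 1)\<close>, shifted by \<open>(c, d)\<close>.\<close>

definition bin :: "nat \<Rightarrow> nat \<Rightarrow> nat" where
  "bin p x = (case p of 0 \<Rightarrow> of_bool (x = 0) | Suc q \<Rightarrow> (x + q) choose q)"

lemma sum_bin: "(\<Sum>v\<le>x. bin p v) = bin (Suc p) x"
proof (cases p)
  case 0
  have "(\<Sum>v\<le>x. (of_bool (v = 0)::nat)) = 1" by (induction x) auto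
  then show ?thesis using 0 by (simp add: bin_def)
next
  case (Suc q)
  have "(\<Sum>v\<le>x. (q + v) choose q) = (q + x + 1) choose (q + 1)" by (rule choose_rising_sum(1))
  then show ?thesis using Suc by (simp add: bin_def add.commute)
qed

type_synonym piece_index = "nat \<times> nat \<times> nat \<times> nat"

definition piece :: "piece_index \<Rightarrow> nat \<Rightarrow> nat \<Rightarrow> nat" where
  "piece = (\<lambda>(p, c, q, d) a b. (if c \<le> a then bin p (a - c) else 0) * (if d \<le> b then bin q (b - d) else 0))"

definition piece_sum :: "piece_index list \<Rightarrow> nat \<Rightarrow> nat \<Rightarrow> nat" where
  "piece_sum ts a b = (\<Sum>t\<leftarrow>ts. piece t a b)"

lemma piece_sum_simps [simp]:
  "piece_sum [] a b = 0" "piece_sum (t # ts) a b = piece t a b + piece_sum ts a b"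
  "piece_sum (ts @ us) a b = piece_sum ts a b + piece_sum us a b"
  by (simp_all add: piece_sum_def)

definition piecewise_binomial :: "(nat \<Rightarrow> nat \<Rightarrow> nat) \<Rightarrow> bool" where
  "piecewise_binomial f \<longleftrightarrow> (\<exists>ts. f = piece_sum ts)"

lemma piecewise_binomial_zero: "piecewise_binomial (\<lambda>a b. 0)"
  unfolding piecewise_binomial_def by (rule exI[of _ "[]"]) (auto simp: fun_eq_iff)

lemma piecewise_binomial_add:
  assumes "piecewise_binomial f" "piecewise_binomial g"
  shows "piecewise_binomial (\<lambda>a b. f a b + g a b)"
proof -
  obtain ts us where "f = piece_sum ts" "g = piece_sum us"
    using assms unfolding piecewise_binomial_def by auto
  then have "(\<lambda>a b. f a b + g a b) = piece_sum (ts @ us)" by (simp add: fun_eq_iff)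
  then show ?thesis unfolding piecewise_binomial_def by blast
qed

lemma piecewise_binomial_swap:
  assumes "piecewise_binomial f"
  shows "piecewise_binomial (\<lambda>a b. f b a)"
proof -
  obtain ts where f: "f = piece_sum ts" using assms unfolding piecewise_binomial_def by auto
  have "(\<lambda>a b. piece_sum ts b a) = piece_sum (map (\<lambda>(p, c, q, d). (q, d, p, c)) ts)"
    by (induction ts) (auto simp: fun_eq_iff piece_def)
  then show ?thesis unfolding piecewise_binomial_def f by blast
qed

text \<open>Multiplies the generating function by the variable of bidegree (1, 0); only the shift
  \<open>c\<close> changes.\<close>

lemma piecewise_binomial_shift:
  assumes "piecewise_binomial f"
  shows "piecewise_binomial (\<lambda>a b. case a of 0 \<Rightarrow> 0 | Suc a' \<Rightarrow> f a' b)"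
proof -
  obtain ts where f: "f = piece_sum ts" using assms unfolding piecewise_binomial_def by auto
  have "(case a of 0 \<Rightarrow> 0 | Suc a' \<Rightarrow> piece_sum ts a' b) = piece_sum (map (\<lambda>(p, c, q, d). (p, Suc c, q, d)) ts) a b" for a b
    by (induction ts) (auto simp: piece_def split: nat.splits)
  then have "(\<lambda>a b. case a of 0 \<Rightarrow> 0 | Suc a' \<Rightarrow> f a' b) = piece_sum (map (\<lambda>(p, c, q, d). (p, Suc c, q, d)) ts)"
    unfolding f by (intro ext)
  then show ?thesis unfolding piecewise_binomial_def by blast
qed

lemma sum_bin_shift:
  "(\<Sum>v\<le>a. if c \<le> v then bin p (v - c) else 0) = (if c \<le> a then bin (Suc p) (a - c) else 0)"
proof (cases "c \<le> a")
  case True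
  have "(\<Sum>v\<le>a. if c \<le> v then bin p (v - c) else 0) = (\<Sum>v\<in>{c..a}. bin p (v - c))"
    by (subst sum.inter_filter[symmetric]) (auto intro!: sum.cong)
  also have "\<dots> = (\<Sum>v\<le>a - c. bin p v)"
    by (rule sum.reindex_bij_witness[of _ "\<lambda>v. v + c" "\<lambda>v. v - c"]) (use True in auto)
  finally show ?thesis using True sum_bin by simp
qed auto

text \<open>Partial sums in \<open>a\<close> are the effect of adjoining one more variable of
  bidegree (1, 0), so only \<open>p\<close> grows.\<close>

lemma piecewise_binomial_sum:
  assumes "piecewise_binomial f"
  shows "piecewise_binomial (\<lambda>a b. \<Sum>v\<le>a. f v b)"
proof -
  obtain ts where f: "f = piece_sum ts" using assms unfolding piecewise_binomial_def by auto
  have "(\<Sum>v\<le>a. piece_sum ts v b) = piece_sum (map (\<lambda>(p, c, q, d). (Suc p, c, q, d)) ts) a b" for a b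
  proof (induction ts)
    case (Cons t ts)
    obtain p c q d where t: "t = (p, c, q, d)" by (cases t) auto
    have "(\<Sum>v\<le>a. piece t v b) = piece (Suc p, c, q, d) a b"
      unfolding t piece_def prod.case sum_distrib_right[symmetric] sum_bin_shift by simp
    then show ?case using Cons t by (simp add: sum.distrib)
  qed simp
  then have "(\<lambda>a b. \<Sum>v\<le>a. f v b) = piece_sum (map (\<lambda>(p, c, q, d). (Suc p, c, q, d)) ts)"
    by (simp add: fun_eq_iff f)
  then show ?thesis unfolding piecewise_binomial_def by blast
qed

text \<open>This is the shape of a count sliced by the exponent of one variable. Slices before
  \<open>v0\<close> are split off one at a time by a shift; once the slices are constant, what
  remains is an ordinary partial sum.\<close>

lemma piecewise_binomial_stable_sum:
  assumes "\<And>v. piecewise_binomial (F v)" and "\<And>v. v0 \<le> v \<Longrightarrow> F v = F v0"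
  shows "piecewise_binomial (\<lambda>a b. \<Sum>v\<le>a. F v (a - v) b)"
  using assms
proof (induction v0 arbitrary: F)
  case 0
  have F: "F v x y = F 0 x y" for v x y by (rule fun_cong[OF fun_cong[OF 0(2)]]) simp
  have "(\<Sum>v\<le>a. F v (a - v) b) = (\<Sum>v\<le>a. F 0 v b)" for a b
    by (rule sum.reindex_bij_witness[of _ "\<lambda>v. a - v" "\<lambda>v. a - v"]) (auto intro: F[symmetric])
  then show ?case using piecewise_binomial_sum[OF 0(1)[of 0]] by simp
next
  case (Suc v0)
  have IH: "piecewise_binomial (\<lambda>a b. \<Sum>v\<le>a. F (Suc v) (a - v) b)"
    by (rule Suc.IH, rule Suc.prems(1), rule Suc.prems(2), simp)
  have "(\<Sum>v\<le>a. F v (a - v) b) = F 0 a b + (case a of 0 \<Rightarrow> 0 | Suc a' \<Rightarrow> \<Sum>v\<le>a'. F (Suc v) (a' - v) b)" for a b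
    by (cases a) (simp_all del: sum.atMost_Suc add: sum.atMost_Suc_shift)
  then show ?case
    using piecewise_binomial_add[OF Suc.prems(1)[of 0] piecewise_binomial_shift[OF IH]] by simp
qed

section \<open>Dickson's lemma and downsets of exponents\<close>

lemma nat_nondecreasing_subseq:
  fixes f :: "nat \<Rightarrow> nat"
  obtains r :: "nat \<Rightarrow> nat" where "strict_mono r" "\<And>i j. i \<le> j \<Longrightarrow> f (r i) \<le> f (r j)"
proof -
  \<comment> \<open>If the monotone subsequence decreases, it is constant from the index of its
    minimum on.\<close>
  obtain r where r: "strict_mono r" "monoseq (\<lambda>n. f (r n))" using seq_monosub by blast
  show ?thesis
  proof (cases "incseq (\<lambda>n. f (r n))")
    case True
    then show ?thesis using that r(1) by (auto simp: incseq_def)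
  next
    case False
    then have dec: "decseq (\<lambda>n. f (r n))" using r(2) by (auto simp: monoseq_iff)
    define N where "N = (ARG_MIN (\<lambda>n. f (r n)) n. True)"
    have N: "f (r N) \<le> f (r n)" for n
      unfolding N_def by (rule arg_min_nat_le) simp
    have eq: "f (r (n + N)) = f (r N)" for n
      using N[of "n + N"] decseqD[OF dec, of N "n + N"] by simp
    have "strict_mono (\<lambda>n. r (n + N))" using r(1) by (auto simp: strict_mono_def)
    then show ?thesis using that[of "\<lambda>n. r (n + N)"] eq by simp
  qed
qed

text \<open>Dickson's lemma in the form that selects a subsequence: refine first for the heads, then
  by induction for the tails.\<close>

lemma dickson_subseq:
  fixes f :: "nat \<Rightarrow> nat list"
  assumes "\<And>i. length (f i) = m"
  shows "\<exists>r :: nat \<Rightarrow> nat. strict_mono r \<and> (\<forall>i j. i \<le> j \<longrightarrow> list_all2 (\<le>) (f (r i)) (f (r j)))"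
  using assms
proof (induction m arbitrary: f)
  case 0
  then show ?case by (intro exI[of _ "\<lambda>n. n"]) (simp add: strict_mono_def)
next
  case (Suc m)
  obtain r1 :: "nat \<Rightarrow> nat" where r1: "strict_mono r1" "\<And>i j. i \<le> j \<Longrightarrow> hd (f (r1 i)) \<le> hd (f (r1 j))"
    using nat_nondecreasing_subseq[of "\<lambda>i. hd (f i)"] by blast
  have "\<exists>r :: nat \<Rightarrow> nat. strict_mono r \<and> (\<forall>i j. i \<le> j \<longrightarrow> list_all2 (\<le>) (tl (f (r1 (r i)))) (tl (f (r1 (r j)))))"
    by (rule Suc.IH) (use Suc.prems in simp)
  then obtain r2 :: "nat \<Rightarrow> nat" where r2: "strict_mono r2"
    "\<And>i j. i \<le> j \<Longrightarrow> list_all2 (\<le>) (tl (f (r1 (r2 i)))) (tl (f (r1 (r2 j))))" by blast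
  have f: "f i = hd (f i) # tl (f i)" for i
    using Suc.prems[of i] by (cases "f i") auto
  have "list_all2 (\<le>) (f (r1 (r2 i))) (f (r1 (r2 j)))" if "i \<le> j" for i j
    by (subst (1 2) f) (use that r2 r1(2) strict_mono_less_eq[OF r2(1)] in auto)
  moreover have "strict_mono (r1 \<circ> r2)" using r1(1) r2(1) by (rule strict_mono_o)
  ultimately show ?case unfolding o_def by blast
qed

text \<open>In a chain that never stabilises, choose a point that leaves at each drop. By Dickson's
  lemma one of these points lies below a later one, and downward closure would keep it in the set
  that it has left.\<close>

lemma downset_chain_stable:
  fixes D :: "nat \<Rightarrow> nat list set"
  assumes len: "\<And>v x. x \<in> D v \<Longrightarrow> length x = m"
    and down: "\<And>v x y. x \<in> D v \<Longrightarrow> list_all2 (\<le>) y x \<Longrightarrow> y \<in> D v"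
    and dec: "\<And>v w. v \<le> w \<Longrightarrow> D w \<subseteq> D v"
  shows "\<exists>v0. \<forall>v\<ge>v0. D v = D v0"
proof (rule ccontr)
  assume "\<not> ?thesis"
  then have "\<exists>w x. v \<le> w \<and> x \<in> D v \<and> x \<notin> D w" for v using dec by blast
  then obtain nx x where nx: "\<And>v. v \<le> nx v" "\<And>v. x v \<in> D v" "\<And>v. x v \<notin> D (nx v)" by metis
  define s where "s n = (nx ^^ n) 0" for n
  have s: "nx (s n) = s (Suc n)" for n by (simp add: s_def)
  have smono: "s i \<le> s j" if "i \<le> j" for i j
    using that by (induction rule: dec_induct) (auto simp: s[symmetric] intro: order.trans nx(1))
  obtain r :: "nat \<Rightarrow> nat" where r: "strict_mono r" "\<And>i j. i \<le> j \<Longrightarrow> list_all2 (\<le>) (x (s (r i))) (x (s (r j)))"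
    using dickson_subseq[of "\<lambda>n. x (s n)" m, OF len[OF nx(2)]] by blast
  have "Suc (r 0) \<le> r 1" using r(1) by (simp add: strict_mono_def Suc_leI)
  then have "D (s (r 1)) \<subseteq> D (s (Suc (r 0)))" by (intro dec smono)
  then have "x (s (r 1)) \<in> D (s (Suc (r 0)))" using nx(2) by blast
  then have "x (s (r 0)) \<in> D (s (Suc (r 0)))" by (rule down) (rule r(2), simp)
  then show False using nx(3)[of "s (r 0)"] s by simp
qed

text \<open>The entries of a list are exponents; \<open>cs\<close> tells which variables have bidegree \<open>(1, 0)\<close> (\<open>True\<close>)
  and which have bidegree \<open>(0, 1)\<close> (\<open>False\<close>).\<close>

fun cdeg :: "bool \<Rightarrow> bool list \<Rightarrow> nat list \<Rightarrow> nat" where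
  "cdeg c (x # xs) (y # ys) = (if x = c then y else 0) + cdeg c xs ys"
| "cdeg c _ _ = 0"

lemma finite_cdeg:
  "finite {al. length al = length cs \<and> cdeg True cs al = a \<and> cdeg False cs al = b}"
proof -
  have "set al \<subseteq> {..cdeg True cs al + cdeg False cs al}" if "length al = length cs" for al
    using that by (induction al cs rule: list_induct2) auto
  then have "{al. length al = length cs \<and> cdeg True cs al = a \<and> cdeg False cs al = b}
     \<subseteq> {al. set al \<subseteq> {..a + b} \<and> length al = length cs}" by auto
  then show ?thesis by (rule finite_subset) (simp add: finite_lists_length_eq)
qed

text \<open>Slice by the exponent \<open>v\<close> of the first variable. Downward closure makes the
  slices \<open>E v\<close> decrease in \<open>v\<close>, hence they stabilise, and each slice is a
  downset in one variable less.\<close>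

lemma downset_count_piecewise_binomial:
  assumes "\<And>x. x \<in> D \<Longrightarrow> length x = length cs"
    and "\<And>x y. x \<in> D \<Longrightarrow> list_all2 (\<le>) y x \<Longrightarrow> y \<in> D"
  shows "piecewise_binomial (\<lambda>a b. card {al \<in> D. cdeg True cs al = a \<and> cdeg False cs al = b})"
  using assms
proof (induction cs arbitrary: D)
  case Nil
  show ?case
  proof (cases "[] \<in> D")
    case True
    then have D: "D = {[]}" using Nil by auto
    have "(\<lambda>a b. card {al \<in> D. cdeg True [] al = a \<and> cdeg False [] al = b}) = piece_sum [(0,0,0,0)]"
      by (auto simp: fun_eq_iff D piece_def bin_def)
    then show ?thesis unfolding piecewise_binomial_def by blast
  next
    case False
    then have "D = {}" using Nil by auto
    then show ?thesis using piecewise_binomial_zero by simp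
  qed
next
  case (Cons c cs)
  define E where "E v = {al. v # al \<in> D}" for v
  define h where "h v a b = card {al \<in> E v. cdeg True cs al = a \<and> cdeg False cs al = b}" for v a b
  have E1: "length x = length cs" if "x \<in> E v" for v x using Cons.prems(1) that by (force simp: E_def)
  have E2: "y \<in> E v" if "x \<in> E v" "list_all2 (\<le>) y x" for v x y
    using Cons.prems(2)[of "v # x" "v # y"] that by (auto simp: E_def)
  have E3: "E w \<subseteq> E v" if "v \<le> w" for v w
  proof
    fix x assume "x \<in> E w"
    then show "x \<in> E v" using Cons.prems(2)[of "w # x" "v # x"] that
      by (auto simp: E_def list_all2_refl)
  qed
  have h: "piecewise_binomial (h v)" for v
    unfolding h_def by (rule Cons.IH) (use E1 E2 in auto)
  have "\<exists>v0. \<forall>v\<ge>v0. E v = E v0"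
    by (rule downset_chain_stable[of E "length cs"]) (use E1 E2 E3 in blast)+
  then obtain v0 where v0: "\<And>v. v0 \<le> v \<Longrightarrow> E v = E v0" by blast
  have hv0: "h v = h v0" if "v0 \<le> v" for v using v0[OF that] by (simp add: h_def fun_eq_iff)
  have fin: "finite {al \<in> E v. cdeg True cs al = a \<and> cdeg False cs al = b}" for v a b
    by (rule finite_subset[OF _ finite_cdeg[of cs a b]]) (use E1 in auto)
  have Dc: "x \<in> D \<longleftrightarrow> (\<exists>v y. x = v # y \<and> y \<in> E v)" for x
    using Cons.prems(1)[of x] by (cases x) (auto simp: E_def)
  \<comment> \<open>One counting rule for both colours of the first variable: \<open>P\<close> fixes
    the bidegree, and \<open>X v\<close> is the part of the slice \<open>E v\<close> in the bidegree
    that remains after subtracting \<open>v\<close>.\<close>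
  have hsum: "card {al \<in> D. P al} = (\<Sum>v\<le>a. card (X v))"
    if "\<And>v. finite (X v)" and "\<And>v y. y \<in> E v \<and> P (v # y) \<longleftrightarrow> v \<le> a \<and> y \<in> X v" for P X a
  proof -
    have "{al \<in> D. P al} = (\<lambda>(v, y). v # y) ` (SIGMA v:{..a}. X v)"
      using that(2) by (fastforce simp: Dc image_iff)
    then show ?thesis
      using that(1) by (simp add: card_image inj_on_def split_beta prod_eq_iff)
  qed
  show ?case
  proof (cases c)
    case True
    have "card {al \<in> D. cdeg True (c # cs) al = a \<and> cdeg False (c # cs) al = b} = (\<Sum>v\<le>a. h v (a - v) b)" for a b
      unfolding h_def by (rule hsum) (auto simp: True fin)
    moreover have "piecewise_binomial (\<lambda>a b. \<Sum>v\<le>a. h v (a - v) b)"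
      by (rule piecewise_binomial_stable_sum[of h v0], rule h, erule hv0)
    ultimately show ?thesis by simp
  next
    case False
    have "card {al \<in> D. cdeg True (c # cs) al = a \<and> cdeg False (c # cs) al = b} = (\<Sum>v\<le>b. h v a (b - v))" for a b
      unfolding h_def by (rule hsum) (auto simp: False fin)
    moreover have "piecewise_binomial (\<lambda>a b. \<Sum>v\<le>a. h v b (a - v))"
      by (rule piecewise_binomial_stable_sum[of "\<lambda>v a b. h v b a" v0])
         (rule piecewise_binomial_swap[OF h], rule arg_cong[where f = "\<lambda>f a b. f b a", OF hv0])
    then have "piecewise_binomial (\<lambda>a b. \<Sum>v\<le>b. h v a (b - v))"
      by (rule piecewise_binomial_swap)
    ultimately show ?thesis by (simp only:)
  qed
qed


section \<open>The lexicographic order as a monomial order\<close>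

fun lexlt :: "nat list \<Rightarrow> nat list \<Rightarrow> bool" where
  "lexlt (x # xs) (y # ys) \<longleftrightarrow> x < y \<or> x = y \<and> lexlt xs ys"
| "lexlt _ _ \<longleftrightarrow> False"

lemma lexlt_total: "length xs = length ys \<Longrightarrow> xs \<noteq> ys \<Longrightarrow> lexlt xs ys \<or> lexlt ys xs"
  by (induction xs ys rule: list_induct2) auto

lemma lexlt_add:
  "length xs = length ys \<Longrightarrow> length ys = length zs \<Longrightarrow> lexlt xs ys \<Longrightarrow>
     lexlt (map2 (+) xs zs) (map2 (+) ys zs)"
  by (induction xs ys zs rule: list_induct3) auto

text \<open>On lists of fixed length the order is well-founded: minimise the head first, then the
  tail. This provides a least representation for every element.\<close>

lemma lexlt_minimal:
  assumes "length xs = m" "P xs"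
  shows "\<exists>xs. length xs = m \<and> P xs \<and> (\<forall>ys. length ys = m \<and> P ys \<longrightarrow> \<not> lexlt ys xs)"
  using assms
proof (induction m arbitrary: P xs)
  case 0
  then show ?case by auto
next
  case (Suc m)
  define h where "h = (LEAST h. \<exists>t. length t = m \<and> P (h # t))"
  have ex: "\<exists>h t. length t = m \<and> P (h # t)" using Suc.prems by (cases xs) auto
  then have "\<exists>t. length t = m \<and> P (h # t)" unfolding h_def by (rule LeastI_ex)
  then obtain t0 where "length t0 = m" "P (h # t0)" by blast
  from Suc.IH[of t0 "\<lambda>t. P (h # t)", OF this] obtain t where
    t: "length t = m" "P (h # t)" "\<And>ys. length ys = m \<Longrightarrow> P (h # ys) \<Longrightarrow> \<not> lexlt ys t" by blast
  have "\<not> lexlt ys (h # t)" if ys: "length ys = Suc m" "P ys" for ys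
  proof -
    obtain g u where gu: "ys = g # u" "length u = m" using ys by (cases ys) auto
    have "h \<le> g" unfolding h_def by (rule Least_le) (use gu ys in blast)
    then show ?thesis using t(3)[of u] gu ys by auto
  qed
  then show ?case using t by (intro exI[of _ "h # t"]) auto
qed

lemma cdeg_add:
  "length xs = length cs \<Longrightarrow> length ys = length cs \<Longrightarrow>
     cdeg c cs (map2 (+) xs ys) = cdeg c cs xs + cdeg c cs ys"
proof (induction cs arbitrary: xs ys)
  case (Cons d cs)
  then show ?case by (cases xs; cases ys) auto
qed auto

text \<open>Each element is counted through its lexicographically least representation; the least
  representations form a downset.\<close>

lemma graded_count_piecewise_binomial:
  fixes val :: "nat list \<Rightarrow> 'a" and U :: "nat \<Rightarrow> nat \<Rightarrow> 'a set"
  assumes rep: "\<And>a b x. x \<in> U a b \<Longrightarrow>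
        \<exists>al. length al = length cs \<and> cdeg True cs al = a \<and> cdeg False cs al = b \<and> val al = x"
    and down: "\<And>al ga. length al = length cs \<Longrightarrow> length ga = length cs \<Longrightarrow>
        val (map2 (+) al ga) \<in> U (cdeg True cs al + cdeg True cs ga) (cdeg False cs al + cdeg False cs ga) \<Longrightarrow>
        val al \<in> U (cdeg True cs al) (cdeg False cs al)"
    and cong: "\<And>al be ga. length al = length cs \<Longrightarrow> length be = length cs \<Longrightarrow> length ga = length cs \<Longrightarrow>
        val al = val be \<Longrightarrow> val (map2 (+) al ga) = val (map2 (+) be ga)"
  shows "piecewise_binomial (\<lambda>a b. card (U a b))"
proof -
  define eqv where "eqv al be \<longleftrightarrow> length be = length cs \<and> cdeg True cs be = cdeg True cs al \<and>
      cdeg False cs be = cdeg False cs al \<and> val be = val al" for al be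
  define D where "D = {al. length al = length cs \<and> val al \<in> U (cdeg True cs al) (cdeg False cs al) \<and>
      (\<forall>be. eqv al be \<longrightarrow> \<not> lexlt be al)}"
  have len: "length x = length cs" if "x \<in> D" for x using that by (simp add: D_def)
  have dn: "be \<in> D" if al: "al \<in> D" and le: "list_all2 (\<le>) be al" for al be
  proof -
    have lb: "length be = length cs" using al le by (simp add: D_def list_all2_lengthD)
    define ga where "ga = map2 (-) al be"
    have lg: "length ga = length cs" using al lb by (simp add: ga_def D_def)
    have al_eq: "al = map2 (+) be ga" unfolding ga_def
      by (rule nth_equalityI) (use al lb le in \<open>auto simp: D_def list_all2_conv_all_nth\<close>)
    have v: "val be \<in> U (cdeg True cs be) (cdeg False cs be)"
      by (rule down[OF lb lg]) (use al lb lg in \<open>simp add: D_def al_eq cdeg_add\<close>)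
    \<comment> \<open>A smaller representation of \<open>be\<close> stays smaller after adding
      \<open>ga\<close>, and by \<open>cong\<close> it then represents the value of
      \<open>al\<close>, against the minimality of \<open>al\<close>.\<close>
    have "\<not> lexlt be' be" if e: "eqv be be'" for be'
    proof
      assume lt: "lexlt be' be"
      have lb': "length be' = length cs" using e by (simp add: eqv_def)
      have "lexlt (map2 (+) be' ga) al" unfolding al_eq
        by (rule lexlt_add) (use lb lb' lg lt in auto)
      moreover have "eqv al (map2 (+) be' ga)"
        using e cong[OF lb lb' lg] lb lb' lg by (auto simp: eqv_def al_eq cdeg_add)
      ultimately show False using al by (auto simp: D_def)
    qed
    then show ?thesis using v lb by (auto simp: D_def)
  qed
  have "bij_betw val {al \<in> D. cdeg True cs al = a \<and> cdeg False cs al = b} (U a b)" for a b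
    unfolding bij_betw_def
  proof
    show "inj_on val {al \<in> D. cdeg True cs al = a \<and> cdeg False cs al = b}"
    proof (rule inj_onI)
      fix x y assume x: "x \<in> {al \<in> D. cdeg True cs al = a \<and> cdeg False cs al = b}"
        and y: "y \<in> {al \<in> D. cdeg True cs al = a \<and> cdeg False cs al = b}" and v: "val x = val y"
      have "eqv x y" "eqv y x" using x y v by (auto simp: eqv_def D_def)
      then have "\<not> lexlt y x" "\<not> lexlt x y" using x y by (auto simp: D_def)
      then show "x = y" using lexlt_total[of x y] x y by (auto simp: D_def)
    qed
    show "val ` {al \<in> D. cdeg True cs al = a \<and> cdeg False cs al = b} = U a b"
    proof
      show "val ` {al \<in> D. cdeg True cs al = a \<and> cdeg False cs al = b} \<subseteq> U a b"
        by (auto simp: D_def)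
      show "U a b \<subseteq> val ` {al \<in> D. cdeg True cs al = a \<and> cdeg False cs al = b}"
      proof
        fix x assume x: "x \<in> U a b"
        obtain al where "length al = length cs" "cdeg True cs al = a \<and> cdeg False cs al = b \<and> val al = x"
          using rep[OF x] by blast
        from lexlt_minimal[of al "length cs" "\<lambda>al. cdeg True cs al = a \<and> cdeg False cs al = b \<and> val al = x", OF this]
        obtain be where be: "length be = length cs" "cdeg True cs be = a" "cdeg False cs be = b" "val be = x"
          "\<And>ys. length ys = length cs \<Longrightarrow> cdeg True cs ys = a \<Longrightarrow> cdeg False cs ys = b \<Longrightarrow> val ys = x \<Longrightarrow> \<not> lexlt ys be"
          by blast
        then have "be \<in> D" using x by (auto simp: D_def eqv_def)
        then show "x \<in> val ` {al \<in> D. cdeg True cs al = a \<and> cdeg False cs al = b}" using be by auto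
      qed
    qed
  qed
  then have "card (U a b) = card {al \<in> D. cdeg True cs al = a \<and> cdeg False cs al = b}" for a b
    by (rule bij_betw_same_card[symmetric])
  then show ?thesis using downset_count_piecewise_binomial[of D cs, OF len dn] by simp
qed

section \<open>Sets of exponents\<close>

text \<open>Monomial ideals are represented by their sets of exponents: \<open>mm t\<close> stands for \<open>\<mm>\<^sup>t\<close>, \<open>msum\<close> for the
  product of ideals and \<open>npow\<close> for powers (with the unit ideal as zeroth power).\<close>

definition deg :: "nat ^ 'n \<Rightarrow> nat" where
  "deg k = (\<Sum>j\<in>UNIV. k $ j)"

definition upset :: "(nat ^ 'n) set \<Rightarrow> bool" where
  "upset U \<longleftrightarrow> (\<forall>k\<in>U. \<forall>l. k + l \<in> U)"

definition mm :: "nat \<Rightarrow> (nat ^ 'n) set" where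
  "mm t = {k. t \<le> deg k}"

definition msum :: "(nat ^ 'n) set \<Rightarrow> (nat ^ 'n) set \<Rightarrow> (nat ^ 'n) set" where
  "msum U V = {u + v | u v. u \<in> U \<and> v \<in> V}"

primrec npow :: "(nat ^ 'n) set \<Rightarrow> nat \<Rightarrow> (nat ^ 'n) set" where
  "npow U 0 = UNIV"
| "npow U (Suc a) = msum (npow U a) U"

lemma deg_add [simp]: "deg (k + l) = deg k + deg l"
  by (simp add: deg_def sum.distrib)

lemma deg_zero [simp]: "deg 0 = 0"
  by (simp add: deg_def)

lemma deg_axis [simp]: "deg (axis j m) = m"
  by (simp add: deg_def axis_def)

lemma component_le_deg: "k $ j \<le> deg k"
  unfolding deg_def by (rule member_le_sum) auto

lemma deg_eq_0_iff: "deg k = 0 \<longleftrightarrow> k = 0"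
  by (auto simp: deg_def vec_eq_iff)

lemma vec_le_iff_add: "(k :: nat ^ 'n) \<le> l \<longleftrightarrow> (\<exists>m. l = k + m)"
proof
  assume "k \<le> l"
  then have "l = k + (l - k)" by (simp add: vec_eq_iff less_eq_vec_def)
  then show "\<exists>m. l = k + m" by blast
qed (auto simp: less_eq_vec_def)

lemma upsetD: "upset U \<Longrightarrow> k \<in> U \<Longrightarrow> k + l \<in> U" "upset U \<Longrightarrow> k \<in> U \<Longrightarrow> l + k \<in> U"
  by (auto simp: upset_def add.commute)

lemma upset_le: "upset U \<Longrightarrow> k \<in> U \<Longrightarrow> k \<le> l \<Longrightarrow> l \<in> U"
  by (auto simp: upset_def vec_le_iff_add)

lemma upset_UNIV [simp]: "upset UNIV" and upset_mm [simp]: "upset (mm t)"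
  by (auto simp: upset_def mm_def)

lemma mm_0 [simp]: "mm 0 = UNIV"
  by (simp add: mm_def)

lemma mm_antimono: "s \<le> t \<Longrightarrow> mm t \<subseteq> mm s"
  by (auto simp: mm_def)

lemma upset_Un: "upset U \<Longrightarrow> upset V \<Longrightarrow> upset (U \<union> V)"
  by (auto simp: upset_def)

lemma exists_le_deg_eq:
  assumes "t \<le> deg k"
  shows "\<exists>l m. k = l + m \<and> deg l = t"
  using assms
proof (induction t)
  case 0
  then show ?case by (intro exI[of _ 0] exI[of _ k]) simp
next
  case (Suc t)
  then obtain l m where lm: "k = l + m" "deg l = t" by auto
  then have "deg m \<noteq> 0" using Suc.prems by auto
  then obtain j where j: "m $ j \<noteq> 0" by (auto simp: deg_eq_0_iff vec_eq_iff)
  have "m = axis j 1 + (m - axis j 1)" using j by (auto simp: vec_eq_iff axis_def)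
  then have "k = (l + axis j 1) + (m - axis j 1)" by (simp add: lm add.assoc)
  then show ?case using lm by (intro exI[of _ "l + axis j 1"] exI[of _ "m - axis j 1"]) simp
qed

lemma finite_vec_box:
  shows "finite {k :: nat ^ 'n. \<forall>j. k $ j < N j}"
    and "card {k :: nat ^ 'n. \<forall>j. k $ j < N j} = (\<Prod>j\<in>UNIV. N j)"
proof -
  have bij: "bij_betw vec_nth {k :: nat ^ 'n. \<forall>j. k $ j < N j} (PiE UNIV (\<lambda>j. {..<N j}))"
    by (rule bij_betwI[of _ _ _ vec_lambda]) (auto simp: PiE_def)
  then show "finite {k :: nat ^ 'n. \<forall>j. k $ j < N j}"
    using bij_betw_finite[OF bij] by (simp add: finite_PiE)
  show "card {k :: nat ^ 'n. \<forall>j. k $ j < N j} = (\<Prod>j\<in>UNIV. N j)"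
    using bij_betw_same_card[OF bij] by (simp add: card_PiE)
qed

lemma card_deg_less: "finite {k :: nat ^ 'n. deg k < N}" "card {k :: nat ^ 'n. deg k < N} \<le> N ^ CARD('n)"
proof -
  have sub: "{k :: nat ^ 'n. deg k < N} \<subseteq> {k. \<forall>j. k $ j < N}"
    by (auto intro: le_less_trans[OF component_le_deg])
  show "finite {k :: nat ^ 'n. deg k < N}" by (rule finite_subset[OF sub finite_vec_box(1)])
  have "card {k :: nat ^ 'n. deg k < N} \<le> card {k :: nat ^ 'n. \<forall>j. k $ j < N}"
    by (rule card_mono[OF finite_vec_box(1) sub])
  then show "card {k :: nat ^ 'n. deg k < N} \<le> N ^ CARD('n)" by (simp add: finite_vec_box(2))
qed

text \<open>A degree above the sum of all missing degrees cannot be missing. Read algebraically,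
  finite colength means containing a power of the maximal ideal; the later estimates are stated in
  terms of such a \<open>d\<close>.\<close>

lemma finite_Compl_iff:
  assumes "upset (U :: (nat ^ 'n) set)"
  shows "finite (- U) \<longleftrightarrow> (\<exists>d. mm d \<subseteq> U)"
proof
  assume fin: "finite (- U)"
  have "k \<in> U" if "Suc (\<Sum>l\<in>- U. deg l) \<le> deg k" for k
  proof (rule ccontr)
    assume "k \<notin> U"
    then have "deg k \<le> (\<Sum>l\<in>- U. deg l)" by (intro member_le_sum) (use fin in auto)
    then show False using that by simp
  qed
  then show "\<exists>d. mm d \<subseteq> U" by (auto simp: mm_def)
next
  assume "\<exists>d. mm d \<subseteq> U"
  then obtain d where "mm d \<subseteq> U" by blast
  then have "- U \<subseteq> {k. deg k < d}" by (auto simp: mm_def not_le[symmetric])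
  then show "finite (- U)" by (rule finite_subset[OF _ card_deg_less(1)])
qed

lemma msumI: "u \<in> U \<Longrightarrow> v \<in> V \<Longrightarrow> u + v \<in> msum U V"
  by (auto simp: msum_def)

lemma msumE: "k \<in> msum U V \<Longrightarrow> (\<And>u v. k = u + v \<Longrightarrow> u \<in> U \<Longrightarrow> v \<in> V \<Longrightarrow> P) \<Longrightarrow> P"
  by (auto simp: msum_def)

lemma msum_commute: "msum U V = msum V U"
  unfolding msum_def by (auto intro: add.commute)

lemma msum_assoc: "msum (msum U V) W = msum U (msum V W)"
proof -
  have 1: "(u + v) + w \<in> msum U (msum V W)" if "u \<in> U" "v \<in> V" "w \<in> W" for u v w
    unfolding add.assoc using that by (intro msumI)
  have 2: "u + (v + w) \<in> msum (msum U V) W" if "u \<in> U" "v \<in> V" "w \<in> W" for u v w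
    unfolding add.assoc[symmetric] using that by (intro msumI)
  have "x \<in> msum U (msum V W)" if "x \<in> msum (msum U V) W" for x
    using that by (auto elim!: msumE intro: 1)
  moreover have "x \<in> msum (msum U V) W" if "x \<in> msum U (msum V W)" for x
    using that by (auto elim!: msumE intro: 2)
  ultimately show ?thesis by blast
qed

lemma msum_mono: "U \<subseteq> U' \<Longrightarrow> V \<subseteq> V' \<Longrightarrow> msum U V \<subseteq> msum U' V'"
  by (fastforce simp: msum_def)

lemma upset_msum: "upset V \<Longrightarrow> upset (msum U V)"
  unfolding upset_def msum_def by (clarsimp simp: add.assoc) blast

lemma msum_UNIV [simp]: "upset U \<Longrightarrow> msum U UNIV = U" "upset U \<Longrightarrow> msum UNIV U = U"
proof -
  show "msum U UNIV = U" if "upset U"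
  proof
    show "U \<subseteq> msum U UNIV" using msumI[of _ U 0 UNIV] by auto
  qed (use that in \<open>auto simp: msum_def upset_def\<close>)
  then show "msum UNIV U = U" if "upset U" using that by (simp add: msum_commute)
qed

lemma msum_mm: "msum (mm s) (mm t) = mm (s + t)"
proof
  show "msum (mm s) (mm t) \<subseteq> mm (s + t)" by (auto simp: msum_def mm_def)
  show "mm (s + t) \<subseteq> msum (mm s) (mm t)"
  proof
    fix k :: "nat ^ 'n" assume "k \<in> mm (s + t)"
    then have k: "s + t \<le> deg k" by (simp add: mm_def)
    then obtain l m where "k = l + m" "deg l = s" using exists_le_deg_eq[of s k] by auto
    then show "k \<in> msum (mm s) (mm t)" using k by (auto simp: mm_def intro!: msumI)
  qed
qed

lemma upset_npow [simp]: "upset U \<Longrightarrow> upset (npow U a)"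
  by (cases a) (auto intro: upset_msum)

lemma npow_add: "upset U \<Longrightarrow> msum (npow U a) (npow U b) = npow U (a + b)"
  by (induction b) (simp_all add: msum_assoc[symmetric])

lemma npow_mm: "npow (mm t) a = mm (t * a)"
  by (induction a) (simp_all add: msum_mm add.commute)

lemma npow_mono: "U \<subseteq> V \<Longrightarrow> npow U a \<subseteq> npow V a"
  by (induction a) (auto dest: msum_mono)

lemma npow_UNIV [simp]: "npow UNIV a = UNIV"
  using npow_mm[of 0 a] by simp

lemma msum_npow_mm_mono:
  assumes "mm d \<subseteq> U"
  shows "mm (d * a + b) \<subseteq> msum (npow U a) (mm b)"
proof -
  have "mm (d * a) \<subseteq> npow U a" using npow_mono[OF assms, of a] by (simp add: npow_mm)
  then have "msum (mm (d * a)) (mm b) \<subseteq> msum (npow U a) (mm b)" by (rule msum_mono) simp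
  then show ?thesis by (simp add: msum_mm)
qed

text \<open>An element of degree above \<open>d\<close> has a divisor of degree exactly
  \<open>d\<close>, which lies in \<open>mm d\<close>. Hence the elements of degree at most
  \<open>d\<close> form a finite generating set.\<close>

lemma generator_le:
  assumes "upset U" "mm d \<subseteq> U" "k \<in> U"
  shows "\<exists>g l. k = g + l \<and> g \<in> U \<and> deg g \<le> d"
proof (cases "deg k \<le> d")
  case True
  then show ?thesis using assms by (intro exI[of _ k] exI[of _ 0]) simp
next
  case False
  then obtain l m where "k = l + m" "deg l = d" using exists_le_deg_eq[of d k] by auto
  then show ?thesis using assms(2) by (auto simp: mm_def)
qed

section \<open>Hilbert functions of finitely generated bigraded modules\<close>

text \<open>The monomials of a bigraded algebra whose generators are tagged with bidegree (1, 0) or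
  (0, 1). The bidegree is recorded beside the monomial because the monomial alone need not determine
  it.\<close>

inductive_set graded_span :: "(bool \<times> 'a :: comm_monoid_add) set \<Rightarrow> (nat \<times> nat \<times> 'a) set"
  for S where
  zero: "(0, 0, 0) \<in> graded_span S"
| stepT: "(a, b, x) \<in> graded_span S \<Longrightarrow> (True, g) \<in> S \<Longrightarrow> (Suc a, b, g + x) \<in> graded_span S"
| stepF: "(a, b, x) \<in> graded_span S \<Longrightarrow> (False, g) \<in> S \<Longrightarrow> (a, Suc b, g + x) \<in> graded_span S"

lemma graded_span_add:
  assumes "(a, b, x) \<in> graded_span S" "(a', b', x') \<in> graded_span S"
  shows "(a + a', b + b', x + x') \<in> graded_span S"
  using assms
proof (induction a b x rule: graded_span.induct)
  case (stepT a b x g)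
  then show ?case using graded_span.stepT[of "a + a'" "b + b'" "x + x'" S g] by (simp add: add.assoc)
next
  case (stepF a b x g)
  then show ?case using graded_span.stepF[of "a + a'" "b + b'" "x + x'" S g] by (simp add: add.assoc)
qed simp

lemma graded_span_gen:
  "(True, g) \<in> S \<Longrightarrow> (1, 0, g) \<in> graded_span S"
  "(False, g) \<in> S \<Longrightarrow> (0, 1, g) \<in> graded_span S"
  using graded_span.stepT[OF graded_span.zero, of g S] graded_span.stepF[OF graded_span.zero, of g S] by auto

fun lincomb :: "'a :: comm_monoid_add list \<Rightarrow> nat list \<Rightarrow> 'a" where
  "lincomb (g # gs) (n # ns) = (\<Sum>i<n. g) + lincomb gs ns"
| "lincomb _ _ = 0"

lemma lincomb_add:
  "length xs = length gs \<Longrightarrow> length ys = length gs \<Longrightarrow>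
     lincomb gs (map2 (+) xs ys) = lincomb gs xs + lincomb gs ys"
proof (induction gs arbitrary: xs ys)
  case (Cons g gs)
  have s: "(\<Sum>i<m + n. g) = (\<Sum>i<m. g) + (\<Sum>i<n. g)" for m n :: nat
    by (induction n) (simp_all add: add_ac)
  show ?case using Cons by (cases xs; cases ys) (auto simp: s add_ac)
qed auto

lemma lincomb_replicate_0: "lincomb gs (replicate (length gs) 0) = 0"
  by (induction gs) auto

lemma cdeg_replicate_0: "cdeg c cs (replicate (length cs) 0) = 0"
  by (induction cs) auto

lemma lincomb_unit:
  "(c, g) \<in> set gs \<Longrightarrow> \<exists>u. length u = length gs \<and> lincomb (map snd gs) u = g \<and>
     (\<forall>c'. cdeg c' (map fst gs) u = of_bool (c = c'))"
proof (induction gs)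
  case (Cons h gs)
  show ?case
  proof (cases "(c, g) = h")
    case True
    then show ?thesis
      using lincomb_replicate_0[of "map snd gs"] cdeg_replicate_0[of _ "map fst gs"]
      by (intro exI[of _ "1 # replicate (length gs) 0"]) auto
  next
    case False
    then obtain u where "length u = length gs" "lincomb (map snd gs) u = g"
      "\<And>c'. cdeg c' (map fst gs) u = of_bool (c = c')" using Cons by auto
    then show ?thesis by (intro exI[of _ "0 # u"]) auto
  qed
qed auto

text \<open>Presents the algebra as an image of a polynomial ring with one variable for each entry
  of \<open>gs\<close>, the form in which \<open>graded_count_piecewise_binomial\<close>
  applies.\<close>

lemma graded_span_iff_lincomb:
  "(a, b, x) \<in> graded_span (set gs) \<longleftrightarrow>
     (\<exists>al. length al = length gs \<and> cdeg True (map fst gs) al = a \<and> cdeg False (map fst gs) al = b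
       \<and> lincomb (map snd gs) al = x)"
proof
  assume "(a, b, x) \<in> graded_span (set gs)"
  then show "\<exists>al. length al = length gs \<and> cdeg True (map fst gs) al = a \<and> cdeg False (map fst gs) al = b
       \<and> lincomb (map snd gs) al = x"
  proof (induction a b x rule: graded_span.induct)
    case zero
    show ?case
      using lincomb_replicate_0[of "map snd gs"] cdeg_replicate_0[of _ "map fst gs"]
      by (intro exI[of _ "replicate (length gs) 0"]) auto
  next
    case (stepT a b x g)
    obtain u where "length u = length gs" "lincomb (map snd gs) u = g"
        "\<And>c'. cdeg c' (map fst gs) u = of_bool (True = c')" using lincomb_unit[OF stepT.hyps(2)] by auto
    moreover obtain al where "length al = length gs" "cdeg True (map fst gs) al = a"
      "cdeg False (map fst gs) al = b" "lincomb (map snd gs) al = x" using stepT.IH by blast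
    ultimately show ?case
      by (intro exI[of _ "map2 (+) u al"]) (simp add: lincomb_add cdeg_add)
  next
    case (stepF a b x g)
    obtain u where "length u = length gs" "lincomb (map snd gs) u = g"
        "\<And>c'. cdeg c' (map fst gs) u = of_bool (False = c')" using lincomb_unit[OF stepF.hyps(2)] by auto
    moreover obtain al where "length al = length gs" "cdeg True (map fst gs) al = a"
      "cdeg False (map fst gs) al = b" "lincomb (map snd gs) al = x" using stepF.IH by blast
    ultimately show ?case
      by (intro exI[of _ "map2 (+) u al"]) (simp add: lincomb_add cdeg_add)
  qed
next
  have main: "(cdeg True (map fst gs) al, cdeg False (map fst gs) al, lincomb (map snd gs) al) \<in> graded_span S"
    if "set gs \<subseteq> S" "length al = length gs" for al :: "nat list" and S gs
    using that
  proof (induction gs arbitrary: al)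
    case Nil
    then show ?case by (simp add: graded_span.zero)
  next
    case (Cons h gs)
    obtain n ns where al: "al = n # ns" "length ns = length gs" using Cons.prems by (cases al) auto
    obtain c g where h: "h = (c, g)" by (cases h)
    have IH: "(cdeg True (map fst gs) ns, cdeg False (map fst gs) ns, lincomb (map snd gs) ns) \<in> graded_span S"
      using Cons al by auto
    have S: "(if c then n else 0, if c then 0 else n, \<Sum>i<n. g) \<in> graded_span S" for n
    proof (induction n)
      case 0
      then show ?case by (simp add: graded_span.zero)
    next
      case (Suc n)
      have "(c, g) \<in> S" using Cons.prems h by auto
      then show ?case using Suc graded_span.stepT[of n 0 "\<Sum>i<n. g" S g] graded_span.stepF[of 0 n "\<Sum>i<n. g" S g]
        by (cases c) (simp_all add: add.commute)
    qed
    show ?case using graded_span_add[OF S[of n] IH] by (cases c) (simp_all add: al h)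
  qed
  assume "\<exists>al. length al = length gs \<and> cdeg True (map fst gs) al = a \<and> cdeg False (map fst gs) al = b
       \<and> lincomb (map snd gs) al = x"
  then show "(a, b, x) \<in> graded_span (set gs)" using main[of gs "set gs"] by auto
qed

lemma finite_graded_span:
  assumes "finite S"
  shows "finite {x. (a, b, x) \<in> graded_span S}"
proof -
  obtain gs where gs: "S = set gs" using finite_list[OF assms] by auto
  have "{x. (a, b, x) \<in> graded_span S} \<subseteq> lincomb (map snd gs) `
      {al. length al = length (map fst gs) \<and> cdeg True (map fst gs) al = a \<and> cdeg False (map fst gs) al = b}"
    by (auto simp: gs graded_span_iff_lincomb)
  then show ?thesis by (rule finite_surj[OF finite_cdeg])
qed

text \<open>\<open>Th\<close> generates a bigraded module over the algebra of \<open>S\<close>, and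
  \<open>U a b\<close> lists its nonzero monomials; the last hypothesis says that a factor of a
  nonzero monomial is nonzero. Induction on \<open>Th\<close>: \<open>R\<close> is the cyclic
  submodule of one generator, and the other generators take care of the quotient by it.\<close>

lemma module_count_piecewise_binomial:
  fixes Th :: "'a :: comm_monoid_add set"
  assumes "finite S" "finite Th"
    and "\<And>a b x. x \<in> U a b \<Longrightarrow> \<exists>th\<in>Th. \<exists>y. (a, b, y) \<in> graded_span S \<and> x = th + y"
    and "\<And>a b th y a' b' z. th \<in> Th \<Longrightarrow> (a, b, y) \<in> graded_span S \<Longrightarrow> (a', b', z) \<in> graded_span S \<Longrightarrow>
           th + y + z \<in> U (a + a') (b + b') \<Longrightarrow> th + y \<in> U a b"
  shows "piecewise_binomial (\<lambda>a b. card (U a b))"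
  using assms(2-)
proof (induction Th arbitrary: U rule: finite_induct)
  case empty
  then have "U a b = {}" for a b by fastforce
  then show ?case by (simp add: piecewise_binomial_zero)
next
  case (insert th Th)
  obtain gs where gs: "S = set gs" using finite_list[OF assms(1)] by auto
  define R where "R a b = {th + y | y. (a, b, y) \<in> graded_span S}" for a b
  have finU: "finite (U a b)" for a b
  proof -
    have "U a b \<subseteq> (\<Union>th\<in>insert th Th. (+) th ` {y. (a, b, y) \<in> graded_span S})"
    proof
      fix x assume "x \<in> U a b"
      from insert.prems(1)[OF this] obtain th' y
        where "th' \<in> insert th Th" "(a, b, y) \<in> graded_span S" "x = th' + y" by blast
      then show "x \<in> (\<Union>th\<in>insert th Th. (+) th ` {y. (a, b, y) \<in> graded_span S})" by blast
    qed
    then show ?thesis by (rule finite_subset) (use insert.hyps finite_graded_span[OF assms(1)] in auto)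
  qed
  have 1: "piecewise_binomial (\<lambda>a b. card (U a b \<inter> R a b))"
  proof (rule graded_count_piecewise_binomial[where val = "\<lambda>al. th + lincomb (map snd gs) al" and cs = "map fst gs"])
    show "\<exists>al. length al = length (map fst gs) \<and> cdeg True (map fst gs) al = a \<and>
       cdeg False (map fst gs) al = b \<and> th + lincomb (map snd gs) al = x" if "x \<in> U a b \<inter> R a b" for a b x
      using that by (auto simp: R_def gs graded_span_iff_lincomb)
  next
    fix al ga :: "nat list"
    assume l: "length al = length (map fst gs)" "length ga = length (map fst gs)"
    assume u: "th + lincomb (map snd gs) (map2 (+) al ga)
       \<in> U (cdeg True (map fst gs) al + cdeg True (map fst gs) ga) (cdeg False (map fst gs) al + cdeg False (map fst gs) ga)
         \<inter> R (cdeg True (map fst gs) al + cdeg True (map fst gs) ga) (cdeg False (map fst gs) al + cdeg False (map fst gs) ga)"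
    have s: "(cdeg True (map fst gs) al, cdeg False (map fst gs) al, lincomb (map snd gs) al) \<in> graded_span S"
      if "length al = length (map fst gs)" for al
      using that by (auto simp: gs graded_span_iff_lincomb)
    show "th + lincomb (map snd gs) al \<in> U (cdeg True (map fst gs) al) (cdeg False (map fst gs) al)
      \<inter> R (cdeg True (map fst gs) al) (cdeg False (map fst gs) al)"
      using insert.prems(2)[OF _ s[OF l(1)] s[OF l(2)], of th] u s[OF l(1)] l
      by (auto simp: lincomb_add add.assoc R_def)
  next
    show "th + lincomb (map snd gs) (map2 (+) al ga) = th + lincomb (map snd gs) (map2 (+) be ga)"
      if "length al = length (map fst gs)" "length be = length (map fst gs)" "length ga = length (map fst gs)"
        "th + lincomb (map snd gs) al = th + lincomb (map snd gs) be" for al be ga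
      using that by (simp add: lincomb_add add.assoc[symmetric])
  qed
  have 2: "piecewise_binomial (\<lambda>a b. card (U a b - R a b))"
  proof (rule insert.IH)
    show "\<exists>th\<in>Th. \<exists>y. (a, b, y) \<in> graded_span S \<and> x = th + y" if "x \<in> U a b - R a b" for a b x
      using insert.prems(1)[of x a b] that by (auto simp: R_def)
  next
    fix a b th' y a' b' z
    assume h: "th' \<in> Th" "(a, b, y) \<in> graded_span S" "(a', b', z) \<in> graded_span S"
      "th' + y + z \<in> U (a + a') (b + b') - R (a + a') (b + b')"
    have "th' + y \<in> U a b" using insert.prems(2)[of th' a b y a' b' z] h by auto
    \<comment> \<open>\<open>R\<close> is stable under the action of \<open>z\<close>, so membership
      of \<open>th' + y\<close> would pass to the product.\<close>
    moreover have "th' + y \<notin> R a b"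
    proof
      assume "th' + y \<in> R a b"
      then obtain y' where "th' + y = th + y'" "(a, b, y') \<in> graded_span S" by (auto simp: R_def)
      then have "th' + y + z \<in> R (a + a') (b + b')"
        using graded_span_add[of a b y' S a' b' z] h(3) by (auto simp: R_def add.assoc)
      then show False using h(4) by blast
    qed
    ultimately show "th' + y \<in> U a b - R a b" by blast
  qed
  have "card (U a b) = card (U a b \<inter> R a b) + card (U a b - R a b)" for a b
    using card_Int_Diff[OF finU] by blast
  then show ?case using piecewise_binomial_add[OF 1 2] by simp
qed

section \<open>The gap between two filtrations\<close>

definition gapset :: "(nat ^ 'n) set \<Rightarrow> (nat ^ 'n) set \<Rightarrow> nat \<Rightarrow> nat \<Rightarrow> nat \<Rightarrow> (nat ^ 'n) set" where
  "gapset J J' t a b = msum (npow J' a) (mm (t * b)) - msum (npow J a) (mm (t * b))"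

text \<open>Multiplies out generators of the single factors. The tag \<open>e\<close> is added once
  per factor, so the component \<open>p * e\<close> counts factors of a marked kind.\<close>

lemma graded_span_npow:
  fixes S :: "(bool \<times> nat \<times> (nat ^ 'n)) set"
  assumes gen: "\<And>k. k \<in> V \<Longrightarrow> \<exists>g l. k = g + l \<and> g \<in> V \<and> (a0, b0, (e, g)) \<in> graded_span S"
    and "k \<in> npow V p"
  shows "\<exists>y l. k = y + l \<and> y \<in> npow V p \<and> (p * a0, p * b0, (p * e, y)) \<in> graded_span S"
  using assms(2)
proof (induction p arbitrary: k)
  case 0
  then show ?case
    using graded_span.zero[of S] by (intro exI[of _ 0] exI[of _ k]) (simp add: zero_prod_def)
next
  case (Suc p)
  then obtain k1 k2 where k: "k = k1 + k2" "k1 \<in> npow V p" "k2 \<in> V" by (auto elim: msumE)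
  obtain y l where y: "k1 = y + l" "y \<in> npow V p" "(p * a0, p * b0, (p * e, y)) \<in> graded_span S"
    using Suc.IH[OF k(2)] by blast
  obtain g m where g: "k2 = g + m" "g \<in> V" "(a0, b0, (e, g)) \<in> graded_span S" using gen[OF k(3)] by blast
  have "k = (y + g) + (l + m)" by (simp add: k y g add_ac)
  moreover have "y + g \<in> npow V (Suc p)" using y g by (auto intro: msumI)
  moreover have "(Suc p * a0, Suc p * b0, (Suc p * e, y + g)) \<in> graded_span S"
    using graded_span_add[OF y(3) g(3)] by (simp add: add_ac)
  ultimately show ?case by blast
qed

lemma card_chain_Diff:
  assumes "\<And>p. p < m \<Longrightarrow> Q p \<subseteq> Q (Suc p)" and "finite (- Q 0)"
  shows "card (Q m - Q 0) = (\<Sum>p<m. card (Q (Suc p) - Q p)) \<and> Q 0 \<subseteq> Q m"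
  using assms(1)
proof (induction m)
  case (Suc m)
  then have IH: "card (Q m - Q 0) = (\<Sum>p<m. card (Q (Suc p) - Q p))" "Q 0 \<subseteq> Q m" by auto
  have sub: "Q m \<subseteq> Q (Suc m)" using Suc.prems by simp
  have fin: "finite (X - Q 0)" for X by (rule finite_subset[OF _ assms(2)]) auto
  have "Q (Suc m) - Q 0 = (Q m - Q 0) \<union> (Q (Suc m) - Q m)" using IH(2) sub by blast
  moreover have "card \<dots> = card (Q m - Q 0) + card (Q (Suc m) - Q m)"
    by (rule card_Un_disjoint) (use IH(2) in \<open>auto intro: finite_subset[OF _ fin[of "Q (Suc m)"]] fin\<close>)
  ultimately show ?case using IH sub by auto
qed simp

text \<open>A telescoping sum over the mixed powers \<open>J'\<^sup>pJ\<^sup>q\<close> turns the gap into the Hilbert function of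
  a single bigraded module over an Artinian ring; this is where positivity comes from.\<close>

lemma gapset_piecewise_binomial:
  fixes J J' :: "(nat ^ 'n) set"
  assumes up: "upset J" "upset J'" and sub: "J \<subseteq> J'" and fin: "finite (- J)"
  shows "piecewise_binomial (\<lambda>a b. card (gapset J J' t (Suc a) b))"
proof -
  obtain d where d: "mm d \<subseteq> J" using finite_Compl_iff[OF up(1)] fin by blast
  have d': "mm d \<subseteq> J'" using d sub by blast
  \<comment> \<open>The extra component of type \<open>nat\<close> counts the factors taken from
    \<open>J'\<close>: generators of \<open>J'\<close> carry 1, those of \<open>J\<close> and of
    \<open>mm t\<close> carry 0. It keeps the summands of \<open>U\<close> for different
    \<open>p\<close> apart.\<close>
  define S :: "(bool \<times> nat \<times> (nat ^ 'n)) set" where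
    "S = (\<lambda>k. (True, (1, k))) ` {k \<in> J'. deg k \<le> d} \<union> (\<lambda>k. (True, (0, k))) ` {k \<in> J. deg k \<le> d}
        \<union> (\<lambda>k. (False, (0, k))) ` {k. deg k = t}"
  define P where "P p q b = msum (msum (npow J' p) (npow J q)) (mm (t * b))" for p q b
  \<comment> \<open>Summand \<open>p\<close> is the monomial basis of
    \<open>J'^(p+1) J^(a-p) m^(tb)\<close> modulo \<open>J'^p J^(a-p+1) m^(tb)\<close>. A further
    factor from \<open>J\<close> keeps \<open>p\<close>, one from \<open>J'\<close> raises it by
    one.\<close>
  define U where "U a b = {(p, k). p \<le> a \<and> k \<in> P (Suc p) (a - p) b - P p (Suc (a - p)) b}" for a b
  have fin_deg: "finite {k \<in> X. deg k \<le> N}" for X :: "(nat ^ 'n) set" and N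
    by (rule finite_subset[OF _ card_deg_less(1)[of "Suc N"]]) auto
  have finS: "finite S" unfolding S_def using fin_deg[of UNIV t]
    by (auto simp: fin_deg intro!: finite_imageI elim: finite_subset[rotated])
  have P_add: "y + z \<in> P (p + p') (q + q') (b + b')" if yz: "y \<in> P p q b" "z \<in> P p' q' b'" for y z p q b p' q' b'
  proof -
    obtain y1 y2 y3 where y: "y = y1 + y2 + y3" "y1 \<in> npow J' p" "y2 \<in> npow J q" "y3 \<in> mm (t * b)"
      using yz(1) by (auto simp: P_def elim!: msumE)
    obtain z1 z2 z3 where z: "z = z1 + z2 + z3" "z1 \<in> npow J' p'" "z2 \<in> npow J q'" "z3 \<in> mm (t * b')"
      using yz(2) by (auto simp: P_def elim!: msumE)
    have "y1 + z1 \<in> npow J' (p + p')" using y z npow_add[OF up(2), of p p'] msumI by blast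
    moreover have "y2 + z2 \<in> npow J (q + q')" using y z npow_add[OF up(1), of q q'] msumI by blast
    moreover have "y3 + z3 \<in> mm (t * (b + b'))" using y z by (auto simp: mm_def algebra_simps)
    ultimately have "(y1 + z1) + (y2 + z2) + (y3 + z3) \<in> P (p + p') (q + q') (b + b')"
      unfolding P_def by (intro msumI)
    then show ?thesis by (simp add: y z add_ac)
  qed
  have P_up: "upset (P p q b)" for p q b unfolding P_def by (intro upset_msum upset_mm)
  have P1: "y \<in> P 1 0 0" if "y \<in> J'" for y using that up by (simp add: P_def)
  have P2: "y \<in> P 0 1 0" if "y \<in> J" for y using that up by (simp add: P_def)
  have P3: "y \<in> P 0 0 b" if "t * b \<le> deg y" for y b
    using that by (simp add: P_def) (simp add: mm_def)
  have span_P: "fst y \<le> a \<and> snd y \<in> P (fst y) (a - fst y) b" if "(a, b, y) \<in> graded_span S" for a b y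
    using that
  proof (induction a b y rule: graded_span.induct)
    case zero
    then show ?case using P3[of 0 0] by simp
  next
    case (stepT a b x g)
    from stepT.hyps(2) consider "fst g = 1" "snd g \<in> J'" | "fst g = 0" "snd g \<in> J" by (auto simp: S_def)
    then show ?case
    proof cases
      case 1
      then show ?thesis using stepT.IH P_add[OF P1[OF 1(2)], of "snd x" "fst x" "a - fst x" b] by simp
    next
      case 2
      then show ?thesis using stepT.IH P_add[OF P2[OF 2(2)], of "snd x" "fst x" "a - fst x" b]
        by (simp add: Suc_diff_le)
    qed
  next
    case (stepF a b x g)
    then have "fst g = 0" "snd g \<in> P 0 0 1" using P3[of 1 "snd g"] by (auto simp: S_def)
    then show ?case using stepF.IH P_add[of "snd g" 0 0 1 "snd x" "fst x" "a - fst x" b] by simp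
  qed
  have pw: "piecewise_binomial (\<lambda>a b. card (U a b))"
  \<comment> \<open>The generators of the module: the one excess factor from \<open>J'\<close>
    contributes degree at most \<open>d\<close>, and the leftover that cannot be absorbed elsewhere
    has degree below \<open>d\<close>; together at most \<open>2 * d\<close>.\<close>
  proof (rule module_count_piecewise_binomial[OF finS, of "Pair 0 ` {k \<in> J'. deg k \<le> 2 * d}"])
    show "finite (Pair (0 :: nat) ` {k \<in> J'. deg k \<le> 2 * d})" by (intro finite_imageI fin_deg)
  next
    fix a b and x :: "nat \<times> (nat ^ 'n)" assume x: "x \<in> U a b"
    obtain p k where pk: "x = (p, k)" "p \<le> a" "k \<in> P (Suc p) (a - p) b" "k \<notin> P p (Suc (a - p)) b"
      using x by (auto simp: U_def)
    obtain k1 k2 k3 k4 where k: "k = k1 + k2 + k3 + k4" "k1 \<in> npow J' p" "k2 \<in> J'" "k3 \<in> npow J (a - p)" "k4 \<in> mm (t * b)"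
      using pk(3) by (auto simp: P_def elim!: msumE)
    have gen1: "\<exists>g l. k = g + l \<and> g \<in> J' \<and> (1, 0, (1, g)) \<in> graded_span S" if "k \<in> J'" for k
    proof -
      obtain g l where gl: "k = g + l" "g \<in> J'" "deg g \<le> d" using generator_le[OF up(2) d' \<open>k \<in> J'\<close>] by blast
      then have "(True, (1, g)) \<in> S" unfolding S_def by blast
      then show ?thesis using graded_span_gen(1)[of "(1, g)" S] gl by blast
    qed
    have gen2: "\<exists>g l. k = g + l \<and> g \<in> J \<and> (1, 0, (0, g)) \<in> graded_span S" if "k \<in> J" for k
    proof -
      obtain g l where gl: "k = g + l" "g \<in> J" "deg g \<le> d" using generator_le[OF up(1) d \<open>k \<in> J\<close>] by blast
      then have "(True, (0, g)) \<in> S" unfolding S_def by blast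
      then show ?thesis using graded_span_gen(1)[of "(0, g)" S] gl by blast
    qed
    have gen3: "\<exists>g l. k = g + l \<and> g \<in> mm t \<and> (0, 1, (0, g)) \<in> graded_span S" if "k \<in> mm t" for k
    proof -
      obtain g l where gl: "k = g + l" "deg g = t" using exists_le_deg_eq[of t k] \<open>k \<in> mm t\<close> by (auto simp: mm_def)
      then have "(False, (0, g)) \<in> S" unfolding S_def by blast
      then show ?thesis using graded_span_gen(2)[of "(0, g)" S] gl by (auto simp: mm_def)
    qed
    obtain y1 l1 where y1: "k1 = y1 + l1" "y1 \<in> npow J' p" "(p, 0, (p, y1)) \<in> graded_span S"
      using graded_span_npow[OF gen1 k(2)] by auto
    obtain y2 l2 where y2: "k2 = y2 + l2" "y2 \<in> J'" "deg y2 \<le> d"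
      using generator_le[OF up(2) d' k(3)] by auto
    obtain y3 l3 where y3: "k3 = y3 + l3" "y3 \<in> npow J (a - p)" "(a - p, 0, (0, y3)) \<in> graded_span S"
      using graded_span_npow[OF gen2 k(4)] by auto
    obtain y4 l4 where y4: "k4 = y4 + l4" "y4 \<in> npow (mm t) b" "(0, b, (0, y4)) \<in> graded_span S"
      using graded_span_npow[OF gen3, of k4 b] k(5) by (auto simp: npow_mm)
    define L where "L = l1 + l2 + l3 + l4"
    have kL: "k = y1 + y2 + y3 + y4 + L" by (simp add: k y1 y2 y3 y4 L_def add_ac)
    \<comment> \<open>A leftover of degree at least \<open>d\<close> lies in \<open>J\<close> and
      could serve as a further factor from \<open>J\<close>. As \<open>y2\<close> may be moved into
      the last factor, \<open>k\<close> would then lie in the subtracted term.\<close>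
    have "deg L < d"
    proof (rule ccontr)
      assume "\<not> deg L < d"
      then have "L \<in> J" using d by (auto simp: mm_def)
      then have "y3 + L \<in> npow J (Suc (a - p))" using y3 by (auto intro: msumI)
      then have "y1 + (y3 + L) + (y2 + y4) \<in> P p (Suc (a - p)) b"
        unfolding P_def using y1(2) y4(2) by (intro msumI) (auto simp: npow_mm intro: upsetD(2)[OF upset_mm])
      then show False using pk(4) by (simp add: kL add_ac)
    qed
    then have "(0, y2 + L) \<in> Pair 0 ` {k \<in> J'. deg k \<le> 2 * d}"
      using y2 upsetD(1)[OF up(2)] by auto
    moreover have "(a, b, (p, y1 + y3 + y4)) \<in> graded_span S"
      using graded_span_add[OF graded_span_add[OF y1(3) y3(3)] y4(3)] pk(2) by simp
    moreover have "x = (0, y2 + L) + (p, y1 + y3 + y4)" by (simp add: pk kL add_ac)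
    ultimately show "\<exists>th\<in>Pair 0 ` {k \<in> J'. deg k \<le> 2 * d}. \<exists>y. (a, b, y) \<in> graded_span S \<and> x = th + y" by blast
  next
    fix a b a' b' :: nat and th y z :: "nat \<times> (nat ^ 'n)"
    assume th: "th \<in> Pair 0 ` {k \<in> J'. deg k \<le> 2 * d}" and y: "(a, b, y) \<in> graded_span S"
      and z: "(a', b', z) \<in> graded_span S" and u: "th + y + z \<in> U (a + a') (b + b')"
    obtain k where k: "th = (0, k)" "k \<in> J'" using th by auto
    obtain p l where pl: "y = (p, l)" "p \<le> a" "l \<in> P p (a - p) b" using span_P[OF y] by (cases y) auto
    obtain r m where rm: "z = (r, m)" "r \<le> a'" "m \<in> P r (a' - r) b'" using span_P[OF z] by (cases z) auto
    have "k + l \<in> P (Suc p) (a - p) b" using P_add[OF P1[OF k(2)] pl(3)] by simp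
    moreover have "k + l \<notin> P p (Suc (a - p)) b"
    proof
      assume "k + l \<in> P p (Suc (a - p)) b"
      from P_add[OF this rm(3)] have "k + l + m \<in> P (p + r) (Suc (a - p) + (a' - r)) (b + b')" .
      moreover have "Suc (a - p) + (a' - r) = Suc (a + a' - (p + r))" using pl(2) rm(2) by simp
      ultimately show False using u by (simp add: U_def k pl rm)
    qed
    ultimately show "th + y \<in> U a b" using pl by (simp add: U_def k)
  qed
  have "card (gapset J J' t (Suc a) b) = card (U a b)" for a b
  proof -
    \<comment> \<open>\<open>Q\<close> leads from \<open>J^(a+1) m^(tb)\<close> to
      \<open>J'^(a+1) m^(tb)\<close>, exchanging one factor of \<open>J\<close> for one of
      \<open>J'\<close> at each step.\<close>
    define Q where "Q p = P p (Suc a - p) b" for p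
    have mono: "Q p \<subseteq> Q (Suc p)" if "p < Suc a" for p
    proof
      fix k assume "k \<in> Q p"
      moreover have "Suc a - p = Suc (a - p)" using that by simp
      ultimately obtain k1 k2 k3 k4 where k: "k = k1 + (k2 + k3) + k4" "k1 \<in> npow J' p" "k2 \<in> npow J (a - p)" "k3 \<in> J"
        "k4 \<in> mm (t * b)" by (auto simp: Q_def P_def elim!: msumE)
      have "k1 + k3 \<in> npow J' (Suc p)" using k sub by (auto intro: msumI)
      then have "(k1 + k3) + k2 + k4 \<in> Q (Suc p)" unfolding Q_def P_def using k by (auto intro!: msumI)
      then show "k \<in> Q (Suc p)" by (simp add: k add_ac)
    qed
    have "mm (d * Suc a + t * b) \<subseteq> Q 0"
      using msum_npow_mm_mono[OF d, of "Suc a" "t * b"] up by (simp add: Q_def P_def del: npow.simps(2))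
    then have finQ: "finite (- Q 0)" using finite_Compl_iff[of "Q 0"] P_up by (auto simp: Q_def)
    have fin: "finite (X - Q p)" if "p \<le> Suc a" for p X
    proof -
      have "Q 0 \<subseteq> Q p" using card_chain_Diff[of p Q] mono that finQ by auto
      then show ?thesis by (intro finite_subset[OF _ finQ]) auto
    qed
    have "gapset J J' t (Suc a) b = Q (Suc a) - Q 0"
      using up by (simp add: gapset_def Q_def P_def del: npow.simps(2))
    then have "card (gapset J J' t (Suc a) b) = (\<Sum>p<Suc a. card (Q (Suc p) - Q p))"
      using card_chain_Diff[of "Suc a" Q] mono finQ by auto
    also have "\<dots> = (\<Sum>p\<le>a. card (Q (Suc p) - Q p))" by (simp add: lessThan_Suc_atMost)
    also have "\<dots> = card (SIGMA p:{..a}. Q (Suc p) - Q p)" using fin by simp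
    also have "(SIGMA p:{..a}. Q (Suc p) - Q p) = U a b"
      by (auto simp: U_def Q_def Suc_diff_le)
    finally show ?thesis .
  qed
  then show ?thesis using pw by simp
qed

lemma card_gapset_le:
  fixes J J' :: "(nat ^ 'n) set"
  assumes "mm d \<subseteq> J"
  shows "card (gapset J J' t a b) \<le> (d * a + t * b) ^ CARD('n)"
proof -
  have "gapset J J' t a b \<subseteq> {k. deg k < d * a + t * b}"
    using msum_npow_mm_mono[OF assms, of a "t * b"] by (auto simp: gapset_def mm_def not_le[symmetric])
  then have "card (gapset J J' t a b) \<le> card {k :: nat ^ 'n. deg k < d * a + t * b}"
    by (rule card_mono[OF card_deg_less(1)])
  then show ?thesis using card_deg_less(2)[where 'n = 'n, of "d * a + t * b"] by linarith
qed

section \<open>Leading coefficients\<close>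

text \<open>The pieces that are polynomials with leading term \<open>a\<^sup>ib\<^bsup>n-i\<^esup> / (i! (n-i)!)\<close>.\<close>

definition lead :: "piece_index list \<Rightarrow> nat \<Rightarrow> nat \<Rightarrow> nat" where
  "lead ts n i = length (filter (\<lambda>(p, c, q, d). p = Suc i \<and> q = Suc (n - i)) ts)"

lemma affine_over_n:
  "(\<lambda>x. (real (c * x - d) + e) / real x) \<longlonglongrightarrow> real c" if "c \<ge> 1"
proof -
  have "(\<lambda>x. real c + (e - real d) / real x) \<longlonglongrightarrow> real c + 0"
    by (intro tendsto_intros lim_const_over_n)
  moreover have "\<forall>\<^sub>F x in sequentially. real c + (e - real d) / real x = (real (c * x - d) + e) / real x"
    using eventually_ge_at_top[of "Suc d"]
  proof eventually_elim
    case (elim x)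
    then have "d \<le> c * x" using that mult_le_mono[of 1 c d x] by simp
    then show ?case using elim by (simp add: field_simps of_nat_diff)
  qed
  ultimately show ?thesis by (simp add: tendsto_cong)
qed

lemma bin_asymp:
  assumes "c \<ge> 1"
  shows "(\<lambda>x. real (bin (Suc i) (c * x - d)) / real x ^ i) \<longlonglongrightarrow> real c ^ i / fact i"
proof -
  have "real (bin (Suc i) m) = (\<Prod>l<i. real m + (1 + real l)) / fact i" for m
  proof -
    have "real (bin (Suc i) m) = (real (m + i) gchoose i)" by (simp add: bin_def binomial_gbinomial)
    also have "\<dots> = pochhammer (real m + 1) i / fact i"
      by (simp add: gbinomial_pochhammer')
    also have "pochhammer (real m + 1) i = (\<Prod>l<i. real m + (1 + real l))"
      by (simp add: pochhammer_prod atLeast0LessThan add.assoc)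
    finally show ?thesis .
  qed
  then have eq: "real (bin (Suc i) (c * x - d)) / real x ^ i
      = (\<Prod>l<i. (real (c * x - d) + (1 + real l)) / real x) / fact i" for x
    by (simp add: prod_dividef)
  have "(\<lambda>x. (\<Prod>l<i. (real (c * x - d) + (1 + real l)) / real x) / fact i) \<longlonglongrightarrow> (\<Prod>l<i. real c) / fact i"
    by (intro tendsto_intros affine_over_n assms) simp
  then show ?thesis by (simp add: eq)
qed

lemma eventually_mult_ge: "c \<ge> 1 \<Longrightarrow> \<forall>\<^sub>F x in sequentially. d \<le> c * (x :: nat)"
  by (rule eventually_mono[OF eventually_ge_at_top[of d]])
     (use mult_le_mono in fastforce)

lemma piece_asymp:
  assumes "c0 \<ge> 1"
  shows "(\<lambda>x. real (piece (Suc i, c, Suc j, d) x (c0 * x)) / real x ^ (i + j))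
           \<longlonglongrightarrow> real c0 ^ j / (fact i * fact j)"
proof -
  have "(\<lambda>x. (real (bin (Suc i) (1 * x - c)) / real x ^ i) * (real (bin (Suc j) (c0 * x - d)) / real x ^ j))
     \<longlonglongrightarrow> (real 1 ^ i / fact i) * (real c0 ^ j / fact j)"
    by (intro tendsto_mult bin_asymp assms) simp
  moreover have "\<forall>\<^sub>F x in sequentially.
     (real (bin (Suc i) (1 * x - c)) / real x ^ i) * (real (bin (Suc j) (c0 * x - d)) / real x ^ j)
     = real (piece (Suc i, c, Suc j, d) x (c0 * x)) / real x ^ (i + j)"
    using eventually_ge_at_top[of c] eventually_mult_ge[OF assms, of d]
    by eventually_elim (simp add: piece_def power_add)
  ultimately show ?thesis by (simp add: tendsto_cong)
qed

text \<open>Such a piece is supported on the line \<open>a = c\<close> (if \<open>p = 0\<close>) or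
  \<open>b = d\<close> (if \<open>q = 0\<close>), and the ray \<open>b = c0 a\<close> leaves
  both.\<close>

lemma piece_asymp_0:
  assumes "c0 \<ge> 1" "p = 0 \<or> q = 0"
  shows "\<forall>\<^sub>F x in sequentially. piece (p, c, q, d) x (c0 * x) = 0"
  using eventually_gt_at_top[of c] eventually_mult_ge[OF assms(1), of "Suc d"]
  by eventually_elim (use assms(2) in \<open>auto simp: piece_def bin_def\<close>)

lemma member_piece_le: "t \<in> set ts \<Longrightarrow> piece t a b \<le> piece_sum ts a b"
  by (induction ts) auto

lemma power_over_power_tendsto_0:
  assumes "n < m"
  shows "(\<lambda>x. K * (real (A * x + 1)) ^ n / real x ^ m) \<longlonglongrightarrow> 0"
proof -
  have "(\<lambda>x. K * (real A + 1 / real x) ^ n * (1 / real x) ^ (m - n)) \<longlonglongrightarrow> K * (real A + 0) ^ n * 0 ^ (m - n)"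
    by (intro tendsto_intros lim_const_over_n)
  moreover have "\<forall>\<^sub>F x in sequentially.
      K * (real A + 1 / real x) ^ n * (1 / real x) ^ (m - n) = K * (real (A * x + 1)) ^ n / real x ^ m"
    using eventually_gt_at_top[of 0]
  proof eventually_elim
    case (elim x)
    have "real x ^ m = real x ^ n * real x ^ (m - n)" using assms by (simp flip: power_add)
    moreover have "real A + 1 / real x = real (A * x + 1) / real x" using elim by (simp add: field_simps)
    ultimately show ?case using elim by (simp add: power_divide)
  qed
  ultimately show ?thesis using assms by (simp add: tendsto_cong zero_power)
qed

text \<open>Since all pieces are nonnegative, a growth bound for the sum bounds the degree of every piece.\<close>

lemma piece_degree_le:
  assumes bound: "\<And>a b. real (piece_sum ts a b) \<le> K * real (a + b + 1) ^ n"
    and t: "(Suc i, c, Suc j, d) \<in> set ts"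
  shows "i + j \<le> n"
proof (rule ccontr)
  assume "\<not> i + j \<le> n"
  then have lt: "n < i + j" by simp
  have "real (1 :: nat) ^ j / (fact i * fact j) \<le> 0"
  proof (rule LIMSEQ_le[OF piece_asymp[of 1 i c j d] power_over_power_tendsto_0[OF lt, of K 2]])
    have "real (piece (Suc i, c, Suc j, d) x (1 * x)) / real x ^ (i + j) \<le> K * real (2 * x + 1) ^ n / real x ^ (i + j)" for x
    proof (rule divide_right_mono)
      have "real (piece (Suc i, c, Suc j, d) x (1 * x)) \<le> real (piece_sum ts x (1 * x))"
        using member_piece_le[OF t] by (simp only: of_nat_le_iff)
      also have "\<dots> \<le> K * real (x + 1 * x + 1) ^ n" by (rule bound)
      also have "x + 1 * x + 1 = 2 * x + 1" by simp
      finally show "real (piece (Suc i, c, Suc j, d) x (1 * x)) \<le> K * real (2 * x + 1) ^ n" .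
    qed simp
    then show "\<exists>N. \<forall>x\<ge>N. real (piece (Suc i, c, Suc j, d) x (1 * x)) / real x ^ (i + j) \<le> K * real (2 * x + 1) ^ n / real x ^ (i + j)"
      by blast
  qed simp
  moreover have "(0 :: real) < fact i * fact j" by simp
  ultimately show False by (simp add: divide_le_0_iff)
qed

text \<open>The value at \<open>(1, c)\<close> of the binary form with coefficient
  \<open>L i\<close> at \<open>a^i b^(n-i)\<close>.\<close>

definition top_form :: "(nat \<Rightarrow> real) \<Rightarrow> nat \<Rightarrow> real \<Rightarrow> real" where
  "top_form L n c = (\<Sum>i\<le>n. L i * c ^ (n - i))"

text \<open>Integral slopes suffice, since a form is determined by its values at infinitely many
  slopes. Slope 0 is left out because a single row also sees the pieces supported on that
  row.\<close>

definition has_top_form :: "(nat \<Rightarrow> nat \<Rightarrow> nat) \<Rightarrow> nat \<Rightarrow> (nat \<Rightarrow> real) \<Rightarrow> bool" where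
  "has_top_form f n L \<longleftrightarrow> (\<forall>c\<ge>1. (\<lambda>x. real (f x (c * x)) / real x ^ n) \<longlonglongrightarrow> top_form L n (real c))"

definition lead_coeff2 :: "piece_index list \<Rightarrow> nat \<Rightarrow> nat \<Rightarrow> real" where
  "lead_coeff2 ts n i = real (lead ts n i) / (fact i * fact (n - i))"

lemma piece_sum_has_top_form:
  assumes bound: "\<And>a b. real (piece_sum ts a b) \<le> K * real (a + b + 1) ^ n"
  shows "has_top_form (piece_sum ts) n (lead_coeff2 ts n)"
  unfolding has_top_form_def
proof (intro allI impI)
  fix c0 :: nat assume c0: "c0 \<ge> 1"
  \<comment> \<open>Extracted before the induction: the growth bound concerns the entire list, while
    the induction needs only the degree bound for single pieces.\<close>
  have deg: "\<forall>(p, c, q, d)\<in>set ts. p > 0 \<longrightarrow> q > 0 \<longrightarrow> (p - 1) + (q - 1) \<le> n"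
    using piece_degree_le[OF bound] by (auto simp: gr0_conv_Suc)
  show "(\<lambda>x. real (piece_sum ts x (c0 * x)) / real x ^ n) \<longlonglongrightarrow> top_form (lead_coeff2 ts n) n (real c0)"
    using deg
  proof (induction ts)
    case Nil
    then show ?case by (simp add: top_form_def lead_coeff2_def lead_def)
  next
    case (Cons t ts)
    obtain p c q d where t: "t = (p, c, q, d)" by (cases t) auto
    have IH: "(\<lambda>x. real (piece_sum ts x (c0 * x)) / real x ^ n) \<longlonglongrightarrow> top_form (lead_coeff2 ts n) n (real c0)"
      using Cons by simp
    define w where "w = (if p > 0 \<and> q > 0 \<and> (p - 1) + (q - 1) = n
      then real c0 ^ (q - 1) / (fact (p - 1) * fact (q - 1)) else (0 :: real))"
    have "(\<lambda>x. real (piece t x (c0 * x)) / real x ^ n) \<longlonglongrightarrow> w"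
    proof (cases "p > 0 \<and> q > 0")
      case True
      then obtain i j where ij: "p = Suc i" "q = Suc j" by (auto simp: gr0_conv_Suc)
      have le: "i + j \<le> n" using Cons.prems by (simp add: t ij)
      have lim: "(\<lambda>x. real (piece t x (c0 * x)) / real x ^ (i + j) * (1 / real x) ^ (n - (i + j)))
          \<longlonglongrightarrow> real c0 ^ j / (fact i * fact j) * 0 ^ (n - (i + j))"
        unfolding t ij by (intro tendsto_intros piece_asymp c0 lim_const_over_n)
      have pw: "real x ^ n = real x ^ (i + j) * real x ^ (n - (i + j))" for x
        using le by (simp flip: power_add)
      have "real (piece t x (c0 * x)) / real x ^ (i + j) * (1 / real x) ^ (n - (i + j)) = real (piece t x (c0 * x)) / real x ^ n" for x
        by (subst pw) (simp add: power_divide)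
      moreover have "real c0 ^ j / (fact i * fact j) * 0 ^ (n - (i + j)) = w"
        using le by (auto simp: w_def ij)
      ultimately show ?thesis using lim by simp
    next
      case False
      then have "p = 0 \<or> q = 0" by auto
      from piece_asymp_0[OF c0 this, of c d]
      have "\<forall>\<^sub>F x in sequentially. 0 = real (piece t x (c0 * x)) / real x ^ n"
        by eventually_elim (simp add: t)
      then have "((\<lambda>x. real (piece t x (c0 * x)) / real x ^ n) \<longlongrightarrow> 0) sequentially"
        by (rule Lim_transform_eventually[OF tendsto_const])
      moreover have "w = 0" using False by (auto simp: w_def)
      ultimately show ?thesis by simp
    qed
    then have lim: "(\<lambda>x. real (piece t x (c0 * x)) / real x ^ n + real (piece_sum ts x (c0 * x)) / real x ^ n)
      \<longlonglongrightarrow> w + top_form (lead_coeff2 ts n) n (real c0)"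
      using IH by (rule tendsto_add)
    have "lead (t # ts) n i = (if p = Suc i \<and> q = Suc (n - i) then 1 else 0) + lead ts n i" for i
      by (simp add: lead_def t)
    then have "lead_coeff2 (t # ts) n i * real c0 ^ (n - i) =
        (if p = Suc i \<and> q = Suc (n - i) then real c0 ^ (n - i) / (fact i * fact (n - i)) else 0)
         + lead_coeff2 ts n i * real c0 ^ (n - i)" for i
      by (simp add: lead_coeff2_def add_divide_distrib distrib_right)
    then have "top_form (lead_coeff2 (t # ts) n) n (real c0) =
       (\<Sum>i\<le>n. if p = Suc i \<and> q = Suc (n - i) then real c0 ^ (n - i) / (fact i * fact (n - i)) else 0)
         + top_form (lead_coeff2 ts n) n (real c0)"
      by (simp add: top_form_def sum.distrib)
    also have "(\<Sum>i\<le>n. if p = Suc i \<and> q = Suc (n - i) then real c0 ^ (n - i) / (fact i * fact (n - i)) else 0) = w"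
    proof (cases "p > 0 \<and> q > 0 \<and> (p - 1) + (q - 1) = n")
      case True
      then have "(\<Sum>i\<le>n. if p = Suc i \<and> q = Suc (n - i) then real c0 ^ (n - i) / (fact i * fact (n - i)) else 0)
         = (\<Sum>i\<le>n. if i = p - 1 then real c0 ^ (q - 1) / (fact (p - 1) * fact (q - 1)) else 0)"
        by (intro sum.cong) auto
      then show ?thesis using True by (auto simp: w_def)
    next
      case False
      then show ?thesis unfolding w_def by (simp only: if_False) (rule sum.neutral, auto)
    qed
    finally show ?case using lim by (simp add: add_divide_distrib)
  qed
qed

text \<open>The difference of the two forms is a polynomial in \<open>c\<close> that vanishes at all
  positive integers.\<close>

lemma top_form_unique:
  assumes "\<And>c :: nat. c \<ge> 1 \<Longrightarrow> top_form L n (real c) = top_form L' n (real c)" "i \<le> n"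
  shows "L i = L' i"
proof (rule ccontr)
  assume ne: "L i \<noteq> L' i"
  have "finite {z. (\<Sum>j\<le>n. (L (n - j) - L' (n - j)) * z ^ j) = 0}"
    unfolding polyfun_finite_roots by (rule exI[of _ "n - i"]) (use ne assms(2) in simp)
  moreover have "top_form M n z = (\<Sum>j\<le>n. M (n - j) * z ^ j)" for M z
    unfolding top_form_def by (rule sum.reindex_bij_witness[of _ "\<lambda>j. n - j" "\<lambda>j. n - j"]) auto
  then have "real ` {1..} \<subseteq> {z. (\<Sum>j\<le>n. (L (n - j) - L' (n - j)) * z ^ j) = 0}"
    using assms(1) by (auto simp: left_diff_distrib sum_subtractf)
  ultimately have "finite (real ` {1..})" by (rule finite_subset[rotated])
  then show False by (simp add: finite_image_iff infinite_Ici)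
qed

lemma has_top_form_unique:
  assumes "has_top_form f n L" "has_top_form f n L'" "i \<le> n"
  shows "L i = L' i"
proof (rule top_form_unique[OF _ assms(3)])
  fix c :: nat assume "c \<ge> 1"
  then show "top_form L n (real c) = top_form L' n (real c)"
    using assms(1,2) LIMSEQ_unique unfolding has_top_form_def by blast
qed

lemma has_top_form_add:
  assumes "has_top_form f n L" "has_top_form g n L'"
  shows "has_top_form (\<lambda>a b. f a b + g a b) n (\<lambda>i. L i + L' i)"
  using assms unfolding has_top_form_def top_form_def
  by (auto simp: add_divide_distrib sum.distrib distrib_right intro!: tendsto_add)

text \<open>Nothing cancels, so the single term \<open>L j * c ^ (n - j) * c\<close> is already
  bounded by \<open>K * c ^ (n - i)\<close>. For \<open>j \<le> i\<close> its power of
  \<open>c\<close> is larger, which is impossible for large \<open>c\<close> if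
  \<open>L j > 0\<close>.\<close>

lemma top_form_upper:
  assumes "\<And>i. i \<le> n \<Longrightarrow> 0 \<le> L i" "i \<le> n"
    and "\<And>c :: nat. c \<ge> c0 \<Longrightarrow> c \<ge> 1 \<Longrightarrow> top_form L n (real c) * real c \<le> K * real c ^ (n - i)"
    and "j \<le> i"
  shows "L j = 0"
proof (rule ccontr)
  assume "L j \<noteq> 0"
  then have pos: "L j > 0" using assms(1)[of j] assms(2,4) by simp
  obtain c1 :: nat where c1: "real c1 > \<bar>K\<bar> / L j" using reals_Archimedean2 by blast
  define c where "c = Suc (max c0 c1)"
  have c: "c \<ge> c0" "c \<ge> 1" "real c > \<bar>K\<bar> / L j" using c1 by (auto simp: c_def)
  have "L j * real c ^ (n - j) \<le> top_form L n (real c)" unfolding top_form_def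
    by (rule member_le_sum[of j "{..n}" "\<lambda>i. L i * real c ^ (n - i)"]) (use assms in auto)
  then have "L j * real c ^ (n - j) * real c \<le> K * real c ^ (n - i)"
    using assms(3)[OF c(1,2)] mult_right_mono[of "L j * real c ^ (n - j)" "top_form L n (real c)" "real c"] by simp
  also have "\<dots> \<le> \<bar>K\<bar> * real c ^ (n - j)"
    by (intro mult_mono power_increasing) (use c assms(4) in auto)
  finally have "(L j * real c) * real c ^ (n - j) \<le> \<bar>K\<bar> * real c ^ (n - j)" by (simp add: mult_ac)
  then have "L j * real c \<le> \<bar>K\<bar>" using c(2) by (simp add: mult_le_cancel_right)
  then show False using c(3) pos by (simp add: field_simps)
qed

text \<open>If \<open>L i\<close> vanished too, only terms with index above \<open>i\<close> would
  remain, and these are of smaller order in \<open>c\<close> than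
  \<open>c ^ (n - i)\<close>.\<close>

lemma top_form_lower:
  assumes "\<And>i. i \<le> n \<Longrightarrow> 0 \<le> L i" "i \<le> n" "K > 0"
    and low: "\<And>c :: nat. c \<ge> 1 \<Longrightarrow> K * real c ^ (n - i) \<le> top_form L n (real c)"
    and z: "\<And>j. j < i \<Longrightarrow> L j = 0"
  shows "L i > 0"
proof (rule ccontr)
  assume "\<not> L i > 0"
  then have Li: "L i = 0" using assms(1)[of i] assms(2) by simp
  define M where "M = (\<Sum>j\<le>n. L j)"
  obtain c1 :: nat where c1: "real c1 > M / K" using reals_Archimedean2 by blast
  define c where "c = Suc c1"
  have c: "c \<ge> 1" "real c > M / K" using c1 by (auto simp: c_def)
  have "L j * real c ^ (n - j) * real c \<le> L j * real c ^ (n - i)" if "j \<le> n" for j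
  proof (cases "j \<le> i")
    case True
    then have "L j = 0" using z Li by (cases "j = i") auto
    then show ?thesis by simp
  next
    case False
    then have "Suc (n - j) \<le> n - i" using that by simp
    then have "real c ^ Suc (n - j) \<le> real c ^ (n - i)" by (intro power_increasing) (use c in auto)
    then show ?thesis using assms(1)[OF that] by (simp add: mult_ac mult_left_mono)
  qed
  then have "top_form L n (real c) * real c \<le> M * real c ^ (n - i)"
    unfolding top_form_def M_def sum_distrib_right by (intro sum_mono) auto
  moreover have "K * real c ^ (n - i) * real c \<le> top_form L n (real c) * real c"
    using low[OF c(1)] by (rule mult_right_mono) simp
  ultimately have "(K * real c) * real c ^ (n - i) \<le> M * real c ^ (n - i)" by (simp add: mult_ac)
  then have "K * real c \<le> M" using c(1) by (simp add: mult_le_cancel_right)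
  then show False using c(2) assms(3) by (simp add: field_simps)
qed

section \<open>Growth of the gap\<close>

text \<open>Replace each of the \<open>a\<close> factors of \<open>k\<close>: one in
  \<open>J\<close> by a divisor of degree at most \<open>d\<close>, one outside \<open>J\<close> (of
  degree at least \<open>r\<close>) by \<open>ka\<close>, which vanishes on \<open>W\<close> and has
  degree at most \<open>r\<close>. This never raises the degree or the entries on \<open>W\<close>,
  and the result is bounded by a multiple of \<open>a\<close>.\<close>

lemma npow_thin_element:
  fixes J :: "(nat ^ 'n) set"
  assumes up: "upset J" and d: "mm d \<subseteq> J"
    and ka: "ka \<in> J" "\<And>w. w \<in> W \<Longrightarrow> ka $ w = 0" "deg ka \<le> r"
    and k: "k \<in> npow (J \<union> mm r) a"
  shows "\<exists>y\<in>npow J a. deg y \<le> deg k \<and> (\<forall>w\<in>W. y $ w \<le> k $ w) \<and> (\<forall>j. y $ j \<le> (d + r) * a)"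
  using k
proof (induction a arbitrary: k)
  case 0
  then show ?case by (intro bexI[of _ 0]) auto
next
  case (Suc a)
  then obtain k1 k2 where k12: "k = k1 + k2" "k1 \<in> npow (J \<union> mm r) a" "k2 \<in> J \<union> mm r" by (auto elim: msumE)
  obtain y where y: "y \<in> npow J a" "deg y \<le> deg k1" "\<And>w. w \<in> W \<Longrightarrow> y $ w \<le> k1 $ w"
      "\<And>j. y $ j \<le> (d + r) * a" using Suc.IH[OF k12(2)] by auto
  have "\<exists>z\<in>J. deg z \<le> deg k2 \<and> (\<forall>w\<in>W. z $ w \<le> k2 $ w) \<and> (\<forall>j. z $ j \<le> d + r)"
  proof (cases "k2 \<in> J")
    case True
    then obtain g l where gl: "k2 = g + l" "g \<in> J" "deg g \<le> d" using generator_le[OF up d] by blast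
    then have "g $ j \<le> d + r" for j using component_le_deg[of g j] by linarith
    then show ?thesis using gl by (intro bexI[of _ g]) auto
  next
    case False
    then have "r \<le> deg k2" using k12(3) by (simp add: mm_def)
    moreover have "ka $ j \<le> d + r" for j using component_le_deg[of ka j] ka(3) by linarith
    ultimately show ?thesis using ka by (intro bexI[of _ ka]) auto
  qed
  then obtain z where z: "z \<in> J" "deg z \<le> deg k2" "\<And>w. w \<in> W \<Longrightarrow> z $ w \<le> k2 $ w" "\<And>j. z $ j \<le> d + r"
    by auto
  have "(y + z) $ j \<le> (d + r) * Suc a" for j using y(4)[of j] z(4)[of j] by simp
  then show ?case using y z by (intro bexI[of _ "y + z"]) (auto simp: k12 intro: add_mono msumI)
qed

text \<open>If fewer than \<open>i\<close> entries of \<open>k\<close> were small, take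
  \<open>W\<close> to be their positions and replace the \<open>J'\<close> factors by means of a
  \<open>ka\<close> that vanishes on \<open>W\<close>. The resulting \<open>y\<close> divides
  \<open>k\<close>: on \<open>W\<close> by comparison with \<open>k1\<close>, elsewhere by its size.
  The cofactor keeps degree at least \<open>t * b\<close>, so \<open>k\<close> would not lie in the
  gap.\<close>

lemma gapset_small_coordinates:
  fixes J :: "(nat ^ 'n) set"
  assumes up: "upset J" and d: "mm d \<subseteq> J"
    and thin: "\<And>W. card W < i \<Longrightarrow> \<exists>ka\<in>J. (\<forall>w\<in>W. ka $ w = 0) \<and> deg ka \<le> r"
    and k: "k \<in> gapset J (J \<union> mm r) t a b"
  shows "i \<le> card {j. k $ j < (d + r) * a}"
proof (rule ccontr)
  define W where "W = {j. k $ j < (d + r) * a}"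
  assume "\<not> i \<le> card {j. k $ j < (d + r) * a}"
  then obtain ka where ka: "ka \<in> J" "\<And>w. w \<in> W \<Longrightarrow> ka $ w = 0" "deg ka \<le> r"
    using thin[of W] by (auto simp: W_def)
  obtain k1 k2 where k12: "k = k1 + k2" "k1 \<in> npow (J \<union> mm r) a" "k2 \<in> mm (t * b)"
    using k by (auto simp: gapset_def elim: msumE)
  obtain y where y: "y \<in> npow J a" "deg y \<le> deg k1" "\<And>w. w \<in> W \<Longrightarrow> y $ w \<le> k1 $ w"
      "\<And>j. y $ j \<le> (d + r) * a" using npow_thin_element[OF up d ka(1) _ ka(3) k12(2), of W] ka(2) by auto
  have "y $ j \<le> k $ j" for j
  proof (cases "j \<in> W")
    case True
    then show ?thesis using y(3)[OF True] by (simp add: k12)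
  next
    case False
    then have "(d + r) * a \<le> k $ j" by (simp add: W_def)
    then show ?thesis using y(4)[of j] by linarith
  qed
  then have "y \<le> k" by (simp add: less_eq_vec_def)
  then obtain z where z: "k = y + z" by (auto simp: vec_le_iff_add)
  have "deg y + deg z = deg k1 + deg k2" using z k12(1) deg_add by metis
  then have "z \<in> mm (t * b)" using y(2) k12(3) by (simp add: mm_def)
  then have "k \<in> msum (npow J a) (mm (t * b))" unfolding z using y(1) by (intro msumI)
  then show False using k by (simp add: gapset_def)
qed

lemma deg_remove: "deg k = k $ j0 + (\<Sum>j\<in>UNIV - {j0}. k $ j)"
  unfolding deg_def by (subst sum.remove[of _ j0]) auto

text \<open>The entry at a position \<open>j0\<close> outside \<open>W\<close> is traded for
  \<open>deg k - s\<close>, which takes at most \<open>D\<close> values. This gains one more small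
  factor than the entries on \<open>W\<close> provide.\<close>

lemma card_slab_le:
  fixes W :: "'n :: finite set"
  assumes "j0 \<notin> W"
  shows "card {k :: nat ^ 'n. (\<forall>j\<in>W. k $ j < D) \<and> s \<le> deg k \<and> deg k < s + D}
      \<le> D ^ Suc (card W) * (s + D) ^ (CARD('n) - Suc (card W))"
proof -
  define X where "X = {k :: nat ^ 'n. (\<forall>j\<in>W. k $ j < D) \<and> s \<le> deg k \<and> deg k < s + D}"
  define N where "N j = (if j \<in> insert j0 W then D else s + D)" for j
  define f where "f k = (\<chi> j. if j = j0 then deg k - s else k $ j)" for k :: "nat ^ 'n"
  have "inj_on f X"
  proof (rule inj_onI)
    fix k l assume k: "k \<in> X" and l: "l \<in> X" and e: "f k = f l"
    have e': "f k $ j = f l $ j" for j using e by simp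
    have o: "k $ j = l $ j" if "j \<noteq> j0" for j using e'[of j] that by (simp add: f_def)
    have "deg k = deg l" using e'[of j0] k l by (auto simp: f_def X_def)
    moreover have "(\<Sum>j\<in>UNIV - {j0}. k $ j) = (\<Sum>j\<in>UNIV - {j0}. l $ j)" by (rule sum.cong) (use o in auto)
    ultimately have "k $ j0 = l $ j0" using deg_remove[of k j0] deg_remove[of l j0] by simp
    then show "k = l" using o by (metis vec_eq_iff)
  qed
  moreover have "f ` X \<subseteq> {k. \<forall>j. k $ j < N j}"
  proof (intro image_subsetI CollectI allI)
    fix k j assume k: "k \<in> X"
    show "f k $ j < N j" using k component_le_deg[of k j] assms by (auto simp: f_def N_def X_def)
  qed
  ultimately have "card X \<le> card {k :: nat ^ 'n. \<forall>j. k $ j < N j}"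
    using card_inj_on_le[OF _ _ finite_vec_box(1)] by blast
  also have "\<dots> = (\<Prod>j\<in>UNIV. N j)" by (rule finite_vec_box(2))
  also have "\<dots> = D ^ card (insert j0 W) * (s + D) ^ card (- insert j0 W)"
  proof -
    have "(\<Prod>j\<in>UNIV. N j) = (\<Prod>j\<in>insert j0 W. N j) * (\<Prod>j\<in>- insert j0 W. N j)"
      by (subst prod.union_disjoint[symmetric]) auto
    also have "(\<Prod>j\<in>insert j0 W. N j) = (\<Prod>j\<in>insert j0 W. D)" by (rule prod.cong) (auto simp: N_def)
    also have "(\<Prod>j\<in>- insert j0 W. N j) = (\<Prod>j\<in>- insert j0 W. s + D)" by (rule prod.cong) (auto simp: N_def)
    finally show ?thesis by simp
  qed
  also have "card (insert j0 W) = Suc (card W)" using assms by simp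
  finally show ?thesis using assms by (simp add: X_def Compl_eq_Diff_UNIV card_Diff_subset del: card_Diff_insert)
qed

text \<open>The gap is covered by slabs, one for each possible set of small positions. The
  hypothesis \<open>s\<close> prevents all entries from being small, so \<open>card_slab_le\<close>
  has a position to trade. The factor \<open>t * b\<close> on the left replaces the exponent
  \<open>n - i - 1\<close>, which would be negative for \<open>i = n\<close>. One power of 2 in
  \<open>4 ^ n\<close> counts the sets \<open>W\<close>, the other comes from
  \<open>s + D \<le> 2 * s\<close>.\<close>

lemma gapset_upper:
  fixes J :: "(nat ^ 'n) set"
  assumes up: "upset J" and d: "mm d \<subseteq> J" and i: "i \<le> CARD('n)"
    and thin: "\<And>W. card W < i \<Longrightarrow> \<exists>ka\<in>J. (\<forall>w\<in>W. ka $ w = 0) \<and> deg ka \<le> r"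
    and s: "CARD('n) * ((d + r) * a) \<le> t * b"
  shows "card (gapset J (J \<union> mm r) t a b) * (t * b)
     \<le> 4 ^ CARD('n) * ((d + r) * a) ^ Suc i * (t * b) ^ (CARD('n) - i)"
proof -
  let ?n = "CARD('n)"
  define D where "D = (d + r) * a"
  define s where "s = t * b"
  define X where "X W = {k :: nat ^ 'n. (\<forall>j\<in>W. k $ j < D) \<and> s \<le> deg k \<and> deg k < s + D}" for W
  define \<W> where "\<W> = {W :: 'n set. W \<noteq> UNIV \<and> i \<le> card W}"
  have nD: "?n * D \<le> s" using s by (simp add: D_def s_def)
  have Ds: "D \<le> s" using nD by (metis One_nat_def Suc_leI le_trans mult.commute mult_le_mono2 nat_mult_1_right zero_less_card_finite)
  have finX: "finite (X W)" for W
    by (rule finite_subset[OF _ card_deg_less(1)[of "s + D"]]) (auto simp: X_def)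
  have sub: "gapset J (J \<union> mm r) t a b \<subseteq> (\<Union>W\<in>\<W>. X W)"
  proof
    fix k assume k: "k \<in> gapset J (J \<union> mm r) t a b"
    define W where "W = {j. k $ j < D}"
    have ci: "i \<le> card W" using gapset_small_coordinates[OF up d thin k] by (simp add: W_def D_def)
    obtain k1 k2 where k12: "k = k1 + k2" "k2 \<in> mm s" using k by (auto simp: gapset_def s_def elim: msumE)
    then have lo: "s \<le> deg k" by (auto simp: mm_def)
    have "\<not> d * a + t * b \<le> deg k"
      using msum_npow_mm_mono[OF d, of a "t * b"] k by (auto simp: gapset_def mm_def)
    then have hi: "deg k < s + D" by (simp add: s_def D_def algebra_simps)
    have "W \<noteq> UNIV"
    proof
      assume "W = UNIV"
      then have "k $ j < D" for j by (auto simp: W_def)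
      then have "deg k < (\<Sum>j\<in>(UNIV :: 'n set). D)" unfolding deg_def by (intro sum_strict_mono) auto
      then show False using lo nD by simp
    qed
    then show "k \<in> (\<Union>W\<in>\<W>. X W)" using ci lo hi by (intro UN_I[of W]) (auto simp: \<W>_def X_def W_def)
  qed
  have each: "card (X W) * s \<le> 2 ^ ?n * D ^ Suc i * s ^ (?n - i)" if W: "W \<in> \<W>" for W
  proof -
    obtain j0 where j0: "j0 \<notin> W" using W by (auto simp: \<W>_def)
    have iw: "i \<le> card W" using W by (simp add: \<W>_def)
    have "card W < card (UNIV :: 'n set)" by (rule psubset_card_mono) (use j0 in auto)
    then have wn: "Suc (card W) \<le> ?n" by simp
    have "card (X W) * s \<le> D ^ Suc (card W) * (s + D) ^ (?n - Suc (card W)) * s"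
      unfolding X_def by (rule mult_right_mono[OF card_slab_le[OF j0]]) simp
    also have "\<dots> \<le> D ^ Suc (card W) * (2 * s) ^ (?n - Suc (card W)) * s"
      using Ds by (intro mult_right_mono mult_left_mono power_mono) auto
    also have "\<dots> \<le> D ^ Suc (card W) * (2 ^ ?n * s ^ (?n - Suc (card W))) * s"
      unfolding power_mult_distrib by (intro mult_right_mono mult_left_mono power_increasing) auto
    also have "\<dots> = 2 ^ ?n * (D ^ Suc (card W) * s ^ Suc (?n - Suc (card W)))" by (simp add: mult_ac)
    also have "D ^ Suc (card W) * s ^ Suc (?n - Suc (card W)) = D ^ Suc i * (D ^ (card W - i) * s ^ (?n - card W))"
      using iw wn by (simp add: Suc_diff_Suc flip: power_add mult.assoc)
    also have "\<dots> \<le> D ^ Suc i * (s ^ (card W - i) * s ^ (?n - card W))"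
      using Ds by (intro mult_left_mono mult_right_mono power_mono) auto
    also have "s ^ (card W - i) * s ^ (?n - card W) = s ^ (?n - i)" using iw wn by (simp flip: power_add)
    finally show ?thesis by (simp add: mult_ac)
  qed
  have "card (gapset J (J \<union> mm r) t a b) * s \<le> card (\<Union>W\<in>\<W>. X W) * s"
    by (intro mult_right_mono card_mono[OF _ sub]) (auto simp: finX)
  also have "\<dots> \<le> (\<Sum>W\<in>\<W>. card (X W)) * s"
    by (intro mult_right_mono card_UN_le) auto
  also have "\<dots> \<le> (\<Sum>W\<in>\<W>. 2 ^ ?n * D ^ Suc i * s ^ (?n - i))"
    unfolding sum_distrib_right by (intro sum_mono each)
  also have "\<dots> = card \<W> * (2 ^ ?n * D ^ Suc i * s ^ (?n - i))" by simp
  also have "card \<W> \<le> card (Pow (UNIV :: 'n set))" by (intro card_mono) auto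
  then have "card \<W> * (2 ^ ?n * D ^ Suc i * s ^ (?n - i)) \<le> 2 ^ ?n * (2 ^ ?n * D ^ Suc i * s ^ (?n - i))"
    by (intro mult_right_mono) (auto simp: card_Pow)
  also have "\<dots> = 4 ^ ?n * D ^ Suc i * s ^ (?n - i)"
    by (simp add: mult.assoc flip: power_mult_distrib)
  finally show ?thesis by (simp add: s_def D_def)
qed

text \<open>Each of the \<open>a\<close> factors either vanishes on \<open>W\<close> and has degree
  above \<open>r\<close>, or contributes at least 1 to the sum over \<open>W\<close>, which is
  weighted by \<open>Suc r\<close>.\<close>

lemma npow_deg_lower:
  fixes J :: "(nat ^ 'n) set"
  assumes "\<And>ka. ka \<in> J \<Longrightarrow> (\<forall>w\<in>W. ka $ w = 0) \<Longrightarrow> r < deg ka" "k \<in> npow J a"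
  shows "a * Suc r \<le> deg k + (\<Sum>w\<in>W. k $ w) * Suc r"
  using assms(2)
proof (induction a arbitrary: k)
  case (Suc a)
  then obtain k1 k2 where k12: "k = k1 + k2" "k1 \<in> npow J a" "k2 \<in> J" by (auto elim: msumE)
  have "Suc r \<le> deg k2 + (\<Sum>w\<in>W. k2 $ w) * Suc r"
  proof (cases "\<forall>w\<in>W. k2 $ w = 0")
    case True
    then show ?thesis using assms(1)[OF k12(3)] by simp
  next
    case False
    then have "(\<Sum>w\<in>W. k2 $ w) \<noteq> 0" by simp
    then have "1 \<le> (\<Sum>w\<in>W. k2 $ w)" by linarith
    then have "1 * Suc r \<le> (\<Sum>w\<in>W. k2 $ w) * Suc r" by (rule mult_right_mono) simp
    then show ?thesis by simp
  qed
  then show ?case using Suc.IH[OF k12(2)] by (simp add: k12 sum.distrib algebra_simps)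
qed simp

text \<open>Take monomials of degree slightly above \<open>t * b + r * a\<close> with small entries
  on \<open>W\<close>. The degree puts them into the larger ideal, while by
  \<open>npow_deg_lower\<close> the smaller one would demand about
  \<open>t * b + (r + 1) * a\<close>. The entries on \<open>W\<close>, the excess of degree, and the
  remaining entries vary independently.\<close>

lemma gapset_lower:
  fixes J :: "(nat ^ 'n) set"
  assumes up: "upset J" and fin: "finite (- J)" and W: "Suc (card W) = i" "i \<le> CARD('n)"
    and thick: "\<And>ka. ka \<in> J \<Longrightarrow> (\<forall>w\<in>W. ka $ w = 0) \<Longrightarrow> r < deg ka"
    and e: "e * (CARD('n) * (r + 2)) < a"
  shows "e ^ i * (t * b div CARD('n)) ^ (CARD('n) - i) \<le> card (gapset J (J \<union> mm r) t a b)"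
proof -
  let ?n = "CARD('n)"
  define m where "m = t * b div ?n"
  have "W \<noteq> UNIV" using W by auto
  then obtain j0 where j0: "j0 \<notin> W" by auto
  define N where "N j = (if j \<in> insert j0 W then e else m)" for j
  define T where "T = - insert j0 W"
  \<comment> \<open>The entry at \<open>j0\<close> is chosen so that the degree is
    \<open>t * b + r * a\<close> plus the sum of the small parameters \<open>u\<close> on
    \<open>insert j0 W\<close>. By \<open>T_le\<close> the subtraction does not truncate.\<close>
  define f where "f u = (\<chi> j. if j = j0 then t * b + r * a + u $ j0 - (\<Sum>j\<in>T. u $ j) else u $ j)" for u :: "nat ^ 'n"
  have nm: "?n * m \<le> t * b" by (simp add: m_def)
  have T_le: "(\<Sum>j\<in>T. u $ j) \<le> t * b" if u: "\<forall>j. u $ j < N j" for u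
  proof -
    have "(\<Sum>j\<in>T. u $ j) \<le> (\<Sum>j\<in>T. m)"
    proof (rule sum_mono)
      fix j assume "j \<in> T"
      then show "u $ j \<le> m" using u[rule_format, of j] by (simp add: T_def N_def)
    qed
    also have "\<dots> \<le> ?n * m" by (simp add: card_mono)
    finally show ?thesis using nm by simp
  qed
  have inj: "inj_on f {u. \<forall>j. u $ j < N j}"
  proof (rule inj_onI)
    fix u v assume u: "u \<in> {u. \<forall>j. u $ j < N j}" and v: "v \<in> {u. \<forall>j. u $ j < N j}" and eq: "f u = f v"
    have e': "f u $ j = f v $ j" for j using eq by simp
    have o: "u $ j = v $ j" if "j \<noteq> j0" for j using e'[of j] that by (simp add: f_def)
    have "(\<Sum>j\<in>T. u $ j) = (\<Sum>j\<in>T. v $ j)" by (rule sum.cong) (use o in \<open>auto simp: T_def\<close>)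
    then have "u $ j0 = v $ j0" using e'[of j0] T_le[of u] T_le[of v] u v by (simp add: f_def)
    then show "u = v" using o by (metis vec_eq_iff)
  qed
  have img: "f ` {u. \<forall>j. u $ j < N j} \<subseteq> gapset J (J \<union> mm r) t a b"
  proof (intro image_subsetI)
    fix u assume "u \<in> {u. \<forall>j. u $ j < N j}"
    then have u: "\<forall>j. u $ j < N j" by simp
    define S where "S = (\<Sum>j\<in>W. u $ j)"
    have Tne: "j \<noteq> j0" if "j \<in> T \<or> j \<in> W" for j using that j0 by (auto simp: T_def)
    have dS: "(\<Sum>j\<in>W. f u $ j) = S" unfolding S_def by (rule sum.cong) (use Tne in \<open>auto simp: f_def\<close>)
    have dT: "(\<Sum>j\<in>T. f u $ j) = (\<Sum>j\<in>T. u $ j)" by (rule sum.cong) (use Tne in \<open>auto simp: f_def\<close>)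
    have "UNIV - {j0} = W \<union> T" "W \<inter> T = {}" using j0 by (auto simp: T_def)
    then have "deg (f u) = f u $ j0 + ((\<Sum>j\<in>W. f u $ j) + (\<Sum>j\<in>T. f u $ j))"
      using deg_remove[of "f u" j0] sum.union_disjoint[of W T "\<lambda>j. f u $ j"] by simp
    then have degf: "deg (f u) = t * b + r * a + u $ j0 + S"
      unfolding dS dT using T_le[OF u] by (simp add: f_def)
    have "mm (r * a + t * b) \<subseteq> msum (npow (J \<union> mm r) a) (mm (t * b))"
      by (rule msum_npow_mm_mono) simp
    then have in1: "f u \<in> msum (npow (J \<union> mm r) a) (mm (t * b))" using degf by (auto simp: mm_def)
    have "f u \<notin> msum (npow J a) (mm (t * b))"
    proof
      assume "f u \<in> msum (npow J a) (mm (t * b))"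
      then obtain K R where KR: "f u = K + R" "K \<in> npow J a" "t * b \<le> deg R" by (auto simp: mm_def elim: msumE)
      have KS: "(\<Sum>w\<in>W. K $ w) \<le> S" unfolding dS[symmetric] by (intro sum_mono) (simp add: KR)
      have "a * Suc r \<le> deg K + (\<Sum>w\<in>W. K $ w) * Suc r" by (rule npow_deg_lower[OF thick KR(2)])
      also have "\<dots> \<le> deg K + S * Suc r" using KS by (intro add_left_mono mult_right_mono) auto
      finally have "a * Suc r + deg R \<le> deg (f u) + S * Suc r" by (simp add: KR)
      \<comment> \<open>\<open>S\<close> has weight \<open>r + 2\<close>: once from the degree of
        \<open>f u\<close>, and \<open>r + 1\<close> times from \<open>npow_deg_lower\<close>. As
        \<open>u\<close> has \<open>card W + 1 \<le> n\<close> entries below \<open>e\<close> on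
        \<open>insert j0 W\<close>, this contradicts the choice of \<open>e\<close>.\<close>
      then have a_le: "a \<le> u $ j0 + S * (r + 2)" using KR(3) degf by (simp add: algebra_simps)
      have ue: "u $ j0 < e" using u[rule_format, of j0] by (simp add: N_def)
      have "S \<le> (\<Sum>j\<in>W. e)" unfolding S_def
      proof (rule sum_mono)
        fix j assume "j \<in> W"
        then show "u $ j \<le> e" using u[rule_format, of j] by (simp add: N_def)
      qed
      then have "S \<le> card W * e" by simp
      then have "S * (r + 2) \<le> card W * e * (r + 2)" by (rule mult_right_mono) simp
      then have "a < e + card W * e * (r + 2)" using a_le ue by linarith
      also have "\<dots> \<le> e * (r + 2) + card W * e * (r + 2)" by simp
      also have "\<dots> = e * (Suc (card W) * (r + 2))" by (simp add: algebra_simps)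
      also have "\<dots> \<le> e * (?n * (r + 2))" using W by (intro mult_left_mono mult_right_mono) auto
      finally show False using e by simp
    qed
    then show "f u \<in> gapset J (J \<union> mm r) t a b" using in1 by (simp add: gapset_def)
  qed
  have "finite (- msum (npow J a) (mm (t * b)))"
  proof -
    obtain d where "mm d \<subseteq> J" using finite_Compl_iff[OF up] fin by blast
    then show ?thesis using msum_npow_mm_mono[of d J a "t * b"] finite_Compl_iff[OF upset_msum[OF upset_mm]] by blast
  qed
  then have fing: "finite (gapset J (J \<union> mm r) t a b)" by (rule finite_subset[rotated]) (auto simp: gapset_def)
  have "e ^ i * m ^ (?n - i) = (\<Prod>j\<in>insert j0 W. N j) * (\<Prod>j\<in>T. N j)"
  proof -
    have "(\<Prod>j\<in>insert j0 W. N j) = (\<Prod>j\<in>insert j0 W. e)" by (rule prod.cong) (auto simp: N_def)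
    moreover have "(\<Prod>j\<in>T. N j) = (\<Prod>j\<in>T. m)" by (rule prod.cong) (auto simp: N_def T_def)
    moreover have ci: "card (insert j0 W) = i" using j0 W by simp
    moreover have "card T = ?n - i" unfolding T_def using ci by (simp add: Compl_eq_Diff_UNIV card_Diff_subset del: card_Diff_insert)
    ultimately show ?thesis by simp
  qed
  also have "\<dots> = (\<Prod>j\<in>UNIV. N j)" unfolding T_def by (subst prod.union_disjoint[symmetric]) auto
  also have "\<dots> = card {u :: nat ^ 'n. \<forall>j. u $ j < N j}" by (simp add: finite_vec_box(2))
  also have "\<dots> \<le> card (gapset J (J \<union> mm r) t a b)" by (rule card_inj_on_le[OF inj img fing])
  finally show ?thesis by (simp add: m_def)
qed

section \<open>Comparison of leading coefficients\<close>

text \<open>\<open>hilb J t a b\<close> is the colength of \<open>J\<^bsup>a+1\<^esup>\<mm>\<^bsup>tb\<^esup>\<close> (the shift in \<open>a\<close> comes from the telescoping sum), and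
  \<open>hlead J t i\<close> will turn out to be the mixed multiplicity of \<open>i\<close> copies of \<open>J\<close> and \<open>n - i\<close> copies of
  \<open>\<mm>\<^sup>t\<close>.\<close>

definition hilb :: "(nat ^ 'n) set \<Rightarrow> nat \<Rightarrow> nat \<Rightarrow> nat \<Rightarrow> nat" where
  "hilb J t a b = card (- msum (npow J (Suc a)) (mm (t * b)))"

definition hlead :: "(nat ^ 'n) set \<Rightarrow> nat \<Rightarrow> nat \<Rightarrow> nat" where
  "hlead J t i = lead (SOME ts. hilb J t = piece_sum ts) CARD('n) i"

lemma finite_Compl_mm: "finite (- (mm t :: (nat ^ 'n) set))"
  using finite_Compl_iff[of "mm t :: (nat ^ 'n) set"] by auto

lemma finite_Compl_msum_npow:
  fixes J :: "(nat ^ 'n) set"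
  assumes "upset J" "finite (- J)"
  shows "finite (- msum (npow J a) (mm s))"
proof -
  obtain d where "mm d \<subseteq> J" using finite_Compl_iff[OF assms(1)] assms(2) by blast
  then have "mm (d * a + s) \<subseteq> msum (npow J a) (mm s)" by (rule msum_npow_mm_mono)
  then show ?thesis using finite_Compl_iff[OF upset_msum[OF upset_mm[of s]], of "npow J a"] by auto
qed

lemma hilb_gapset:
  fixes J J' :: "(nat ^ 'n) set"
  assumes "upset J" "finite (- J)" "J \<subseteq> J'"
  shows "hilb J t a b = hilb J' t a b + card (gapset J J' t (Suc a) b)"
proof -
  let ?A = "msum (npow J (Suc a)) (mm (t * b))" and ?B = "msum (npow J' (Suc a)) (mm (t * b))"
  have sub: "?A \<subseteq> ?B" using npow_mono[OF assms(3)] by (rule msum_mono) simp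
  have fin: "finite (- ?A)" by (rule finite_Compl_msum_npow[OF assms(1,2)])
  have eq: "- ?A = - ?B \<union> gapset J J' t (Suc a) b" using sub by (auto simp: gapset_def)
  have "card (- ?A) = card (- ?B) + card (gapset J J' t (Suc a) b)"
    unfolding eq by (rule card_Un_disjoint) (use fin eq in \<open>auto simp: gapset_def intro: finite_subset\<close>)
  then show ?thesis by (simp add: hilb_def)
qed

text \<open>The colength of a power of the maximal ideal is itself a gap, namely that between
  \<open>mm t\<close> and the unit ideal with trivial second factor.\<close>

lemma card_Compl_mm_piecewise_binomial:
  "piecewise_binomial (\<lambda>a b. card (- (mm (t * Suc a) :: (nat ^ 'n) set)))"
proof -
  have "gapset (mm t) UNIV 0 (Suc a) b = - (mm (t * Suc a) :: (nat ^ 'n) set)" for a b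
    by (auto simp: gapset_def npow_mm simp del: npow.simps(2))
  then show ?thesis
    using gapset_piecewise_binomial[of "mm t :: (nat ^ 'n) set" UNIV 0] finite_Compl_mm[of t] by simp
qed

text \<open>Splits the quotient by \<open>J^(a+1) m^(tb)\<close> into the quotient by
  \<open>m^(tb)\<close> and the gap between \<open>J\<close> and the unit ideal. The first part is a
  function of \<open>b\<close> alone, obtained by shifting away the \<open>Suc\<close> and swapping
  the variables.\<close>

lemma hilb_piecewise_binomial:
  fixes J :: "(nat ^ 'n) set"
  assumes "upset J" "finite (- J)"
  shows "piecewise_binomial (hilb J t)"
proof -
  have "(case a of 0 \<Rightarrow> 0 | Suc a' \<Rightarrow> card (- (mm (t * Suc a') :: (nat ^ 'n) set))) = card (- (mm (t * a) :: (nat ^ 'n) set))"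
    for a by (cases a) (auto simp del: mult_Suc_right)
  then have "piecewise_binomial (\<lambda>a b :: nat. card (- (mm (t * a) :: (nat ^ 'n) set)))"
    using piecewise_binomial_shift[OF card_Compl_mm_piecewise_binomial[of t, where 'n = 'n]] by simp
  from piecewise_binomial_add[OF piecewise_binomial_swap[OF this] gapset_piecewise_binomial[OF assms(1) upset_UNIV _ assms(2)]]
  have "piecewise_binomial (\<lambda>a b. card (- (mm (t * b) :: (nat ^ 'n) set)) + card (gapset J UNIV t (Suc a) b))" by simp
  moreover have "hilb J t a b = card (- (mm (t * b) :: (nat ^ 'n) set)) + card (gapset J UNIV t (Suc a) b)" for a b
    using hilb_gapset[OF assms, of UNIV t a b] by (simp add: hilb_def del: npow.simps(2))
  then have "hilb J t = (\<lambda>a b. card (- (mm (t * b) :: (nat ^ 'n) set)) + card (gapset J UNIV t (Suc a) b))"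
    by (simp add: fun_eq_iff)
  ultimately show ?thesis by simp
qed

lemma affine_bound: "(d * Suc a + t * b) ^ n \<le> (d + t) ^ n * (a + b + 1) ^ n" for d :: nat
  unfolding power_mult_distrib[symmetric] by (rule power_mono) (auto simp: algebra_simps)

lemma gapset_bound:
  fixes J J' :: "(nat ^ 'n) set"
  assumes "upset J" "finite (- J)"
  obtains K where "\<And>a b. real (card (gapset J J' t (Suc a) b)) \<le> real K * real (a + b + 1) ^ CARD('n)"
proof -
  obtain d where d: "mm d \<subseteq> J" using finite_Compl_iff[OF assms(1)] assms(2) by blast
  have "card (gapset J J' t (Suc a) b) \<le> (d + t) ^ CARD('n) * (a + b + 1) ^ CARD('n)" for a b
    using card_gapset_le[OF d, of J' t "Suc a" b] affine_bound[of d a t b "CARD('n)"] by linarith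
  then have "real (card (gapset J J' t (Suc a) b)) \<le> real ((d + t) ^ CARD('n)) * real (a + b + 1) ^ CARD('n)" for a b
    by (simp only: of_nat_power[symmetric] of_nat_mult[symmetric] of_nat_le_iff)
  then show ?thesis by (rule that)
qed

lemma hilb_bound:
  fixes J :: "(nat ^ 'n) set"
  assumes "upset J" "finite (- J)"
  obtains K where "\<And>a b. real (hilb J t a b) \<le> real K * real (a + b + 1) ^ CARD('n)"
proof -
  obtain d where d: "mm d \<subseteq> J" using finite_Compl_iff[OF assms(1)] assms(2) by blast
  have "hilb J t a b \<le> (d + t) ^ CARD('n) * (a + b + 1) ^ CARD('n)" for a b
  proof -
    have "- msum (npow J (Suc a)) (mm (t * b)) \<subseteq> {k. deg k < d * Suc a + t * b}"
      using msum_npow_mm_mono[OF d, of "Suc a" "t * b"] by (auto simp: mm_def not_le[symmetric])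
    then have "hilb J t a b \<le> card {k :: nat ^ 'n. deg k < d * Suc a + t * b}"
      unfolding hilb_def by (rule card_mono[OF card_deg_less(1)])
    then show ?thesis
      using card_deg_less(2)[where 'n = 'n, of "d * Suc a + t * b"] affine_bound[of d a t b "CARD('n)"] by linarith
  qed
  then have "real (hilb J t a b) \<le> real ((d + t) ^ CARD('n)) * real (a + b + 1) ^ CARD('n)" for a b
    by (simp only: of_nat_power[symmetric] of_nat_mult[symmetric] of_nat_le_iff)
  then show ?thesis by (rule that)
qed

lemma hilb_eq_piece_sum:
  assumes "upset J" "finite (- J)"
  shows "hilb J t = piece_sum (SOME ts. hilb J t = piece_sum ts)"
  using hilb_piecewise_binomial[OF assms, of t] unfolding piecewise_binomial_def by (rule someI_ex)

lemma hilb_has_top_form: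
  fixes J :: "(nat ^ 'n) set"
  assumes "upset J" "finite (- J)"
  shows "has_top_form (hilb J t) CARD('n) (\<lambda>i. real (hlead J t i) / (fact i * fact (CARD('n) - i)))"
proof -
  define ts where "ts = (SOME ts. hilb J t = piece_sum ts)"
  have ts: "hilb J t = piece_sum ts" unfolding ts_def by (rule hilb_eq_piece_sum[OF assms])
  obtain K where "\<And>a b. real (hilb J t a b) \<le> real K * real (a + b + 1) ^ CARD('n)" using hilb_bound[OF assms] by blast
  then have "has_top_form (piece_sum ts) CARD('n) (lead_coeff2 ts CARD('n))"
    unfolding ts by (rule piece_sum_has_top_form)
  then show ?thesis unfolding ts[symmetric] by (simp add: lead_coeff2_def[abs_def] hlead_def ts_def)
qed

text \<open>By uniqueness of top forms the coefficients of the gap are the differences of the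
  normalised values of \<open>hlead\<close>; as scaled counts of pieces they are
  nonnegative.\<close>

lemma gapset_top_form:
  fixes J J' :: "(nat ^ 'n) set"
  assumes "upset J" "finite (- J)" "upset J'" "J \<subseteq> J'"
  obtains L where "has_top_form (\<lambda>a b. card (gapset J J' t (Suc a) b)) CARD('n) L" "\<And>i. 0 \<le> L i"
    "\<And>i. i \<le> CARD('n) \<Longrightarrow> real (hlead J t i) = real (hlead J' t i) + L i * (fact i * fact (CARD('n) - i))"
proof -
  obtain ts where ts: "(\<lambda>a b. card (gapset J J' t (Suc a) b)) = piece_sum ts"
    using gapset_piecewise_binomial[OF assms(1,3,4,2)] by (auto simp: piecewise_binomial_def)
  have ts': "card (gapset J J' t (Suc a) b) = piece_sum ts a b" for a b using ts by (simp add: fun_eq_iff)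
  obtain K where "\<And>a b. real (card (gapset J J' t (Suc a) b)) \<le> real K * real (a + b + 1) ^ CARD('n)"
    using gapset_bound[OF assms(1,2)] by blast
  then have top: "has_top_form (\<lambda>a b. card (gapset J J' t (Suc a) b)) CARD('n) (lead_coeff2 ts CARD('n))"
    unfolding ts ts' by (rule piece_sum_has_top_form)
  have fin': "finite (- J')" by (rule finite_subset[OF _ assms(2)]) (use assms(4) in auto)
  have eq: "hilb J t = (\<lambda>a b. hilb J' t a b + card (gapset J J' t (Suc a) b))"
    using hilb_gapset[OF assms(1,2,4)] by (simp add: fun_eq_iff)
  have "real (hlead J t i) / (fact i * fact (CARD('n) - i))
     = real (hlead J' t i) / (fact i * fact (CARD('n) - i)) + lead_coeff2 ts CARD('n) i" if "i \<le> CARD('n)" for i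
    using has_top_form_unique[OF hilb_has_top_form[OF assms(1,2), of t, unfolded eq]
        has_top_form_add[OF hilb_has_top_form[OF assms(3) fin', of t] top] that] by (simp flip: eq)
  then have "real (hlead J t i) = real (hlead J' t i) + lead_coeff2 ts CARD('n) i * (fact i * fact (CARD('n) - i))"
    if "i \<le> CARD('n)" for i using that by (simp add: field_simps)
  note rel = this
  show ?thesis by (rule that[OF top _ rel]) (simp_all add: lead_coeff2_def)
qed

lemma hlead_mono:
  fixes J J' :: "(nat ^ 'n) set"
  assumes "upset J" "finite (- J)" "upset J'" "J \<subseteq> J'" "i \<le> CARD('n)"
  shows "hlead J' t i \<le> hlead J t i"
proof -
  obtain L where "\<And>i. 0 \<le> L i"
    "\<And>i. i \<le> CARD('n) \<Longrightarrow> real (hlead J t i) = real (hlead J' t i) + L i * (fact i * fact (CARD('n) - i))"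
    by (rule gapset_top_form[OF assms(1-4), of t]) auto
  then have "real (hlead J' t i) \<le> real (hlead J t i)" using assms(5) by simp
  then show ?thesis by simp
qed

lemma gapset_top_form_upper:
  fixes J :: "(nat ^ 'n) set"
  assumes up: "upset J" and fin: "finite (- J)" and t: "1 \<le> t" and i: "i \<le> CARD('n)"
    and thin: "\<And>W. card W < i \<Longrightarrow> \<exists>ka\<in>J. (\<forall>w\<in>W. ka $ w = 0) \<and> deg ka \<le> r"
    and top: "has_top_form (\<lambda>a b. card (gapset J (J \<union> mm r) t (Suc a) b)) CARD('n) L"
    and L: "\<And>i. 0 \<le> L i" and j: "j \<le> i"
  shows "L j = 0"
proof -
  let ?n = "CARD('n)"
  obtain d where d: "mm d \<subseteq> J" using finite_Compl_iff[OF up] fin by blast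
  define N where "N = d + r"
  \<comment> \<open>The factor 2 comes from \<open>Suc x \<le> 2 * x\<close>, and the bound
    \<open>2 * n * N \<le> c\<close> below ensures the hypothesis of \<open>gapset_upper\<close>
    along the ray.\<close>
  define K where "K = real (4 ^ ?n * (2 * N) ^ Suc i * t ^ (?n - i))"
  have "top_form L ?n (real c) * real c \<le> K * real c ^ (?n - i)" if c: "2 * ?n * N \<le> c" "1 \<le> c" for c
  proof (rule LIMSEQ_le_const2)
    show "(\<lambda>x. real (card (gapset J (J \<union> mm r) t (Suc x) (c * x))) / real x ^ ?n * real c) \<longlonglongrightarrow> top_form L ?n (real c) * real c"
      using top c by (intro tendsto_mult tendsto_const) (simp add: has_top_form_def)
    have "real (card (gapset J (J \<union> mm r) t (Suc x) (c * x))) / real x ^ ?n * real c \<le> K * real c ^ (?n - i)" if x: "x \<ge> 1" for x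
    proof -
      let ?G = "card (gapset J (J \<union> mm r) t (Suc x) (c * x))"
      have x2: "Suc x \<le> 2 * x" using x by simp
      have "?n * (N * Suc x) \<le> ?n * (N * (2 * x))" by (intro mult_left_mono x2) auto
      also have "\<dots> = (2 * ?n * N) * x" by simp
      also have "\<dots> \<le> c * x" by (rule mult_right_mono[OF c(1)]) simp
      also have "\<dots> \<le> t * (c * x)" using t by simp
      finally have "?n * ((d + r) * Suc x) \<le> t * (c * x)" by (simp add: N_def)
      from gapset_upper[OF up d i thin this]
      have "?G * (t * (c * x)) \<le> 4 ^ ?n * (N * Suc x) ^ Suc i * (t * (c * x)) ^ (?n - i)" by (simp add: N_def)
      also have "\<dots> \<le> 4 ^ ?n * (N * (2 * x)) ^ Suc i * (t * (c * x)) ^ (?n - i)"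
        by (intro mult_right_mono mult_left_mono power_mono x2) auto
      also have "\<dots> = 4 ^ ?n * (2 * N) ^ Suc i * t ^ (?n - i) * c ^ (?n - i) * (x ^ Suc i * x ^ (?n - i))"
        by (simp add: power_mult_distrib mult_ac)
      also have "x ^ Suc i * x ^ (?n - i) = x * x ^ ?n" using i by (simp flip: power_add)
      finally have "?G * (t * (c * x)) \<le> 4 ^ ?n * (2 * N) ^ Suc i * t ^ (?n - i) * c ^ (?n - i) * (x * x ^ ?n)" .
      moreover have "?G * (c * x) \<le> ?G * (t * (c * x))" using t by simp
      ultimately have "?G * (c * x) \<le> 4 ^ ?n * (2 * N) ^ Suc i * t ^ (?n - i) * c ^ (?n - i) * (x * x ^ ?n)" by linarith
      then have "(?G * c) * x \<le> (4 ^ ?n * (2 * N) ^ Suc i * t ^ (?n - i) * c ^ (?n - i) * x ^ ?n) * x" by (simp only: mult_ac)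
      then have "?G * c \<le> 4 ^ ?n * (2 * N) ^ Suc i * t ^ (?n - i) * c ^ (?n - i) * x ^ ?n" using x by simp
      then have "real (?G * c) \<le> real (4 ^ ?n * (2 * N) ^ Suc i * t ^ (?n - i) * c ^ (?n - i) * x ^ ?n)" by (simp only: of_nat_le_iff)
      then have "real ?G * real c \<le> K * real c ^ (?n - i) * real x ^ ?n" by (simp add: K_def)
      then show ?thesis using x by (simp add: divide_le_eq)
    qed
    then show "\<exists>N. \<forall>x\<ge>N. real (card (gapset J (J \<union> mm r) t (Suc x) (c * x))) / real x ^ ?n * real c \<le> K * real c ^ (?n - i)"
      by blast
  qed
  then show ?thesis using top_form_upper[of ?n L i "2 * ?n * N" K j] L i j by blast
qed

text \<open>The hypothesis \<open>thin\<close> removes the coefficients below \<open>i\<close>, and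
  those above \<open>i\<close> grow too slowly in \<open>c\<close>. The box of
  \<open>gapset_lower\<close> must therefore be accounted for by the coefficient at
  \<open>i\<close>.\<close>

lemma gapset_top_form_lower:
  fixes J :: "(nat ^ 'n) set"
  assumes up: "upset J" and fin: "finite (- J)" and t: "1 \<le> t" and W: "Suc (card W) = i" "i \<le> CARD('n)"
    and thick: "\<And>ka. ka \<in> J \<Longrightarrow> (\<forall>w\<in>W. ka $ w = 0) \<Longrightarrow> r < deg ka"
    and thin: "\<And>V. Suc (card V) < i \<Longrightarrow> \<exists>ka\<in>J. (\<forall>w\<in>V. ka $ w = 0) \<and> deg ka \<le> r"
    and top: "has_top_form (\<lambda>a b. card (gapset J (J \<union> mm r) t (Suc a) b)) CARD('n) L"
    and L: "\<And>i. 0 \<le> L i"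
  shows "L i > 0"
proof -
  let ?n = "CARD('n)"
  \<comment> \<open>Along \<open>x = M * y\<close> the division by \<open>n\<close> in
    \<open>gapset_lower\<close> is exact and a box of side \<open>e = y\<close> is admissible;
    \<open>K\<close> compensates for the passage from \<open>x\<close> to \<open>y\<close>.\<close>
  define M where "M = ?n * (r + 2)"
  have Mpos: "M > 0" by (simp add: M_def)
  define K where "K = 1 / real M ^ ?n"
  have low: "K * real c ^ (?n - i) \<le> top_form L ?n (real c)" if c: "1 \<le> c" for c
  proof (rule LIMSEQ_le_const)
    have "strict_mono (\<lambda>y. M * y)" using Mpos by (simp add: strict_mono_def)
    moreover have "(\<lambda>x. real (card (gapset J (J \<union> mm r) t (Suc x) (c * x))) / real x ^ ?n) \<longlonglongrightarrow> top_form L ?n (real c)"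
      using top c by (simp add: has_top_form_def)
    ultimately show "(\<lambda>y. real (card (gapset J (J \<union> mm r) t (Suc (M * y)) (c * (M * y)))) / real (M * y) ^ ?n) \<longlonglongrightarrow> top_form L ?n (real c)"
      using LIMSEQ_subseq_LIMSEQ unfolding o_def by blast
    have "K * real c ^ (?n - i) \<le> real (card (gapset J (J \<union> mm r) t (Suc (M * y)) (c * (M * y)))) / real (M * y) ^ ?n" if y: "y \<ge> 1" for y
    proof -
      let ?G = "card (gapset J (J \<union> mm r) t (Suc (M * y)) (c * (M * y)))"
      have "t * (c * (M * y)) = (t * c * (r + 2) * y) * ?n" unfolding M_def by (simp only: mult_ac)
      then have "t * (c * (M * y)) div ?n = t * c * (r + 2) * y" by (simp only: nonzero_mult_div_cancel_right[OF zero_less_card_finite[THEN less_imp_neq, symmetric]])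
      moreover have "y * (?n * (r + 2)) < Suc (M * y)" by (simp add: M_def mult_ac)
      ultimately have "y ^ i * (t * c * (r + 2) * y) ^ (?n - i) \<le> ?G"
        using gapset_lower[OF up fin W thick, of y "Suc (M * y)" t "c * (M * y)"] by simp
      moreover have "c * y \<le> t * c * (r + 2) * y"
      proof -
        have "1 * c * 1 \<le> t * c * (r + 2)" using t by (intro mult_mono) auto
        then show ?thesis by (intro mult_right_mono) auto
      qed
      then have "y ^ i * (c * y) ^ (?n - i) \<le> y ^ i * (t * c * (r + 2) * y) ^ (?n - i)"
        by (intro mult_left_mono power_mono) auto
      moreover have "y ^ i * (c * y) ^ (?n - i) = c ^ (?n - i) * y ^ ?n"
        using W(2) by (simp add: power_mult_distrib mult_ac flip: power_add)
      ultimately have "c ^ (?n - i) * y ^ ?n \<le> ?G" by linarith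
      then have "real (c ^ (?n - i) * y ^ ?n) \<le> real ?G" by (simp only: of_nat_le_iff)
      then have "real c ^ (?n - i) * real y ^ ?n \<le> real ?G" by simp
      then show ?thesis using y Mpos by (simp add: K_def field_simps power_mult_distrib)
    qed
    then show "\<exists>N. \<forall>y\<ge>N. K * real c ^ (?n - i) \<le> real (card (gapset J (J \<union> mm r) t (Suc (M * y)) (c * (M * y)))) / real (M * y) ^ ?n"
      by blast
  qed
  have z: "L j = 0" if "j < i" for j
    by (rule gapset_top_form_upper[OF up fin t _ _ top L, of "i - 1"]) (use that W thin in auto)
  show ?thesis by (rule top_form_lower[of ?n L i K]) (use L W(2) Mpos low z in \<open>auto simp: K_def\<close>)
qed

text \<open>If \<open>J\<close> has large order along \<open>x\<^sub>W = 0\<close>, one first enlarges it to \<open>J1\<close>, where the orders along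
  all smaller coordinate subspaces drop but the order along \<open>x\<^sub>W = 0\<close> does not; the gap between
  \<open>J1\<close> and \<open>J \<union> mm r\<close> then has a dominating term of exactly the right bidegree.\<close>

lemma hlead_eq_iff:
  fixes J :: "(nat ^ 'n) set"
  assumes up: "upset J" and fin: "finite (- J)" and t: "1 \<le> t" and i: "1 \<le> i" "i \<le> CARD('n)" and r: "1 \<le> r"
  shows "hlead J t i = hlead (J \<union> mm r) t i \<longleftrightarrow>
     (\<forall>W. card W < i \<longrightarrow> (\<exists>ka\<in>J. (\<forall>w\<in>W. ka $ w = 0) \<and> deg ka \<le> r))"
proof
  assume thin: "\<forall>W. card W < i \<longrightarrow> (\<exists>ka\<in>J. (\<forall>w\<in>W. ka $ w = 0) \<and> deg ka \<le> r)"
  obtain L where L: "has_top_form (\<lambda>a b. card (gapset J (J \<union> mm r) t (Suc a) b)) CARD('n) L" "\<And>i. 0 \<le> L i"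
    "\<And>i. i \<le> CARD('n) \<Longrightarrow> real (hlead J t i) = real (hlead (J \<union> mm r) t i) + L i * (fact i * fact (CARD('n) - i))"
    by (rule gapset_top_form[OF up fin upset_Un[OF up upset_mm[of r]], of t]) auto
  have "L i = 0" by (rule gapset_top_form_upper[OF up fin t i(2) _ L(1,2)]) (use thin in auto)
  then have "real (hlead J t i) = real (hlead (J \<union> mm r) t i)" using L(3)[OF i(2)] by simp
  then show "hlead J t i = hlead (J \<union> mm r) t i" by simp
next
  assume eq: "hlead J t i = hlead (J \<union> mm r) t i"
  show "\<forall>W. card W < i \<longrightarrow> (\<exists>ka\<in>J. (\<forall>w\<in>W. ka $ w = 0) \<and> deg ka \<le> r)"
  proof (rule ccontr)
    assume "\<not> ?thesis"
    then obtain V where V: "card V < i" "\<And>ka. ka \<in> J \<Longrightarrow> (\<forall>w\<in>V. ka $ w = 0) \<Longrightarrow> r < deg ka" by fastforce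
    \<comment> \<open>\<open>V\<close> is enlarged to a set of exactly \<open>i - 1\<close>
      positions. Elements that vanish there also vanish on \<open>V\<close>, so their degrees stay
      above \<open>r\<close>.\<close>
    have "i - 1 - card V \<le> card (- V)" using V(1) i by (simp add: Compl_eq_Diff_UNIV card_Diff_subset)
    then obtain C where C: "C \<subseteq> - V" "card C = i - 1 - card V" by (meson obtain_subset_with_card_n)
    define W where "W = V \<union> C"
    have cW: "Suc (card W) = i"
      unfolding W_def using C V(1) i by (subst card_Un_disjoint) auto
    define J1 where "J1 = J \<union> {k \<in> mm r. \<exists>w\<in>W. k $ w \<noteq> 0}"
    have upset1: "upset J1" using up unfolding J1_def upset_def mm_def by auto
    have fin1: "finite (- J1)" by (rule finite_subset[OF _ fin]) (auto simp: J1_def)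
    have Un1: "J1 \<union> mm r = J \<union> mm r" by (auto simp: J1_def)
    obtain L where L: "has_top_form (\<lambda>a b. card (gapset J1 (J1 \<union> mm r) t (Suc a) b)) CARD('n) L" "\<And>i. 0 \<le> L i"
      "\<And>i. i \<le> CARD('n) \<Longrightarrow> real (hlead J1 t i) = real (hlead (J1 \<union> mm r) t i) + L i * (fact i * fact (CARD('n) - i))"
      by (rule gapset_top_form[OF upset1 fin1 upset_Un[OF upset1 upset_mm[of r]], of t]) auto
    have "L i > 0"
    proof (rule gapset_top_form_lower[OF upset1 fin1 t cW i(2) _ _ L(1,2)])
      show "r < deg ka" if "ka \<in> J1" "\<forall>w\<in>W. ka $ w = 0" for ka
        using V(2)[of ka] that by (auto simp: J1_def W_def)
      show "\<exists>ka\<in>J1. (\<forall>w\<in>V. ka $ w = 0) \<and> deg ka \<le> r" if "Suc (card V) < i" for V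
      proof -
        \<comment> \<open>A set with fewer than \<open>i - 1\<close> elements misses some
          \<open>w\<close> in \<open>W\<close>, and the pure power of exponent \<open>r\<close> of
          that variable belongs to \<open>J1\<close>.\<close>
        have "\<not> W \<subseteq> V" using card_mono[of V W] cW that by auto
        then obtain w where w: "w \<in> W" "w \<notin> V" by blast
        have "axis w r $ w \<noteq> 0" using r by (simp add: axis_def)
        then have "\<exists>w'\<in>W. axis w r $ w' \<noteq> 0" using w by blast
        then have "axis w r \<in> J1" by (simp add: J1_def mm_def)
        moreover have "\<forall>v\<in>V. axis w r $ v = 0" using w by (auto simp: axis_def)
        ultimately show ?thesis by (intro bexI[of _ "axis w r"]) auto
      qed
    qed
    then have "real (hlead (J \<union> mm r) t i) < real (hlead J1 t i)" using L(3)[OF i(2)] by (simp add: Un1)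
    moreover have "hlead J1 t i \<le> hlead J t i" by (rule hlead_mono[OF up fin upset1 _ i(2)]) (simp add: J1_def)
    ultimately show False using eq by simp
  qed
qed

text \<open>For \<open>J = mm s\<close> the colength depends only on \<open>s * (a + 1 + b)\<close>,
  so its top form is \<open>V * (s * (1 + c)) ^ n\<close>, and the binomial theorem gives all
  coefficients. They increase strictly with \<open>s\<close> since \<open>V > 0\<close>.\<close>

lemma hlead_mm_less:
  assumes "r < t" "i \<le> CARD('n)"
  shows "hlead (mm r :: (nat ^ 'n) set) r i < hlead (mm t :: (nat ^ 'n) set) t i"
proof -
  let ?n = "CARD('n)"
  define v where "v N = card (- (mm N :: (nat ^ 'n) set))" for N
  have vle: "v N \<le> N ^ ?n" for N
  proof -
    have "- (mm N :: (nat ^ 'n) set) = {k. deg k < N}" by (auto simp: mm_def)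
    then show ?thesis using card_deg_less(2)[where 'n = 'n, of N] by (simp add: v_def)
  qed
  obtain ts where "(\<lambda>a b. card (- (mm (1 * Suc a) :: (nat ^ 'n) set))) = piece_sum ts"
    using card_Compl_mm_piecewise_binomial unfolding piecewise_binomial_def by blast
  then have ts: "piece_sum ts a b = v (Suc a)" for a b by (simp add: fun_eq_iff v_def)
  have "real (piece_sum ts a b) \<le> 1 * real (a + b + 1) ^ ?n" for a b
  proof -
    have "v (Suc a) \<le> (a + b + 1) ^ ?n" using vle[of "Suc a"] power_mono[of "Suc a" "a + b + 1" ?n] by linarith
    then have "real (v (Suc a)) \<le> real ((a + b + 1) ^ ?n)" by (simp only: of_nat_le_iff)
    then show ?thesis by (simp add: ts)
  qed
  from piece_sum_has_top_form[OF this]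
  have "has_top_form (piece_sum ts) ?n (lead_coeff2 ts ?n)" .
  then have "(\<lambda>x. real (piece_sum ts x (1 * x)) / real x ^ ?n) \<longlonglongrightarrow> top_form (lead_coeff2 ts ?n) ?n (real 1)"
    unfolding has_top_form_def by blast
  then obtain V where V: "(\<lambda>x. real (v (Suc x)) / real x ^ ?n) \<longlonglongrightarrow> V" by (auto simp: ts)
  \<comment> \<open>Only positivity of \<open>V\<close> matters, so cubes of side \<open>y\<close>
    inside the simplex of size \<open>n * y\<close> are a sufficient lower bound.\<close>
  have "1 / real ?n ^ ?n \<le> V"
  proof (rule LIMSEQ_le_const)
    show "(\<lambda>y. real (v (Suc (?n * y))) / real (?n * y) ^ ?n) \<longlonglongrightarrow> V"
      using LIMSEQ_subseq_LIMSEQ[OF V, of "\<lambda>y. ?n * y"] by (simp add: o_def strict_mono_def)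
    have "1 / real ?n ^ ?n \<le> real (v (Suc (?n * y))) / real (?n * y) ^ ?n" if y: "y \<ge> 1" for y
    proof -
      have "{k :: nat ^ 'n. \<forall>j. k $ j < y} \<subseteq> - mm (Suc (?n * y))"
      proof
        fix k :: "nat ^ 'n" assume "k \<in> {k. \<forall>j. k $ j < y}"
        then have "deg k \<le> (\<Sum>j\<in>(UNIV :: 'n set). y)" unfolding deg_def by (intro sum_mono) (auto intro: less_imp_le)
        then show "k \<in> - mm (Suc (?n * y))" by (simp add: mm_def)
      qed
      then have "y ^ ?n \<le> v (Suc (?n * y))"
        using card_mono[OF finite_Compl_mm, of "{k :: nat ^ 'n. \<forall>j. k $ j < y}"] finite_vec_box(2)[where 'n = 'n, of "\<lambda>_. y"]
        by (simp add: v_def)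
      then have "real (y ^ ?n) \<le> real (v (Suc (?n * y)))" by (simp only: of_nat_le_iff)
      then show ?thesis using y by (simp add: field_simps power_mult_distrib)
    qed
    then show "\<exists>N. \<forall>y\<ge>N. 1 / real ?n ^ ?n \<le> real (v (Suc (?n * y))) / real (?n * y) ^ ?n" by blast
  qed
  moreover have "0 < 1 / real ?n ^ ?n" by simp
  ultimately have Vpos: "V > 0" by linarith
  have hilb_v: "hilb (mm s :: (nat ^ 'n) set) s a b = v (s * (Suc a + b))" for s a b
    unfolding hilb_def v_def npow_mm msum_mm distrib_left ..
  have lim: "(\<lambda>x. real (v (s * (Suc x + c * x))) / real x ^ ?n) \<longlonglongrightarrow> V * (real s * (1 + real c)) ^ ?n" if c: "1 \<le> c" for s c
  proof (cases s)
    case 0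
    then show ?thesis by (simp add: v_def zero_power)
  next
    case (Suc s')
    define m where "m x = s * (1 + c) * x + s'" for x
    have m: "s * (Suc x + c * x) = Suc (m x)" for x by (simp add: m_def Suc algebra_simps)
    have "filterlim m at_top sequentially"
    proof (rule filterlim_at_top_mono[OF filterlim_ident])
      show "\<forall>\<^sub>F x in sequentially. x \<le> m x" by (simp add: m_def Suc)
    qed
    then have l1: "(\<lambda>x. real (v (Suc (m x))) / real (m x) ^ ?n) \<longlonglongrightarrow> V"
      using filterlim_compose[OF V] by blast
    have l2: "(\<lambda>x. ((real ((s * (1 + c)) * x - 0) + real s') / real x) ^ ?n) \<longlonglongrightarrow> real (s * (1 + c)) ^ ?n"
      by (intro tendsto_power affine_over_n) (simp add: Suc)
    have "(\<lambda>x. real (v (Suc (m x))) / real (m x) ^ ?n * ((real ((s * (1 + c)) * x - 0) + real s') / real x) ^ ?n)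
       \<longlonglongrightarrow> V * real (s * (1 + c)) ^ ?n" by (intro tendsto_mult l1 l2)
    moreover have "\<forall>\<^sub>F x in sequentially. real (v (Suc (m x))) / real (m x) ^ ?n * ((real ((s * (1 + c)) * x - 0) + real s') / real x) ^ ?n
        = real (v (s * (Suc x + c * x))) / real x ^ ?n"
      using eventually_gt_at_top[of 0]
    proof eventually_elim
      case (elim x)
      have "m x > 0" using elim by (simp add: m_def Suc)
      moreover have "real ((s * (1 + c)) * x - 0) + real s' = real (m x)" by (simp add: m_def)
      ultimately show ?case unfolding m by (simp add: power_divide)
    qed
    ultimately have "(\<lambda>x. real (v (s * (Suc x + c * x))) / real x ^ ?n) \<longlonglongrightarrow> V * real (s * (1 + c)) ^ ?n"
      by (rule Lim_transform_eventually)
    then show ?thesis by (simp only: of_nat_mult of_nat_add of_nat_1)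
  qed
  have top: "has_top_form (hilb (mm s :: (nat ^ 'n) set) s) ?n (\<lambda>i. V * real s ^ ?n * real (?n choose i))" for s
    unfolding has_top_form_def
  proof (intro allI impI)
    fix c :: nat assume c: "c \<ge> 1"
    have "(1 + real c) ^ ?n = (\<Sum>i\<le>?n. real (?n choose i) * real c ^ (?n - i))"
      using binomial_ring[of 1 "real c" ?n] by simp
    then have "top_form (\<lambda>i. V * real s ^ ?n * real (?n choose i)) ?n (real c) = V * (real s * (1 + real c)) ^ ?n"
      by (simp add: top_form_def power_mult_distrib sum_distrib_left mult.assoc)
    then show "(\<lambda>x. real (hilb (mm s :: (nat ^ 'n) set) s x (c * x)) / real x ^ ?n) \<longlonglongrightarrow> top_form (\<lambda>i. V * real s ^ ?n * real (?n choose i)) ?n (real c)"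
      using lim[OF c, of s] by (simp add: hilb_v)
  qed
  have val: "real (hlead (mm s :: (nat ^ 'n) set) s i) = V * real s ^ ?n * real (?n choose i) * (fact i * fact (?n - i))" for s
    using has_top_form_unique[OF hilb_has_top_form[OF upset_mm finite_Compl_mm] top assms(2), of s] by (simp add: field_simps)
  have "real r ^ ?n < real t ^ ?n" using assms(1) by (intro power_strict_mono) auto
  then have "V * real r ^ ?n * real (?n choose i) * (fact i * fact (?n - i)) < V * real t ^ ?n * real (?n choose i) * (fact i * fact (?n - i))"
    using Vpos assms(2) by (intro mult_strict_right_mono mult_strict_left_mono) auto
  then have "real (hlead (mm r :: (nat ^ 'n) set) r i) < real (hlead (mm t :: (nat ^ 'n) set) t i)" by (simp only: val)
  then show ?thesis by simp
qed

section \<open>Length polynomials\<close>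

definition mono_eval :: "(nat \<Rightarrow>\<^sub>0 nat) \<Rightarrow> (nat \<Rightarrow> rat) \<Rightarrow> rat" where
  "mono_eval m x = (\<Prod>j\<in>Poly_Mapping.keys m. x j ^ Poly_Mapping.lookup m j)"

lemma mono_eval_superset:
  assumes "finite T" "Poly_Mapping.keys m \<subseteq> T"
  shows "mono_eval m x = (\<Prod>j\<in>T. x j ^ Poly_Mapping.lookup m j)"
  unfolding mono_eval_def using assms by (intro prod.mono_neutral_left) (auto simp: in_keys_iff)

lemma mono_eval_add: "mono_eval (m + m') x = mono_eval m x * mono_eval m' x"
proof -
  let ?T = "Poly_Mapping.keys m \<union> Poly_Mapping.keys m'"
  have "mono_eval (m + m') x = (\<Prod>j\<in>?T. x j ^ Poly_Mapping.lookup (m + m') j)"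
    by (rule mono_eval_superset) (use Poly_Mapping.keys_add[of m m'] in auto)
  also have "\<dots> = (\<Prod>j\<in>?T. x j ^ Poly_Mapping.lookup m j) * (\<Prod>j\<in>?T. x j ^ Poly_Mapping.lookup m' j)"
    by (simp add: lookup_add power_add prod.distrib)
  also have "\<dots> = mono_eval m x * mono_eval m' x"
    using mono_eval_superset[of ?T m x] mono_eval_superset[of ?T m' x] by simp
  finally show ?thesis .
qed

lemma mono_eval_single: "mono_eval (Poly_Mapping.single j 1) x = x j"
  by (simp add: mono_eval_def)

definition mono_deg :: "(nat \<Rightarrow>\<^sub>0 nat) \<Rightarrow> nat" where
  "mono_deg m = (\<Sum>j\<in>Poly_Mapping.keys m. Poly_Mapping.lookup m j)"

lemma mono_deg_superset:
  assumes "finite T" "Poly_Mapping.keys m \<subseteq> T"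
  shows "mono_deg m = (\<Sum>j\<in>T. Poly_Mapping.lookup m j)"
  unfolding mono_deg_def using assms by (intro sum.mono_neutral_left) (auto simp: in_keys_iff)

definition monomials_le :: "nat \<Rightarrow> nat \<Rightarrow> (nat \<Rightarrow>\<^sub>0 nat) set" where
  "monomials_le n D = {m. Poly_Mapping.keys m \<subseteq> {..<n} \<and> mono_deg m \<le> D}"

lemma monos_add_single:
  assumes "m \<in> monomials_le n D" "j < n"
  shows "m + Poly_Mapping.single j 1 \<in> monomials_le n (Suc D)"
proof -
  have k: "Poly_Mapping.keys (m + Poly_Mapping.single j 1) \<subseteq> {..<n}"
    using Poly_Mapping.keys_add[of m "Poly_Mapping.single j 1"] assms by (auto simp: monomials_le_def)
  have "mono_deg (m + Poly_Mapping.single j 1) = (\<Sum>l<n. Poly_Mapping.lookup m l) + (\<Sum>l<n. if l = j then 1 else 0)"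
    using mono_deg_superset[OF _ k] by (simp add: lookup_add sum.distrib lookup_single when_def eq_commute)
  also have "(\<Sum>l<n. Poly_Mapping.lookup m l) = mono_deg m"
    using mono_deg_superset[of "{..<n}" m] assms by (simp add: monomials_le_def)
  finally show ?thesis using k assms by (simp add: monomials_le_def)
qed

text \<open>Polynomials are handled as functions, so that closure under sums and products involves
  no coefficients; \<open>polyfun_imp_mpoly\<close> returns to the formal polynomials required by
  \<open>is_length_poly\<close>.\<close>

definition polyfun :: "nat \<Rightarrow> nat \<Rightarrow> ((nat \<Rightarrow> rat) \<Rightarrow> rat) \<Rightarrow> bool" where
  "polyfun n D F \<longleftrightarrow> (\<exists>S c. finite S \<and> S \<subseteq> monomials_le n D \<and> (\<forall>x. F x = (\<Sum>m\<in>S. c m * mono_eval m x)))"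

lemma polyfun_zero: "polyfun n D (\<lambda>x. 0)"
  unfolding polyfun_def by (rule exI[of _ "{}"]) simp

lemma polyfun_one: "polyfun n D (\<lambda>x. 1)"
  unfolding polyfun_def
  by (rule exI[of _ "{0}"], rule exI[of _ "\<lambda>_. 1"]) (simp add: monomials_le_def mono_deg_def mono_eval_def)

lemma polyfun_add:
  assumes "polyfun n D F" "polyfun n D G"
  shows "polyfun n D (\<lambda>x. F x + G x)"
proof -
  obtain S c where S: "finite S" "S \<subseteq> monomials_le n D" "\<And>x. F x = (\<Sum>m\<in>S. c m * mono_eval m x)"
    using assms(1) unfolding polyfun_def by blast
  obtain T e where T: "finite T" "T \<subseteq> monomials_le n D" "\<And>x. G x = (\<Sum>m\<in>T. e m * mono_eval m x)"
    using assms(2) unfolding polyfun_def by blast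
  define f where "f m = (if m \<in> S then c m else 0) + (if m \<in> T then e m else 0)" for m
  have "F x + G x = (\<Sum>m\<in>S \<union> T. f m * mono_eval m x)" for x
  proof -
    have "F x = (\<Sum>m\<in>S \<union> T. (if m \<in> S then c m else 0) * mono_eval m x)"
      unfolding S(3) by (rule sum.mono_neutral_cong_left) (use S T in auto)
    moreover have "G x = (\<Sum>m\<in>S \<union> T. (if m \<in> T then e m else 0) * mono_eval m x)"
      unfolding T(3) by (rule sum.mono_neutral_cong_left) (use S T in auto)
    ultimately show ?thesis by (simp add: f_def distrib_right sum.distrib)
  qed
  then show ?thesis unfolding polyfun_def using S T by (intro exI[of _ "S \<union> T"] exI[of _ f]) auto
qed

lemma polyfun_scale:
  assumes "polyfun n D F"
  shows "polyfun n D (\<lambda>x. a * F x)"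
proof -
  obtain S c where S: "finite S" "S \<subseteq> monomials_le n D" "\<And>x. F x = (\<Sum>m\<in>S. c m * mono_eval m x)"
    using assms unfolding polyfun_def by blast
  then have "a * F x = (\<Sum>m\<in>S. (a * c m) * mono_eval m x)" for x by (simp add: sum_distrib_left mult.assoc)
  then show ?thesis unfolding polyfun_def using S(1,2)
    by (intro exI[of _ S] exI[of _ "\<lambda>m. a * c m"]) simp
qed

lemma polyfun_mono: "polyfun n D F \<Longrightarrow> D \<le> D' \<Longrightarrow> polyfun n D' F"
  unfolding polyfun_def monomials_le_def by fastforce

lemma polyfun_sum:
  "finite A \<Longrightarrow> (\<And>a. a \<in> A \<Longrightarrow> polyfun n D (F a)) \<Longrightarrow> polyfun n D (\<lambda>x. \<Sum>a\<in>A. F a x)"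
  by (induction A rule: finite_induct) (auto intro: polyfun_zero polyfun_add)

lemma polyfun_sum_list:
  "(\<And>a. a \<in> set as \<Longrightarrow> polyfun n D (F a)) \<Longrightarrow> polyfun n D (\<lambda>x. \<Sum>a\<leftarrow>as. F a x)"
  by (induction as) (auto intro: polyfun_zero polyfun_add)

lemma polyfun_mult_var:
  assumes "polyfun n D F" "j < n"
  shows "polyfun n (Suc D) (\<lambda>x. x j * F x)"
proof -
  obtain S c where S: "finite S" "S \<subseteq> monomials_le n D" "\<And>x. F x = (\<Sum>m\<in>S. c m * mono_eval m x)"
    using assms(1) unfolding polyfun_def by blast
  let ?s = "Poly_Mapping.single j (1 :: nat)"
  have inj: "inj_on (\<lambda>m. m + ?s) S" by (simp add: inj_on_def)
  have "x j * F x = (\<Sum>m\<in>(\<lambda>m. m + ?s) ` S. c (m - ?s) * mono_eval m x)" for x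
    unfolding S(3) by (simp add: sum.reindex[OF inj] mono_eval_add mono_eval_single sum_distrib_left mult_ac del: One_nat_def)
  moreover have "(\<lambda>m. m + ?s) ` S \<subseteq> monomials_le n (Suc D)" using S(2) monos_add_single[OF _ assms(2)] by blast
  ultimately show ?thesis unfolding polyfun_def using S(1)
    by (intro exI[of _ "(\<lambda>m. m + ?s) ` S"] exI[of _ "\<lambda>m. c (m - ?s)"]) simp
qed

lemma polyfun_mult_linear:
  assumes "polyfun n D F" "T \<subseteq> {..<n}"
  shows "polyfun n (Suc D) (\<lambda>x. ((\<Sum>j\<in>T. x j) + e) * F x)"
proof -
  have "polyfun n (Suc D) (\<lambda>x. \<Sum>j\<in>T. x j * F x)"
    by (rule polyfun_sum) (use assms finite_subset in \<open>auto intro: polyfun_mult_var\<close>)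
  moreover have "polyfun n (Suc D) (\<lambda>x. e * F x)" by (intro polyfun_scale polyfun_mono[OF assms(1)]) simp
  ultimately have "polyfun n (Suc D) (\<lambda>x. (\<Sum>j\<in>T. x j * F x) + e * F x)" by (rule polyfun_add)
  then show ?thesis by (simp add: distrib_right sum_distrib_right)
qed

text \<open>Each increase of \<open>u\<close> multiplies by one linear factor
  \<open>(z - u) / (u + 1)\<close>, hence raises the degree by one.\<close>

lemma polyfun_mult_gbinomial:
  assumes "polyfun n D F" "T \<subseteq> {..<n}"
  shows "polyfun n (D + u) (\<lambda>x. (((\<Sum>j\<in>T. x j) + e) gchoose u) * F x)"
proof (induction u)
  case 0
  then show ?case using assms by simp
next
  case (Suc u)
  have "polyfun n (Suc (D + u)) (\<lambda>x. ((\<Sum>j\<in>T. x j) + (e - of_nat u)) * ((((\<Sum>j\<in>T. x j) + e) gchoose u) * F x))"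
    by (rule polyfun_mult_linear[OF Suc assms(2)])
  from polyfun_scale[OF this, of "1 / of_nat (Suc u)"]
  have p: "polyfun n (Suc (D + u)) (\<lambda>x. 1 / of_nat (Suc u) * (((\<Sum>j\<in>T. x j) + (e - of_nat u)) * ((((\<Sum>j\<in>T. x j) + e) gchoose u) * F x)))" .
  have g: "(a gchoose Suc u) = 1 / of_nat (Suc u) * ((a - of_nat u) * (a gchoose u))" for a :: rat
    by (simp add: gbinomial_prod_rev field_simps)
  have "(\<lambda>x. 1 / of_nat (Suc u) * (((\<Sum>j\<in>T. x j) + (e - of_nat u)) * ((((\<Sum>j\<in>T. x j) + e) gchoose u) * F x)))
     = (\<lambda>x. (((\<Sum>j\<in>T. x j) + e) gchoose Suc u) * F x)"
    unfolding g by (simp add: fun_eq_iff mult_ac add_diff_eq del: of_nat_Suc)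
  then show ?case using p by simp
qed

lemma polyfun_imp_mpoly:
  assumes "polyfun n D F"
  obtains P :: rat_mpoly where "Poly_Mapping.keys P \<subseteq> monomials_le n D" "\<And>x. mpoly_eval P x = F x"
proof -
  obtain S c where S: "finite S" "S \<subseteq> monomials_le n D" "\<And>x. F x = (\<Sum>m\<in>S. c m * mono_eval m x)"
    using assms unfolding polyfun_def by blast
  define P :: rat_mpoly where "P = (\<Sum>m\<in>S. Poly_Mapping.single m (c m))"
  have lP: "Poly_Mapping.lookup P m = (if m \<in> S then c m else 0)" for m
    using S(1) by (simp add: P_def lookup_sum lookup_single when_def)
  have kP: "Poly_Mapping.keys P \<subseteq> S" by (auto simp: in_keys_iff lP split: if_splits)
  have "mpoly_eval P x = F x" for x
  proof -
    have "mpoly_eval P x = (\<Sum>m\<in>Poly_Mapping.keys P. Poly_Mapping.lookup P m * mono_eval m x)"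
      by (simp add: mpoly_eval_def mono_eval_def)
    also have "\<dots> = (\<Sum>m\<in>S. c m * mono_eval m x)"
      by (rule sum.mono_neutral_cong_left) (use S(1) kP in \<open>auto simp: lP in_keys_iff\<close>)
    finally show ?thesis by (simp add: S(3))
  qed
  then show ?thesis using that kP S(2) by blast
qed

section \<open>Polynomials are determined by their values on a translated orthant\<close>

lemma digits_unique:
  fixes f g :: "nat \<Rightarrow> nat"
  assumes "(\<Sum>j<n. f j * b ^ j) = (\<Sum>j<n. g j * b ^ j)" "\<And>j. j < n \<Longrightarrow> f j < b" "\<And>j. j < n \<Longrightarrow> g j < b" "j < n"
  shows "f j = g j"
  using assms
proof (induction n arbitrary: f g j)
  case (Suc n)
  have e: "(\<Sum>j<Suc n. h j * b ^ j) = h 0 + b * (\<Sum>j<n. h (Suc j) * b ^ j)" for h :: "nat \<Rightarrow> nat"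
    by (simp only: sum.lessThan_Suc_shift) (simp add: sum_distrib_left mult_ac)
  have eq: "f 0 + b * (\<Sum>j<n. f (Suc j) * b ^ j) = g 0 + b * (\<Sum>j<n. g (Suc j) * b ^ j)"
    using Suc.prems(1) by (simp only: e)
  have b: "f 0 < b" "g 0 < b" using Suc.prems(2,3)[of 0] by auto
  have 0: "f 0 = g 0" using arg_cong[OF eq, of "\<lambda>x. x mod b"] b by simp
  moreover have "(\<Sum>j<n. f (Suc j) * b ^ j) = (\<Sum>j<n. g (Suc j) * b ^ j)" using eq 0 b by simp
  ultimately show ?case using Suc.IH[of "\<lambda>j. f (Suc j)" "\<lambda>j. g (Suc j)" "j - 1"] Suc.prems by (cases j) auto
qed simp

text \<open>Kronecker substitution \<open>x\<^sub>j = t\<^bsup>(D+1)\<^sup>j\<^esup>\<close> reduces the vanishing of a polynomial on a translated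
  orthant to one variable.\<close>

lemma mpoly_zero_if_vanishes:
  fixes P :: rat_mpoly
  assumes keys: "Poly_Mapping.keys P \<subseteq> monomials_le n D"
    and van: "\<And>r. (\<And>j. j < n \<Longrightarrow> N \<le> r j) \<Longrightarrow> mpoly_eval P (\<lambda>j. of_nat (r j)) = 0"
  shows "P = 0"
proof (rule poly_mapping_eqI)
  fix m0
  define e where "e m = (\<Sum>j<n. Poly_Mapping.lookup m j * (Suc D) ^ j)" for m :: "nat \<Rightarrow>\<^sub>0 nat"
  have small: "Poly_Mapping.lookup m j < Suc D" if "m \<in> monomials_le n D" "j < n" for m j
  proof -
    have "Poly_Mapping.lookup m j \<le> (\<Sum>j<n. Poly_Mapping.lookup m j)" using that by (intro member_le_sum) auto
    then show ?thesis using that mono_deg_superset[of "{..<n}" m] by (simp add: monomials_le_def)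
  qed
  have inj: "inj_on e (Poly_Mapping.keys P)"
  proof (rule inj_onI)
    fix m m' assume m: "m \<in> Poly_Mapping.keys P" "m' \<in> Poly_Mapping.keys P" "e m = e m'"
    have "Poly_Mapping.lookup m j = Poly_Mapping.lookup m' j" for j
    proof (cases "j < n")
      case True
      then show ?thesis
        using digits_unique[of "Poly_Mapping.lookup m" "Suc D" n "Poly_Mapping.lookup m'" j] m keys small
        unfolding e_def by blast
    next
      case False
      then have "j \<notin> Poly_Mapping.keys m" "j \<notin> Poly_Mapping.keys m'" using m keys by (auto simp: monomials_le_def)
      then show ?thesis by (simp add: in_keys_iff)
    qed
    then show "m = m'" by (rule poly_mapping_eqI)
  qed
  define p where "p = (\<Sum>m\<in>Poly_Mapping.keys P. Polynomial.monom (Poly_Mapping.lookup P m) (e m))"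
  have "poly p (of_nat t) = 0" if t: "t \<ge> Suc N" for t
  proof -
    have me: "mono_eval m (\<lambda>j. of_nat (t ^ (Suc D ^ j))) = of_nat t ^ e m" if "m \<in> Poly_Mapping.keys P" for m
    proof -
      have "mono_eval m (\<lambda>j. of_nat (t ^ (Suc D ^ j))) = (\<Prod>j<n. of_nat (t ^ (Suc D ^ j)) ^ Poly_Mapping.lookup m j)"
        by (rule mono_eval_superset) (use that keys in \<open>auto simp: monomials_le_def\<close>)
      also have "\<dots> = (\<Prod>j<n. of_nat t ^ (Poly_Mapping.lookup m j * Suc D ^ j))"
        by (simp add: power_mult[symmetric] mult.commute)
      also have "\<dots> = of_nat t ^ e m" by (simp add: power_sum e_def)
      finally show ?thesis .
    qed
    have "poly p (of_nat t) = (\<Sum>m\<in>Poly_Mapping.keys P. Poly_Mapping.lookup P m * of_nat t ^ e m)"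
      by (simp add: p_def poly_sum poly_monom)
    also have "\<dots> = (\<Sum>m\<in>Poly_Mapping.keys P. Poly_Mapping.lookup P m * mono_eval m (\<lambda>j. of_nat (t ^ (Suc D ^ j))))"
      by (intro sum.cong refl arg_cong2[where f = "(*)"]) (simp only: me)
    also have "\<dots> = mpoly_eval P (\<lambda>j. of_nat (t ^ (Suc D ^ j)))" by (simp add: mpoly_eval_def mono_eval_def)
    also have "\<dots> = 0"
    proof (rule van)
      fix j
      have "t ^ 1 \<le> t ^ (Suc D ^ j)" using t by (intro power_increasing) auto
      then show "N \<le> t ^ (Suc D ^ j)" using t by simp
    qed
    finally show ?thesis .
  qed
  then have sub: "(of_nat ` {Suc N..} :: rat set) \<subseteq> {z. poly p z = 0}" by auto
  have "infinite (of_nat ` {Suc N..} :: rat set)" by (simp add: finite_image_iff infinite_Ici inj_on_def)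
  then have "p = 0" using sub poly_roots_finite[of p] finite_subset by blast
  show "Poly_Mapping.lookup P m0 = Poly_Mapping.lookup 0 m0"
  proof (cases "m0 \<in> Poly_Mapping.keys P")
    case True
    have "Polynomial.coeff p (e m0) = (\<Sum>m\<in>Poly_Mapping.keys P. if m = m0 then Poly_Mapping.lookup P m else 0)"
      unfolding p_def coeff_sum by (rule sum.cong) (use inj True in \<open>auto simp: inj_on_def\<close>)
    also have "\<dots> = Poly_Mapping.lookup P m0" using True by simp
    finally show ?thesis using \<open>p = 0\<close> by simp
  next
    case False
    then show ?thesis by (simp add: in_keys_iff)
  qed
qed

text \<open>The difference vanishes on a translated orthant. This gives meaning to the definite
  description in \<open>mixed_mult\<close>.\<close>

lemma length_poly_unique:
  assumes "is_length_poly R Is P" "is_length_poly R Is Q"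
  shows "P = Q"
proof -
  let ?n = "length Is"
  have kP: "Poly_Mapping.keys P \<subseteq> monomials_le ?n ?n" and kQ: "Poly_Mapping.keys Q \<subseteq> monomials_le ?n ?n"
    using assms by (auto simp: is_length_poly_def monomials_le_def mono_deg_def)
  obtain N1 N2 where
    N: "\<And>r. (\<forall>j<?n. N1 \<le> r j) \<Longrightarrow> mpoly_eval P (\<lambda>j. of_nat (r j)) = of_nat (the_enat (colength R (ideal_power_prod R Is r)))"
       "\<And>r. (\<forall>j<?n. N2 \<le> r j) \<Longrightarrow> mpoly_eval Q (\<lambda>j. of_nat (r j)) = of_nat (the_enat (colength R (ideal_power_prod R Is r)))"
    using assms unfolding is_length_poly_def by blast
  have "P - Q = 0"
  proof (rule mpoly_zero_if_vanishes[where N = "max N1 N2"])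
    show "Poly_Mapping.keys (P - Q) \<subseteq> monomials_le ?n ?n"
    proof
      fix m assume "m \<in> Poly_Mapping.keys (P - Q)"
      then have "m \<in> Poly_Mapping.keys P \<or> m \<in> Poly_Mapping.keys Q" by (auto simp: in_keys_iff lookup_minus)
      then show "m \<in> monomials_le ?n ?n" using kP kQ by blast
    qed
    fix r :: "nat \<Rightarrow> nat" assume r: "\<And>j. j < ?n \<Longrightarrow> max N1 N2 \<le> r j"
    let ?S = "Poly_Mapping.keys P \<union> Poly_Mapping.keys Q"
    have ev: "mpoly_eval X x = (\<Sum>m\<in>?S. Poly_Mapping.lookup X m * mono_eval m x)"
      if "Poly_Mapping.keys X \<subseteq> ?S" for X :: rat_mpoly and x
      unfolding mpoly_eval_def mono_eval_def[symmetric]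
      by (rule sum.mono_neutral_left) (use that in \<open>auto simp: in_keys_iff\<close>)
    have "mpoly_eval (P - Q) x = mpoly_eval P x - mpoly_eval Q x" for x
      using ev[of P x] ev[of Q x] ev[of "P - Q" x]
      by (auto simp: lookup_minus left_diff_distrib sum_subtractf in_keys_iff subset_iff)
    then show "mpoly_eval (P - Q) (\<lambda>j. of_nat (r j)) = 0" using N(1)[of r] N(2)[of r] r by simp
  qed
  then show ?thesis by simp
qed

section \<open>Mixed coefficients as iterated differences\<close>

text \<open>The coefficient of \<open>x\<^sub>0 \<cdots> x\<^sub>n\<^sub>-\<^sub>1\<close> in a polynomial of degree at most \<open>n\<close> is its iterated
  difference in all variables.\<close>

primrec iter_diff :: "nat \<Rightarrow> ((nat \<Rightarrow> rat) \<Rightarrow> rat) \<Rightarrow> (nat \<Rightarrow> rat) \<Rightarrow> rat" where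
  "iter_diff 0 F x = F x"
| "iter_diff (Suc k) F x = iter_diff k F (x(k := x k + 1)) - iter_diff k F x"

lemma iter_diff_sum: "iter_diff k (\<lambda>x. \<Sum>a\<in>A. c a * F a x) x = (\<Sum>a\<in>A. c a * iter_diff k (F a) x)"
  by (induction k arbitrary: x) (simp_all add: sum_subtractf right_diff_distrib)

lemma iter_diff_sum_list: "iter_diff k (\<lambda>x. \<Sum>a\<leftarrow>as. F a x) x = (\<Sum>a\<leftarrow>as. iter_diff k (F a) x)"
  by (induction k arbitrary: x) (simp_all add: sum_list_subtractf)

lemma iter_diff_prod:
  fixes h :: "nat \<Rightarrow> rat \<Rightarrow> rat"
  shows "k \<le> n \<Longrightarrow> iter_diff k (\<lambda>x. \<Prod>j<n. h j (x j)) x =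
     (\<Prod>j<n. if j < k then h j (x j + 1) - h j (x j) else h j (x j))"
proof (induction k arbitrary: x)
  case (Suc k)
  have IH: "iter_diff k (\<lambda>x. \<Prod>j<n. h j (x j)) y = (\<Prod>j<n. if j < k then h j (y j + 1) - h j (y j) else h j (y j))" for y
    using Suc by simp
  have split: "(\<Prod>j<n. g j) = g k * (\<Prod>j\<in>{..<n} - {k}. g j)" for g :: "nat \<Rightarrow> rat"
    by (rule prod.remove) (use Suc.prems in auto)
  let ?R = "\<Prod>j\<in>{..<n} - {k}. if j < k then h j (x j + 1) - h j (x j) else h j (x j)"
  have "iter_diff (Suc k) (\<lambda>x. \<Prod>j<n. h j (x j)) x = h k (x k + 1) * ?R - h k (x k) * ?R"
  proof -
    have "(\<Prod>j\<in>{..<n} - {k}. if j < k then h j ((x(k := x k + 1)) j + 1) - h j ((x(k := x k + 1)) j) else h j ((x(k := x k + 1)) j)) = ?R"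
      by (rule prod.cong) auto
    then show ?thesis by (simp only: iter_diff.simps IH) (simp add: split)
  qed
  also have "\<dots> = (h k (x k + 1) - h k (x k)) * ?R" by (simp add: left_diff_distrib)
  also have "?R = (\<Prod>j\<in>{..<n} - {k}. if j < Suc k then h j (x j + 1) - h j (x j) else h j (x j))"
    by (rule prod.cong) auto
  finally show ?case by (simp add: split)
qed simp

text \<open>At the origin the difference of \<open>x^e\<close> is \<open>1 - 0^e\<close>, so only
  monomials that involve every variable survive; the degree bound leaves just the squarefree
  one.\<close>

lemma iter_diff_mono_eval:
  assumes "m \<in> monomials_le n n"
  shows "iter_diff n (mono_eval m) (\<lambda>_. 0) = (if m = (\<Sum>j<n. Poly_Mapping.single j 1) then 1 else 0)"
proof -
  have "mono_eval m = (\<lambda>x. \<Prod>j<n. x j ^ Poly_Mapping.lookup m j)"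
    using assms mono_eval_superset[of "{..<n}" m] by (auto simp: monomials_le_def fun_eq_iff)
  then have d: "iter_diff n (mono_eval m) (\<lambda>_. 0) = (\<Prod>j<n. 1 - 0 ^ Poly_Mapping.lookup m j)"
    using iter_diff_prod[of n n "\<lambda>j y. y ^ Poly_Mapping.lookup m j" "\<lambda>_. 0"] by simp
  have one: "Poly_Mapping.lookup (\<Sum>j<n. Poly_Mapping.single j (1 :: nat)) l = (if l < n then 1 else 0)" for l
    by (simp add: lookup_sum lookup_single when_def)
  show ?thesis
  proof (cases "\<forall>j<n. Poly_Mapping.lookup m j > 0")
    case True
    have "(\<Sum>j<n. Poly_Mapping.lookup m j) \<le> n"
      using assms mono_deg_superset[of "{..<n}" m] by (simp add: monomials_le_def)
    moreover have "(\<Sum>j<n. Poly_Mapping.lookup m j) = (\<Sum>j<n. 1 + (Poly_Mapping.lookup m j - 1))"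
      by (rule sum.cong) (use True in auto)
    moreover have "(\<Sum>j<n. 1 + (Poly_Mapping.lookup m j - 1)) = n + (\<Sum>j<n. Poly_Mapping.lookup m j - 1)"
      by (simp only: sum.distrib) simp
    ultimately have "(\<Sum>j<n. Poly_Mapping.lookup m j - 1) = 0" by linarith
    then have "Poly_Mapping.lookup m j - 1 = 0" if "j < n" for j using that by simp
    then have "Poly_Mapping.lookup m j = 1" if "j < n" for j using True that by (metis One_nat_def Suc_pred add_0 plus_1_eq_Suc)
    moreover have "Poly_Mapping.lookup m j = 0" if "\<not> j < n" for j
      using assms that by (auto simp: monomials_le_def in_keys_iff subset_iff)
    ultimately have "m = (\<Sum>j<n. Poly_Mapping.single j 1)" by (intro poly_mapping_eqI) (simp add: one del: One_nat_def)
    moreover have "(\<Prod>j<n. 1 - 0 ^ Poly_Mapping.lookup m j) = (\<Prod>j<n. 1 :: rat)"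
      by (rule prod.cong) (use True in \<open>auto simp: zero_power\<close>)
    ultimately show ?thesis using d by simp
  next
    case False
    then obtain j where j: "j < n" "Poly_Mapping.lookup m j = 0" by auto
    then have "m \<noteq> (\<Sum>j<n. Poly_Mapping.single j 1)" using one[of j] by auto
    moreover have "(\<Prod>j<n. 1 - 0 ^ Poly_Mapping.lookup m j) = (0 :: rat)"
      by (rule prod_zero) (use j in \<open>auto intro!: bexI[of _ j]\<close>)
    ultimately show ?thesis by (simp add: d)
  qed
qed

lemma iter_diff_eq_coeff:
  fixes P :: rat_mpoly
  assumes "Poly_Mapping.keys P \<subseteq> monomials_le n n"
  shows "Poly_Mapping.lookup P (\<Sum>j<n. Poly_Mapping.single j 1) = iter_diff n (mpoly_eval P) (\<lambda>_. 0)"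
proof -
  have "mpoly_eval P = (\<lambda>x. \<Sum>m\<in>Poly_Mapping.keys P. Poly_Mapping.lookup P m * mono_eval m x)"
    by (simp add: mpoly_eval_def mono_eval_def fun_eq_iff)
  then have "iter_diff n (mpoly_eval P) (\<lambda>_. 0) = (\<Sum>m\<in>Poly_Mapping.keys P. Poly_Mapping.lookup P m * iter_diff n (mono_eval m) (\<lambda>_. 0))"
    using iter_diff_sum[of n "Poly_Mapping.lookup P" mono_eval "Poly_Mapping.keys P"] by simp
  also have "\<dots> = (\<Sum>m\<in>Poly_Mapping.keys P. if m = (\<Sum>j<n. Poly_Mapping.single j 1) then Poly_Mapping.lookup P m else 0)"
    by (rule sum.cong) (use assms iter_diff_mono_eval in auto)
  also have "\<dots> = Poly_Mapping.lookup P (\<Sum>j<n. Poly_Mapping.single j 1)"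
    by (auto simp: in_keys_iff)
  finally show ?thesis ..
qed

text \<open>\<open>U k\<close> and \<open>W k\<close> stand for the \<open>k\<close>-th differences
  of \<open>U 0\<close> and \<open>W 0\<close>. A difference in any variable of the first block acts
  on \<open>U\<close>, one in the second block on \<open>W\<close>, because only the block sums
  enter.\<close>

lemma iter_diff_two_blocks:
  fixes U W :: "nat \<Rightarrow> rat \<Rightarrow> rat"
  assumes U: "\<And>k z. U k (z + 1) - U k z = U (Suc k) z" and W: "\<And>k z. W k (z + 1) - W k z = W (Suc k) z"
    and i: "i \<le> n"
  shows "k \<le> n \<Longrightarrow> iter_diff k (\<lambda>x. U 0 (\<Sum>j<i. x j) * W 0 (\<Sum>j=i..<n. x j)) x
     = U (min k i) (\<Sum>j<i. x j) * W (k - i) (\<Sum>j=i..<n. x j)"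
proof (induction k arbitrary: x)
  case (Suc k)
  have upd: "(\<Sum>j\<in>T. (x(k := x k + 1)) j) = (\<Sum>j\<in>T. x j) + (if k \<in> T then 1 else 0)" if "finite T" for T
  proof -
    have "(\<Sum>j\<in>T. (x(k := x k + 1)) j) = (\<Sum>j\<in>T. x j + (if j = k then 1 else 0))" by (rule sum.cong) auto
    also have "\<dots> = (\<Sum>j\<in>T. x j) + (\<Sum>j\<in>T. if j = k then 1 else 0)" by (rule sum.distrib)
    also have "(\<Sum>j\<in>T. if j = k then 1 else (0 :: rat)) = (if k \<in> T then 1 else 0)" using that by simp
    finally show ?thesis .
  qed
  have IH: "iter_diff k (\<lambda>x. U 0 (\<Sum>j<i. x j) * W 0 (\<Sum>j=i..<n. x j)) y
     = U (min k i) (\<Sum>j<i. y j) * W (k - i) (\<Sum>j=i..<n. y j)" for y using Suc by simp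
  show ?case
  proof (cases "k < i")
    case True
    then have m: "min k i = k" "min (Suc k) i = Suc k" "k - i = 0" "Suc k - i = 0" by auto
    have "(\<Sum>j<i. (x(k := x k + 1)) j) = (\<Sum>j<i. x j) + 1" "(\<Sum>j=i..<n. (x(k := x k + 1)) j) = (\<Sum>j=i..<n. x j)"
      using upd[of "{..<i}"] upd[of "{i..<n}"] True by auto
    then show ?thesis by (simp only: iter_diff.simps IH m left_diff_distrib[symmetric] U)
  next
    case False
    then have m: "min k i = i" "min (Suc k) i = i" "Suc k - i = Suc (k - i)" by auto
    have "(\<Sum>j<i. (x(k := x k + 1)) j) = (\<Sum>j<i. x j)" "(\<Sum>j=i..<n. (x(k := x k + 1)) j) = (\<Sum>j=i..<n. x j) + 1"
      using upd[of "{..<i}"] upd[of "{i..<n}"] False Suc.prems by auto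
    then show ?thesis by (simp only: iter_diff.simps IH m right_diff_distrib[symmetric] W)
  qed
qed simp

text \<open>The polynomial that agrees with \<open>piece\<close> at large arguments, where
  \<open>a + 1\<close> and \<open>b\<close> are the two block sums; the extra \<open>- 1\<close>
  undoes the shift of \<open>a\<close> in \<open>hilb\<close>. Pieces with \<open>p = 0\<close> or
  \<open>q = 0\<close> are eventually zero.\<close>

definition piece_poly :: "nat \<Rightarrow> nat \<Rightarrow> piece_index \<Rightarrow> (nat \<Rightarrow> rat) \<Rightarrow> rat" where
  "piece_poly n i = (\<lambda>(p, c, q, d) x. if 0 < p \<and> 0 < q
     then ((\<Sum>j<i. x j) + (of_nat (p - 1) - of_nat c - 1) gchoose (p - 1)) *
          ((\<Sum>j=i..<n. x j) + (of_nat (q - 1) - of_nat d) gchoose (q - 1)) else 0)"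

lemma polyfun_piece_poly:
  assumes "0 < p \<Longrightarrow> 0 < q \<Longrightarrow> (p - 1) + (q - 1) \<le> n" "i \<le> n"
  shows "polyfun n n (piece_poly n i (p, c, q, d))"
proof (cases "0 < p \<and> 0 < q")
  case True
  have "polyfun n (0 + (q - 1) + (p - 1)) (\<lambda>x. ((\<Sum>j\<in>{..<i}. x j) + (of_nat (p - 1) - of_nat c - 1) gchoose (p - 1)) *
          (((\<Sum>j\<in>{i..<n}. x j) + (of_nat (q - 1) - of_nat d) gchoose (q - 1)) * 1))"
    by (intro polyfun_mult_gbinomial polyfun_one) (use assms in auto)
  then have "polyfun n n (\<lambda>x. ((\<Sum>j\<in>{..<i}. x j) + (of_nat (p - 1) - of_nat c - 1) gchoose (p - 1)) *
          (((\<Sum>j\<in>{i..<n}. x j) + (of_nat (q - 1) - of_nat d) gchoose (q - 1)) * 1))"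
    by (rule polyfun_mono) (use assms True in auto)
  then show ?thesis using True by (simp add: piece_poly_def)
next
  case False
  then have "piece_poly n i (p, c, q, d) = (\<lambda>x. 0)" by (auto simp: piece_poly_def fun_eq_iff)
  then show ?thesis by (simp add: polyfun_zero)
qed

text \<open>Each difference lowers the lower index of a binomial coefficient by one. For a nonzero
  result the index \<open>p - 1\<close> must reach \<open>i\<close> and \<open>q - 1\<close> must
  reach \<open>n - i\<close>; the degree bound then forces equality, and both remaining binomials
  are 1.\<close>

lemma iter_diff_piece_poly:
  assumes "0 < p \<Longrightarrow> 0 < q \<Longrightarrow> (p - 1) + (q - 1) \<le> n" "i \<le> n"
  shows "iter_diff n (piece_poly n i (p, c, q, d)) (\<lambda>_. 0) = (if p = Suc i \<and> q = Suc (n - i) then 1 else 0)"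
proof (cases "0 < p \<and> 0 < q")
  case True
  define U :: "nat \<Rightarrow> rat \<Rightarrow> nat \<Rightarrow> rat \<Rightarrow> rat"
    where "U = (\<lambda>u e k z. if k \<le> u then (z + e gchoose (u - k)) else 0)"
  have step: "U u e k (z + 1) - U u e k z = U u e (Suc k) z" for u e k z
  proof (cases "k < u")
    case True
    then have m: "u - k = Suc (u - Suc k)" by simp
    have "z + 1 + e = (z + e) + 1" by simp
    then have "(z + 1 + e gchoose Suc (u - Suc k)) - (z + e gchoose Suc (u - Suc k)) = (z + e gchoose (u - Suc k))"
      by (simp only: gbinomial_Suc_Suc)
    then show ?thesis using True by (simp add: U_def m)
  qed (auto simp: U_def)
  let ?e = "of_nat (p - 1) - of_nat c - 1" and ?f = "of_nat (q - 1) - of_nat d"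
  have "piece_poly n i (p, c, q, d) = (\<lambda>x. U (p - 1) ?e 0 (\<Sum>j<i. x j) * U (q - 1) ?f 0 (\<Sum>j=i..<n. x j))"
    using True by (simp add: piece_poly_def U_def fun_eq_iff)
  then have "iter_diff n (piece_poly n i (p, c, q, d)) (\<lambda>_. 0) = U (p - 1) ?e (min n i) 0 * U (q - 1) ?f (n - i) 0"
    using iter_diff_two_blocks[of "U (p - 1) ?e" "U (q - 1) ?f" i n n "\<lambda>_. 0"] step assms(2) by simp
  also have "\<dots> = (if p = Suc i \<and> q = Suc (n - i) then 1 else 0)"
    using True assms by (auto simp: U_def min_def)
  finally show ?thesis .
next
  case False
  then have "piece_poly n i (p, c, q, d) = (\<lambda>x. \<Sum>a\<in>{}. 0 * mono_eval a x)" by (auto simp: piece_poly_def fun_eq_iff)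
  then have "iter_diff n (piece_poly n i (p, c, q, d)) (\<lambda>_. 0) = 0"
    using iter_diff_sum[of n "\<lambda>_. 0" mono_eval "{}"] by simp
  then show ?thesis using False by auto
qed

lemma bin_eq_gbinomial:
  assumes "c \<le> a"
  shows "of_nat (bin (Suc u) (a - c)) = ((of_nat a + (of_nat u - of_nat c)) gchoose u :: rat)"
proof -
  have "of_nat (bin (Suc u) (a - c)) = (of_nat (a - c + u) gchoose u :: rat)"
    by (simp add: bin_def binomial_gbinomial)
  also have "of_nat (a - c + u) = (of_nat a + (of_nat u - of_nat c) :: rat)" using assms by simp
  finally show ?thesis .
qed

text \<open>Differencing the sum of the polynomials of all pieces counts exactly the pieces of
  leading type. For \<open>i = n\<close> the second block is empty and \<open>b\<close> is always 0,
  so \<open>b\<close> cannot be made large; \<open>reg\<close> asks that the pieces agree with their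
  polynomials already there.\<close>

lemma mixed_mult_eq_lead:
  assumes len: "length Is = n" and i: "1 \<le> i" "i \<le> n"
    and bound: "\<And>a b. real (piece_sum ts a b) \<le> K * real (a + b + 1) ^ n"
    and col: "\<And>r. (\<And>j. j < n \<Longrightarrow> 1 \<le> r j) \<Longrightarrow> colength R (ideal_power_prod R Is r)
        = enat (piece_sum ts ((\<Sum>j<i. r j) - 1) (\<Sum>j=i..<n. r j))"
    and reg: "i < n \<or> (\<forall>(p, c, q, d)\<in>set ts. 0 < q \<and> d = 0)"
  shows "mixed_mult R Is = of_nat (lead ts n i)"
proof -
  have deg: "(p - 1) + (q - 1) \<le> n" if "(p, c, q, d) \<in> set ts" "0 < p" "0 < q" for p c q d
    using piece_degree_le[OF bound, of "p - 1" c "q - 1" d] that by simp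
  have pf: "polyfun n n (piece_poly n i t)" if "t \<in> set ts" for t
  proof -
    obtain p c q d where t: "t = (p, c, q, d)" by (cases t) auto
    show ?thesis unfolding t by (rule polyfun_piece_poly[OF deg i(2)]) (use that t in auto)
  qed
  obtain P where P: "Poly_Mapping.keys P \<subseteq> monomials_le n n" "\<And>x. mpoly_eval P x = (\<Sum>t\<leftarrow>ts. piece_poly n i t x)"
    using polyfun_imp_mpoly[OF polyfun_sum_list[of ts n n "piece_poly n i"]] pf by blast
  \<comment> \<open>Larger than every shift, so that no piece is cut off and those with
    \<open>p = 0\<close> or \<open>q = 0\<close> have become zero; the margin of 2 allows for
    \<open>A - 1\<close> in place of \<open>A\<close>.\<close>
  define N where "N = Suc (Suc (\<Sum>(p, c, q, d)\<leftarrow>ts. c + d))"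
  have cd: "c + d + 2 \<le> N" if "(p, c, q, d) \<in> set ts" for p c q d
  proof -
    have "c + d \<in> set (map (\<lambda>(p, c, q, d). c + d) ts)" using that by force
    then show ?thesis using member_le_sum_list[of "c + d" "map (\<lambda>(p, c, q, d). c + d) ts"] by (simp add: N_def)
  qed
  have "is_length_poly R Is P"
    unfolding is_length_poly_def
  proof (intro conjI exI[of _ N] allI impI)
    show "\<forall>m\<in>Poly_Mapping.keys P. Poly_Mapping.keys m \<subseteq> {..<length Is} \<and> sum (Poly_Mapping.lookup m) (Poly_Mapping.keys m) \<le> length Is"
      using P(1) by (auto simp: monomials_le_def mono_deg_def len)
    fix r :: "nat \<Rightarrow> nat" assume r: "\<forall>j<length Is. N \<le> r j"
    define A where "A = (\<Sum>j<i. r j)"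
    define B where "B = (\<Sum>j=i..<n. r j)"
    have "r 0 \<le> A" unfolding A_def by (rule member_le_sum) (use i in auto)
    moreover have "N \<le> r 0" using r i len by auto
    ultimately have A: "N \<le> A" by linarith
    have B: "N \<le> B" if "i < n"
    proof -
      have "r i \<le> B" unfolding B_def by (rule member_le_sum) (use that in auto)
      moreover have "N \<le> r i" using r that len by auto
      ultimately show ?thesis by linarith
    qed
    have "of_nat (piece t (A - 1) B) = piece_poly n i t (\<lambda>j. of_nat (r j))" if t: "t \<in> set ts" for t
    proof -
      obtain p c q d where pcqd: "t = (p, c, q, d)" by (cases t) auto
      have c: "c + d + 2 \<le> N" using cd t pcqd by blast
      have "d < B \<or> (0 < q \<and> d = 0)"
      proof (cases "i < n")
        case True
        then show ?thesis using B c by linarith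
      next
        case False
        then show ?thesis using reg t pcqd by auto
      qed
      then have d: "d \<le> B" "q = 0 \<Longrightarrow> d < B" by auto
      show ?thesis
      proof (cases "0 < p \<and> 0 < q")
        case True
        then obtain u w where uw: "p = Suc u" "q = Suc w" by (auto simp: gr0_conv_Suc)
        obtain a where a: "A = Suc a" using A c by (cases A) auto
        have "of_nat (bin (Suc u) (a - c)) = ((\<Sum>j<i. of_nat (r j)) + (of_nat u - of_nat c - 1) gchoose u :: rat)"
        proof -
          have e: "of_nat a + (of_nat u - of_nat c) = (\<Sum>j<i. of_nat (r j)) + (of_nat u - of_nat c - 1 :: rat)"
            using arg_cong[OF a, of "of_nat :: nat \<Rightarrow> rat"] by (simp add: A_def)
          have "c \<le> a" using c A a by simp
          then show ?thesis unfolding e[symmetric] by (rule bin_eq_gbinomial)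
        qed
        moreover have "of_nat (bin (Suc w) (B - d)) = ((\<Sum>j=i..<n. of_nat (r j)) + (of_nat w - of_nat d) gchoose w :: rat)"
          using bin_eq_gbinomial[OF d(1), of w] by (simp add: B_def)
        moreover have "c \<le> a" using c A a by simp
        ultimately show ?thesis using d(1) by (simp add: pcqd uw piece_def piece_poly_def a)
      next
        case False
        then show ?thesis using c A d by (auto simp: pcqd piece_def piece_poly_def bin_def)
      qed
    qed
    then have "of_nat (piece_sum us (A - 1) B) = (\<Sum>t\<leftarrow>us. piece_poly n i t (\<lambda>j. of_nat (r j)))" if "set us \<subseteq> set ts" for us
      using that by (induction us) auto
    then have "of_nat (piece_sum ts (A - 1) B) = mpoly_eval P (\<lambda>j. of_nat (r j))" by (simp add: P(2))
    moreover have "colength R (ideal_power_prod R Is r) = enat (piece_sum ts (A - 1) B)"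
      unfolding A_def B_def
    proof (rule col)
      fix j assume "j < n"
      then have "N \<le> r j" using r len by simp
      then show "1 \<le> r j" by (simp add: N_def)
    qed
    ultimately show "mpoly_eval P (\<lambda>j. of_nat (r j)) = of_nat (the_enat (colength R (ideal_power_prod R Is r)))" by simp
  qed
  then have the: "(THE P. is_length_poly R Is P) = P" using length_poly_unique by blast
  have "mpoly_eval P = (\<lambda>x. \<Sum>t\<leftarrow>ts. piece_poly n i t x)" using P(2) by (simp add: fun_eq_iff)
  then have "Poly_Mapping.lookup P (\<Sum>j<n. Poly_Mapping.single j 1) = (\<Sum>t\<leftarrow>ts. iter_diff n (piece_poly n i t) (\<lambda>_. 0))"
    using iter_diff_eq_coeff[OF P(1)] by (simp add: iter_diff_sum_list)
  also have "\<dots> = of_nat (lead ts n i)"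
  proof -
    have "(\<Sum>t\<leftarrow>us. iter_diff n (piece_poly n i t) (\<lambda>_. 0)) = of_nat (lead us n i)" if "set us \<subseteq> set ts" for us
      using that
    proof (induction us)
      case (Cons t us)
      obtain p c q d where t: "t = (p, c, q, d)" by (cases t) auto
      show ?case using Cons deg[of p c q d] i(2) by (simp add: t iter_diff_piece_poly lead_def)
    qed (simp add: lead_def)
    then show ?thesis by simp
  qed
  finally show ?thesis by (simp add: mixed_mult_def the len)
qed

text \<open>For fixed \<open>b\<close>, a piece with \<open>q > 0\<close> grows like the power
  \<open>p - 1\<close> of \<open>a\<close>. If this is \<open>n\<close>, the degree bound forces
  \<open>q = 1\<close>, whose factor is constantly 1. One row therefore reveals the coefficient at
  \<open>i = n\<close>.\<close>

lemma piece_sum_column_limit: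
  assumes bound: "\<And>a b. real (piece_sum ts a b) \<le> K * real (a + b + 1) ^ n"
    and b: "\<And>p c q d. (p, c, q, d) \<in> set ts \<Longrightarrow> d \<le> b \<and> (q = 0 \<longrightarrow> d < b)"
  shows "(\<lambda>x. real (piece_sum ts x b) / real x ^ n) \<longlonglongrightarrow> real (lead ts n n) / fact n"
proof -
  have deg: "(p - 1) + (q - 1) \<le> n" if "(p, c, q, d) \<in> set ts" "0 < p" "0 < q" for p c q d
    using piece_degree_le[OF bound, of "p - 1" c "q - 1" d] that by simp
  have "(\<lambda>x. real (piece_sum us x b) / real x ^ n) \<longlonglongrightarrow> real (lead us n n) / fact n" if "set us \<subseteq> set ts" for us
    using that
  proof (induction us)
    case Nil
    then show ?case by (simp add: lead_def)
  next
    case (Cons t us)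
    obtain p c q d where t: "t = (p, c, q, d)" by (cases t) auto
    have tin: "(p, c, q, d) \<in> set ts" using Cons.prems t by auto
    define w where "w = (if p = Suc n \<and> q = Suc 0 then 1 / fact n else (0 :: real))"
    have "(\<lambda>x. real (piece t x b) / real x ^ n) \<longlonglongrightarrow> w"
    proof (cases "0 < p \<and> 0 < q")
      case True
      then obtain u v where uv: "p = Suc u" "q = Suc v" by (auto simp: gr0_conv_Suc)
      have le: "u + v \<le> n" using deg[OF tin] True by (simp add: uv)
      have lim: "(\<lambda>x. real (bin (Suc u) (1 * x - c)) / real x ^ u * (1 / real x) ^ (n - u) * real (bin q (b - d)))
          \<longlonglongrightarrow> real 1 ^ u / fact u * 0 ^ (n - u) * real (bin q (b - d))"
        by (intro tendsto_intros bin_asymp lim_const_over_n) simp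
      have pw: "real x ^ n = real x ^ u * real x ^ (n - u)" for x
        using le by (simp flip: power_add)
      have ev: "\<forall>\<^sub>F x in sequentially. real (bin (Suc u) (1 * x - c)) / real x ^ u * (1 / real x) ^ (n - u) * real (bin q (b - d))
         = real (piece t x b) / real x ^ n"
        using eventually_ge_at_top[of c]
        by eventually_elim (subst pw, use b[OF tin] in \<open>simp add: t uv piece_def power_divide\<close>)
      have "real 1 ^ u / fact u * 0 ^ (n - u) * real (bin q (b - d)) = w"
        using le by (cases "u = n") (auto simp: w_def uv bin_def)
      then show ?thesis using Lim_transform_eventually[OF lim ev] by simp
    next
      case False
      then have w0: "w = 0" by (auto simp: w_def)
      have "\<forall>\<^sub>F x in sequentially. 0 = real (piece t x b) / real x ^ n"
        using eventually_gt_at_top[of c]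
        by eventually_elim (use False b[OF tin] in \<open>auto simp: t piece_def bin_def\<close>)
      then show ?thesis unfolding w0 by (rule Lim_transform_eventually[OF tendsto_const])
    qed
    moreover have "(\<lambda>x. real (piece_sum us x b) / real x ^ n) \<longlonglongrightarrow> real (lead us n n) / fact n"
      using Cons by simp
    ultimately have "(\<lambda>x. real (piece t x b) / real x ^ n + real (piece_sum us x b) / real x ^ n) \<longlonglongrightarrow> w + real (lead us n n) / fact n"
      by (rule tendsto_add)
    moreover have "w + real (lead us n n) / fact n = real (lead (t # us) n n) / fact n"
      by (simp add: w_def lead_def t add_divide_distrib)
    ultimately show ?case by (simp add: add_divide_distrib)
  qed
  then show ?thesis by blast
qed

text \<open>Only the row \<open>b = 0\<close> is visible for \<open>i = n\<close>, but the pieces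
  found there need not be those counted by \<open>hlead\<close>. A comparison with a row
  \<open>b\<close> beyond all shifts shows that the leading counts agree.\<close>

lemma hlead_column:
  fixes J :: "(nat ^ 'n) set"
  assumes up: "upset J" and fin: "finite (- J)" and J: "t = 0 \<or> J \<subseteq> mm 1"
  obtains ts K where "\<And>a b. piece_sum ts a b = hilb J t a 0" "\<And>a b. real (piece_sum ts a b) \<le> real K * real (a + b + 1) ^ CARD('n)"
    "\<forall>(p, c, q, d)\<in>set ts. 0 < q \<and> d = 0" "lead ts CARD('n) CARD('n) = hlead J t CARD('n)"
proof -
  let ?n = "CARD('n)"
  define ts where "ts = (SOME ts. hilb J t = piece_sum ts)"
  have ts: "hilb J t = piece_sum ts" unfolding ts_def by (rule hilb_eq_piece_sum[OF up fin])
  obtain K where K: "\<And>a b. real (hilb J t a b) \<le> real K * real (a + b + 1) ^ ?n" using hilb_bound[OF up fin] by blast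
  \<comment> \<open>On the row \<open>b = 0\<close> only pieces with \<open>d = 0\<close> survive,
    with second factor \<open>bin q 0 = 1\<close>. Setting \<open>q = 1\<close> represents the same
    row by a function that is constant in \<open>b\<close>.\<close>
  define us where "us = map (\<lambda>(p, c, q, d). (p, c, 1 :: nat, 0 :: nat)) (filter (\<lambda>(p, c, q, d). d = 0) ts)"
  have us: "piece_sum us a b = hilb J t a 0" for a b
  proof -
    have "piece_sum (map (\<lambda>(p, c, q, d). (p, c, 1 :: nat, 0 :: nat)) (filter (\<lambda>(p, c, q, d). d = 0) vs)) a b = piece_sum vs a 0" for vs
      by (induction vs) (auto simp: piece_def bin_def split: nat.splits)
    then show ?thesis by (simp add: us_def ts)
  qed
  have bus: "real (piece_sum us a b) \<le> real K * real (a + b + 1) ^ ?n" for a b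
  proof -
    have "real (hilb J t a 0) \<le> real K * real (a + 0 + 1) ^ ?n" by (rule K)
    also have "\<dots> \<le> real K * real (a + b + 1) ^ ?n" by (intro mult_left_mono power_mono) auto
    finally show ?thesis by (simp add: us)
  qed
  have reg: "\<forall>(p, c, q, d)\<in>set us. 0 < q \<and> d = 0" by (auto simp: us_def)
  have l0: "(\<lambda>x. real (hilb J t x 0) / real x ^ ?n) \<longlonglongrightarrow> real (lead us ?n ?n) / fact ?n"
    using piece_sum_column_limit[OF bus, of 0] reg by (fastforce simp: us)
  define b where "b = Suc (\<Sum>(p, c, q, d)\<leftarrow>ts. d)"
  have bd: "d < b" if "(p, c, q, d) \<in> set ts" for p c q d
  proof -
    have "d \<in> set (map (\<lambda>(p, c, q, d). d) ts)" using that by force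
    then show ?thesis using member_le_sum_list[of d "map (\<lambda>(p, c, q, d). d) ts"] by (simp add: b_def)
  qed
  have lb: "(\<lambda>x. real (hilb J t x b) / real x ^ ?n) \<longlonglongrightarrow> real (lead ts ?n ?n) / fact ?n"
    unfolding ts by (rule piece_sum_column_limit[OF K[unfolded ts]]) (use bd in \<open>fastforce intro: less_imp_le\<close>)
  \<comment> \<open>\<open>npow J k\<close> lies in \<open>mm (t * b)\<close>, so the row
    \<open>b\<close> is squeezed between the row 0 and its translate by \<open>k\<close>; such a
    translation does not affect the leading growth.\<close>
  define k where "k = t * b"
  have le1: "hilb J t x 0 \<le> hilb J t x b" for x
  proof -
    have "- msum (npow J (Suc x)) (mm (t * 0)) \<subseteq> - msum (npow J (Suc x)) (mm (t * b))"
      using msum_mono[of "npow J (Suc x)" "npow J (Suc x)" "mm (t * b)" "mm (t * 0)"] by auto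
    then show ?thesis unfolding hilb_def by (intro card_mono finite_Compl_msum_npow up fin)
  qed
  have le2: "hilb J t x b \<le> hilb J t (x + k) 0" for x
  proof -
    have "npow J k \<subseteq> mm (t * b)"
    proof (cases "t = 0")
      case False
      then have "npow J k \<subseteq> npow (mm 1) k" using J by (intro npow_mono) auto
      then show ?thesis by (simp add: npow_mm k_def)
    qed simp
    then have "msum (npow J (Suc x)) (npow J k) \<subseteq> msum (npow J (Suc x)) (mm (t * b))" by (intro msum_mono) auto
    then have "npow J (Suc (x + k)) \<subseteq> msum (npow J (Suc x)) (mm (t * b))" using npow_add[OF up, of "Suc x" k] by simp
    then have "- msum (npow J (Suc x)) (mm (t * b)) \<subseteq> - msum (npow J (Suc (x + k))) (mm (t * 0))"
      using upset_npow[OF up, of "Suc (x + k)"] by (auto simp del: npow.simps)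
    then show ?thesis unfolding hilb_def by (intro card_mono finite_Compl_msum_npow up fin)
  qed
  have l1: "(\<lambda>x. real (hilb J t (x + k) 0) / real x ^ ?n) \<longlonglongrightarrow> real (lead us ?n ?n) / fact ?n"
  proof -
    have a: "(\<lambda>x. real (hilb J t (x + k) 0) / real (x + k) ^ ?n) \<longlonglongrightarrow> real (lead us ?n ?n) / fact ?n"
      by (rule LIMSEQ_ignore_initial_segment[OF l0])
    have bb: "(\<lambda>x. ((real (1 * x - 0) + real k) / real x) ^ ?n) \<longlonglongrightarrow> real 1 ^ ?n"
      by (intro tendsto_power affine_over_n) simp
    have "(\<lambda>x. real (hilb J t (x + k) 0) / real (x + k) ^ ?n * ((real (1 * x - 0) + real k) / real x) ^ ?n)
        \<longlonglongrightarrow> real (lead us ?n ?n) / fact ?n * real 1 ^ ?n" by (rule tendsto_mult[OF a bb])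
    moreover have "\<forall>\<^sub>F x in sequentially. real (hilb J t (x + k) 0) / real (x + k) ^ ?n * ((real (1 * x - 0) + real k) / real x) ^ ?n
       = real (hilb J t (x + k) 0) / real x ^ ?n"
      using eventually_gt_at_top[of 0] by eventually_elim (simp add: power_divide)
    ultimately have "(\<lambda>x. real (hilb J t (x + k) 0) / real x ^ ?n) \<longlonglongrightarrow> real (lead us ?n ?n) / fact ?n * real 1 ^ ?n"
      by (rule Lim_transform_eventually)
    then show ?thesis by simp
  qed
  have "(\<lambda>x. real (hilb J t x b) / real x ^ ?n) \<longlonglongrightarrow> real (lead us ?n ?n) / fact ?n"
    by (rule tendsto_sandwich[OF _ _ l0 l1]) (auto intro!: always_eventually divide_right_mono simp: le1 le2)
  then have "real (lead us ?n ?n) / fact ?n = real (lead ts ?n ?n) / fact ?n" using LIMSEQ_unique lb by blast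
  then have "lead us ?n ?n = lead ts ?n ?n" by simp
  then show ?thesis by (intro that[of us K] us bus reg) (simp add: hlead_def ts_def)
qed

lemma mixed_mult_eq_hlead:
  fixes J :: "(nat ^ 'n) set"
  assumes up: "upset J" and fin: "finite (- J)" and J: "t = 0 \<or> J \<subseteq> mm 1"
    and len: "length Is = CARD('n)" and i: "1 \<le> i" "i \<le> CARD('n)"
    and col: "\<And>r. colength R (ideal_power_prod R Is r)
        = enat (card (- msum (npow J (\<Sum>j<i. r j)) (mm (t * (\<Sum>j=i..<CARD('n). r j)))))"
  shows "mixed_mult R Is = of_nat (hlead J t i)"
proof -
  have col': "colength R (ideal_power_prod R Is r) = enat (hilb J t ((\<Sum>j<i. r j) - 1) (\<Sum>j=i..<CARD('n). r j))"
    if "\<And>j. j < CARD('n) \<Longrightarrow> 1 \<le> r j" for r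
  proof -
    have "r 0 \<le> (\<Sum>j<i. r j)" by (rule member_le_sum) (use i in auto)
    then have "1 \<le> (\<Sum>j<i. r j)" using that[of 0] i by simp
    then have "Suc ((\<Sum>j<i. r j) - 1) = (\<Sum>j<i. r j)" by simp
    then show ?thesis unfolding col hilb_def by (simp only:)
  qed
  show ?thesis
  proof (cases "i < CARD('n)")
    case True
    define ts where "ts = (SOME ts. hilb J t = piece_sum ts)"
    have ts: "hilb J t = piece_sum ts" unfolding ts_def by (rule hilb_eq_piece_sum[OF up fin])
    obtain K where K: "\<And>a b. real (hilb J t a b) \<le> real K * real (a + b + 1) ^ CARD('n)" using hilb_bound[OF up fin] by blast
    have "mixed_mult R Is = of_nat (lead ts CARD('n) i)"
      by (rule mixed_mult_eq_lead[OF len i K[unfolded ts] col'[unfolded ts]]) (use True in auto)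
    then show ?thesis by (simp add: hlead_def ts_def)
  next
    case False
    then have eq: "i = CARD('n)" using i by simp
    obtain ts K where ts: "\<And>a b. piece_sum ts a b = hilb J t a 0"
      "\<And>a b. real (piece_sum ts a b) \<le> real K * real (a + b + 1) ^ CARD('n)"
      "\<forall>(p, c, q, d)\<in>set ts. 0 < q \<and> d = 0" "lead ts CARD('n) CARD('n) = hlead J t CARD('n)"
      using hlead_column[OF up fin J] by blast
    have "mixed_mult R Is = of_nat (lead ts CARD('n) i)"
    proof (rule mixed_mult_eq_lead[OF len i ts(2)])
      fix r :: "nat \<Rightarrow> nat" assume "\<And>j. j < CARD('n) \<Longrightarrow> 1 \<le> r j"
      from col'[OF this] show "colength R (ideal_power_prod R Is r) = enat (piece_sum ts ((\<Sum>j<i. r j) - 1) (\<Sum>j=i..<CARD('n). r j))"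
        by (simp add: ts(1) eq)
    qed (use ts(3) in auto)
    then show ?thesis using ts(4) eq by simp
  qed
qed

section \<open>Convergent power series\<close>

lemma monomial_fun_add: "monomial_fun (k + l) x = monomial_fun k x * monomial_fun l x"
  by (simp add: monomial_fun_def power_add prod.distrib)

lemma monomial_fun_zero [simp]: "monomial_fun 0 x = 1"
  by (simp add: monomial_fun_def)

lemma norm_monomial_fun_le:
  assumes "\<And>j. norm (x $ j) \<le> \<rho>"
  shows "norm (monomial_fun k x) \<le> \<rho> ^ deg k"
proof -
  have "norm (monomial_fun k x) = (\<Prod>j\<in>UNIV. norm (x $ j) ^ (k $ j))"
    by (simp add: monomial_fun_def prod_norm[symmetric] norm_power)
  also have "\<dots> \<le> (\<Prod>j\<in>UNIV. \<rho> ^ (k $ j))"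
    using assms by (intro prod_mono conjI power_mono zero_le_power) auto
  also have "\<dots> = \<rho> ^ deg k" by (simp add: deg_def power_sum)
  finally show ?thesis .
qed

lemma geometric_summable_on:
  assumes q: "0 \<le> q" "q < (1 :: real)"
  shows "(\<lambda>k :: nat ^ 'n. q ^ deg k) summable_on UNIV"
proof (rule nonneg_bdd_above_summable_on)
  show "bdd_above (sum (\<lambda>k :: nat ^ 'n. q ^ deg k) ` {F. F \<subseteq> UNIV \<and> finite F})"
  proof (rule bdd_aboveI2)
    fix F :: "(nat ^ 'n) set" assume "F \<in> {F. F \<subseteq> UNIV \<and> finite F}"
    then have F: "finite F" by simp
    define N where "N = Suc (\<Sum>k\<in>F. deg k)"
    have sub: "F \<subseteq> {k. \<forall>j. k $ j < N}"
    proof (intro subsetI CollectI allI)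
      fix k j assume "k \<in> F"
      then have "deg k \<le> (\<Sum>k\<in>F. deg k)" using F by (intro member_le_sum) auto
      then show "k $ j < N" using component_le_deg[of k j] by (simp add: N_def)
    qed
    have "(\<Sum>k\<in>F. q ^ deg k) \<le> (\<Sum>k\<in>{k :: nat ^ 'n. \<forall>j. k $ j < N}. q ^ deg k)"
      by (rule sum_mono2[OF finite_vec_box(1) sub]) (use q in auto)
    also have "\<dots> = (\<Sum>g\<in>PiE UNIV (\<lambda>_ :: 'n. {..<N}). \<Prod>j\<in>UNIV. q ^ g j)"
      by (rule sum.reindex_bij_witness[of _ vec_lambda vec_nth]) (auto simp: PiE_def deg_def power_sum)
    also have "\<dots> = (\<Prod>j\<in>(UNIV :: 'n set). \<Sum>l<N. q ^ l)"
      by (rule prod_sum_PiE[symmetric]) auto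
    also have "\<dots> \<le> (\<Prod>j\<in>(UNIV :: 'n set). 1 / (1 - q))"
    proof (rule prod_mono)
      have "(\<Sum>l<N. q ^ l) = (1 - q ^ N) / (1 - q)" using q by (intro sum_gp_strict[THEN trans]) auto
      also have "\<dots> \<le> 1 / (1 - q)" using q by (intro divide_right_mono) auto
      finally show "0 \<le> (\<Sum>l<N. q ^ l) \<and> (\<Sum>l<N. q ^ l) \<le> 1 / (1 - q)" using q by (auto intro: sum_nonneg)
    qed
    finally show "(\<Sum>k\<in>F. q ^ deg k) \<le> (\<Prod>j\<in>(UNIV :: 'n set). 1 / (1 - q))" .
  qed
qed (use q in auto)

text \<open>The growth condition equivalent to convergence near the origin. It reduces the
  construction of germs to estimates for coefficients.\<close>

definition convergent_coeffs :: "(nat ^ 'n \<Rightarrow> complex) \<Rightarrow> bool" where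
  "convergent_coeffs a \<longleftrightarrow> (\<exists>C B. 0 < C \<and> 1 \<le> B \<and> (\<forall>k. norm (a k) \<le> C * B ^ deg k))"

lemma convergent_coeffsI:
  assumes "\<And>k. norm (a k) \<le> C * B ^ deg k" "0 \<le> B"
  shows "convergent_coeffs a"
  unfolding convergent_coeffs_def
proof (intro exI conjI allI)
  fix k
  have "norm (a k) \<le> C * B ^ deg k" by (rule assms(1))
  also have "\<dots> \<le> (\<bar>C\<bar> + 1) * (B + 1) ^ deg k"
    using assms(2) by (intro mult_mono power_mono) auto
  finally show "norm (a k) \<le> (\<bar>C\<bar> + 1) * (B + 1) ^ deg k" .
qed (use assms(2) in auto)

lemma has_sum_norm_summable:
  fixes f :: "'a \<Rightarrow> complex"
  assumes "(f has_sum s) A"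
  shows "(\<lambda>x. norm (f x)) summable_on A"
  using has_sum_imp_summable[OF assms] summable_on_iff_abs_summable_on_complex[of f A] by simp

lemma convergent_coeffs_abs_summable:
  fixes a :: "nat ^ 'n \<Rightarrow> complex"
  assumes "convergent_coeffs a"
  obtains \<rho> where "\<rho> > 0" "\<And>x. (\<And>j. norm (x $ j) \<le> \<rho>) \<Longrightarrow> (\<lambda>k. norm (a k * monomial_fun k x)) summable_on UNIV"
proof -
  obtain C B where CB: "0 < C" "1 \<le> B" "\<And>k. norm (a k) \<le> C * B ^ deg k"
    using assms unfolding convergent_coeffs_def by blast
  define \<rho> where "\<rho> = 1 / (2 * B)"
  show ?thesis
  proof (rule that[of \<rho>])
    show "\<rho> > 0" using CB by (simp add: \<rho>_def)
    fix x :: "complex ^ 'n" assume x: "\<And>j. norm (x $ j) \<le> \<rho>"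
    show "(\<lambda>k. norm (a k * monomial_fun k x)) summable_on UNIV"
    proof (rule Infinite_Sum.abs_summable_on_comparison_test')
      show "(\<lambda>k :: nat ^ 'n. C * (1 / 2) ^ deg k) summable_on UNIV"
        by (intro summable_on_cmult_right geometric_summable_on) auto
      fix k :: "nat ^ 'n"
      have "norm (a k * monomial_fun k x) \<le> (C * B ^ deg k) * \<rho> ^ deg k"
        unfolding norm_mult using CB norm_monomial_fun_le[OF x] by (intro mult_mono) auto
      also have "\<dots> = C * (1 / 2) ^ deg k" using CB(2)
        by (simp add: \<rho>_def mult.assoc flip: power_mult_distrib)
      finally show "norm (a k * monomial_fun k x) \<le> C * (1 / 2) ^ deg k" .
    qed
  qed
qed

lemma eventually_nhds_0_coordinates:
  assumes "\<rho> > 0"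
  shows "\<forall>\<^sub>F x :: complex ^ 'n in nhds 0. \<forall>j. norm (x $ j) \<le> \<rho>"
  unfolding eventually_nhds_metric
proof (intro exI conjI allI impI)
  show "\<rho> > 0" by fact
  fix x :: "complex ^ 'n" and j assume "dist x 0 < \<rho>"
  then have "norm x < \<rho>" by (simp add: dist_norm)
  moreover have "norm (x $ j) \<le> norm x" by (rule Finite_Cartesian_Product.norm_nth_le)
  ultimately show "norm (x $ j) \<le> \<rho>" by linarith
qed

lemma norm_vec_le_sum: "norm (x :: complex ^ 'n) \<le> (\<Sum>j\<in>UNIV. norm (x $ j))"
  unfolding norm_vec_def by (rule L2_set_le_sum) auto

lemma convergent_coeffs_has_taylor:
  assumes "convergent_coeffs a"
  shows "has_taylor (\<lambda>x. infsum (\<lambda>k. a k * monomial_fun k x) UNIV) a"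
proof -
  obtain \<rho> where \<rho>: "\<rho> > 0" "\<And>x. (\<And>j. norm (x $ j) \<le> \<rho>) \<Longrightarrow> (\<lambda>k. norm (a k * monomial_fun k x)) summable_on UNIV"
    using convergent_coeffs_abs_summable[OF assms] by blast
  show ?thesis unfolding has_taylor_def
    using eventually_nhds_0_coordinates[OF \<rho>(1)]
  proof eventually_elim
    case (elim x)
    have "(\<lambda>k. a k * monomial_fun k x) summable_on UNIV"
      by (rule abs_summable_summable, rule \<rho>(2)) (use elim in simp)
    then show ?case by simp
  qed
qed

text \<open>At the point with all coordinates \<open>\<delta>\<close> the terms have norm
  \<open>norm (a k) * \<delta> ^ deg k\<close>; absolute convergence bounds each of them by the
  total.\<close>

lemma has_taylor_convergent_coeffs:
  fixes f :: "complex ^ 'n \<Rightarrow> complex"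
  assumes "has_taylor f a"
  shows "convergent_coeffs a"
proof -
  obtain e where e: "e > 0" "\<And>x. dist x 0 < e \<Longrightarrow> ((\<lambda>k. a k * monomial_fun k x) has_sum f x) UNIV"
    using assms unfolding has_taylor_def eventually_nhds_metric by blast
  define \<delta> where "\<delta> = e / (2 * real CARD('n))"
  have \<delta>: "\<delta> > 0" using e by (simp add: \<delta>_def)
  define x :: "complex ^ 'n" where "x = (\<chi> j. of_real \<delta>)"
  have "norm x \<le> (\<Sum>j\<in>(UNIV :: 'n set). \<delta>)" using norm_vec_le_sum[of x] \<delta> by (simp add: x_def)
  also have "\<dots> < e" using e by (simp add: \<delta>_def)
  finally have "((\<lambda>k. a k * monomial_fun k x) has_sum f x) UNIV" using e(2) by (simp add: dist_norm)
  then have "(\<lambda>k. norm (a k * monomial_fun k x)) summable_on UNIV"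
    by (rule has_sum_norm_summable)
  moreover have "norm (a k * monomial_fun k x) = norm (a k) * \<delta> ^ deg k" for k
    using \<delta> by (simp add: norm_mult monomial_fun_def x_def norm_power prod_norm[symmetric] deg_def power_sum)
  ultimately have s: "(\<lambda>k. norm (a k) * \<delta> ^ deg k) summable_on UNIV" by simp
  define C where "C = infsum (\<lambda>k. norm (a k) * \<delta> ^ deg k) UNIV"
  have "norm (a k) \<le> C * (1 / \<delta>) ^ deg k" for k
  proof -
    have "sum (\<lambda>k. norm (a k) * \<delta> ^ deg k) {k} \<le> C"
      unfolding C_def by (rule finite_sum_le_infsum[OF s]) (use \<delta> in auto)
    then show ?thesis using \<delta> by (simp add: field_simps)
  qed
  then show ?thesis by (rule convergent_coeffsI) (use \<delta> in simp)
qed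

lemma convergent_coeffs_restrict:
  assumes "convergent_coeffs a" "\<And>k. b k = a k \<or> b k = 0"
  shows "convergent_coeffs b"
proof -
  obtain C B where CB: "0 < C" "1 \<le> B" "\<And>k. norm (a k) \<le> C * B ^ deg k"
    using assms unfolding convergent_coeffs_def by blast
  have "norm (b k) \<le> C * B ^ deg k" for k using assms(2)[of k] CB(3)[of k] CB(1,2) by auto
  then show ?thesis by (rule convergent_coeffsI) (use CB in simp)
qed

lemma convergent_coeffs_shift:
  assumes "convergent_coeffs a"
  shows "convergent_coeffs (\<lambda>l. a (k + l))"
proof -
  obtain C B where CB: "0 < C" "1 \<le> B" "\<And>k. norm (a k) \<le> C * B ^ deg k"
    using assms unfolding convergent_coeffs_def by blast
  have "norm (a (k + l)) \<le> (C * B ^ deg k) * B ^ deg l" for l using CB(3)[of "k + l"] by (simp add: power_add mult.assoc)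
  then show ?thesis by (rule convergent_coeffsI) (use CB in simp)
qed

definition unit_coeffs :: "nat ^ 'n \<Rightarrow> nat ^ 'n \<Rightarrow> complex" where
  "unit_coeffs k l = (if l = k then 1 else 0)"

lemma has_taylor_monomial_fun: "has_taylor (monomial_fun k) (unit_coeffs k)"
  unfolding has_taylor_def
proof (rule always_eventually, rule allI)
  fix x
  show "((\<lambda>l. unit_coeffs k l * monomial_fun l x) has_sum monomial_fun k x) UNIV"
    by (rule has_sum_finite_neutralI[of "{k}"]) (auto simp: unit_coeffs_def)
qed

section \<open>Products of power series\<close>

definition cauchy_prod :: "(nat ^ 'n \<Rightarrow> complex) \<Rightarrow> (nat ^ 'n \<Rightarrow> complex) \<Rightarrow> nat ^ 'n \<Rightarrow> complex" where
  "cauchy_prod a b s = (\<Sum>k\<in>{k. k \<le> s}. a k * b (s - k))"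

lemma finite_vec_le: "finite {k :: nat ^ 'n. k \<le> s}"
  by (rule finite_subset[OF _ finite_vec_box(1)[of "\<lambda>j. Suc (s $ j)"]]) (auto simp: less_eq_vec_def less_Suc_eq_le)

text \<open>Absolute summability of both series makes the double family summable, so it may be
  regrouped by \<open>s = k + l\<close>.\<close>

lemma has_sum_cauchy_prod:
  fixes F G :: "nat ^ 'n \<Rightarrow> complex"
  assumes F: "(F has_sum f) UNIV" and G: "(G has_sum g) UNIV"
  shows "((\<lambda>s. \<Sum>k\<in>{k. k \<le> s}. F k * G (s - k)) has_sum f * g) UNIV"
proof -
  have aF: "(\<lambda>k. norm (F k)) summable_on UNIV" and aG: "(\<lambda>k. norm (G k)) summable_on UNIV"
    using F G by (auto intro: has_sum_norm_summable)
  have "(\<lambda>p. norm (case p of (k, l) \<Rightarrow> F k * G l)) summable_on UNIV \<times> UNIV"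
  proof (rule nonneg_bdd_above_summable_on)
    show "bdd_above (sum (\<lambda>p. norm (case p of (k, l) \<Rightarrow> F k * G l)) ` {X. X \<subseteq> UNIV \<times> UNIV \<and> finite X})"
    proof (rule bdd_aboveI2)
      fix X :: "((nat ^ 'n) \<times> (nat ^ 'n)) set" assume "X \<in> {X. X \<subseteq> UNIV \<times> UNIV \<and> finite X}"
      then have X: "finite X" by simp
      have "(\<Sum>p\<in>X. norm (case p of (k, l) \<Rightarrow> F k * G l)) \<le> (\<Sum>p\<in>fst ` X \<times> snd ` X. norm (case p of (k, l) \<Rightarrow> F k * G l))"
        by (rule sum_mono2[OF _ subset_fst_snd]) (use X in auto)
      also have "\<dots> = (\<Sum>k\<in>fst ` X. norm (F k)) * (\<Sum>l\<in>snd ` X. norm (G l))"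
        by (simp add: sum_product sum.cartesian_product norm_mult split_beta)
      also have "\<dots> \<le> infsum (\<lambda>k. norm (F k)) UNIV * infsum (\<lambda>k. norm (G k)) UNIV"
        by (intro mult_mono finite_sum_le_infsum aF aG infsum_nonneg sum_nonneg) (use X in auto)
      finally show "(\<Sum>p\<in>X. norm (case p of (k, l) \<Rightarrow> F k * G l)) \<le> infsum (\<lambda>k. norm (F k)) UNIV * infsum (\<lambda>k. norm (G k)) UNIV" .
    qed
  qed auto
  then have s: "(\<lambda>(k, l). F k * G l) summable_on UNIV \<times> UNIV" by (rule abs_summable_summable)
  have "((\<lambda>(k, l). F k * G l) has_sum f * g) (UNIV \<times> UNIV)"
  proof (rule has_sum_SigmaI[where g = "\<lambda>k. F k * g"])
    show "((\<lambda>l. case (k, l) of (k, l) \<Rightarrow> F k * G l) has_sum F k * g) UNIV" for k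
      using has_sum_cmult_right[OF G, of "F k"] by simp
    show "((\<lambda>k. F k * g) has_sum f * g) UNIV" by (rule has_sum_cmult_left[OF F])
  qed (rule s)
  then have "((\<lambda>(s, k). F k * G (s - k)) has_sum f * g) (SIGMA s:UNIV. {k. k \<le> s})"
    by (subst has_sum_reindex_bij_witness[of _ "\<lambda>(k, l). (k + l, k)" "\<lambda>(s, k). (k, s - k)"])
       (auto simp: vec_eq_iff less_eq_vec_def)
  then show ?thesis
    by (rule has_sum_SigmaD) (auto intro!: has_sum_finiteI finite_vec_le)
qed

lemma has_taylor_mult:
  assumes "has_taylor f a" "has_taylor g b"
  shows "has_taylor (\<lambda>x. f x * g x) (cauchy_prod a b)"
  using assms unfolding has_taylor_def
proof eventually_elim
  case (elim x)
  have "(\<Sum>k\<in>{k. k \<le> s}. (a k * monomial_fun k x) * (b (s - k) * monomial_fun (s - k) x)) = cauchy_prod a b s * monomial_fun s x" for s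
    unfolding cauchy_prod_def sum_distrib_right
  proof (rule sum.cong)
    fix k assume "k \<in> {k. k \<le> s}"
    then have "k + (s - k) = s" by (simp add: vec_eq_iff less_eq_vec_def)
    then have "monomial_fun k x * monomial_fun (s - k) x = monomial_fun s x" by (simp flip: monomial_fun_add)
    then show "(a k * monomial_fun k x) * (b (s - k) * monomial_fun (s - k) x) = a k * b (s - k) * monomial_fun s x"
      by (metis (no_types, lifting) mult.assoc mult.left_commute)
  qed simp
  then show ?case using has_sum_cauchy_prod[OF elim] by simp
qed

lemma has_taylor_add:
  assumes "has_taylor f a" "has_taylor g b"
  shows "has_taylor (\<lambda>x. f x + g x) (\<lambda>k. a k + b k)"
  using assms unfolding has_taylor_def
  by eventually_elim (simp add: distrib_right has_sum_add)

lemma has_taylor_cmult: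
  assumes "has_taylor f a"
  shows "has_taylor (\<lambda>x. c * f x) (\<lambda>k. c * a k)"
  using assms unfolding has_taylor_def
  by eventually_elim (simp add: mult.assoc has_sum_cmult_right)

lemma has_taylor_cong:
  assumes "has_taylor f a" "\<forall>\<^sub>F x in nhds 0. f x = g x"
  shows "has_taylor g a"
  using assms unfolding has_taylor_def by eventually_elim simp

lemma has_taylor_zero: "has_taylor (\<lambda>x. 0) (\<lambda>k. 0)"
  by (simp add: has_taylor_def)

section \<open>Uniqueness of the Taylor expansion\<close>

text \<open>Along \<open>x\<^sub>j = t\<^bsup>w j\<^esup>\<close> with weights that refine the total degree, a nonzero series has a unique
  term of lowest order in \<open>t\<close>.\<close>

lemma taylor_coeffs_zero:
  fixes c :: "nat ^ 'n \<Rightarrow> complex"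
  assumes "has_taylor f c" and "\<forall>\<^sub>F x in nhds 0. f x = 0"
  shows "c k = 0"
proof (rule ccontr)
  assume "c k \<noteq> 0"
  have "has_taylor (\<lambda>x. 0) c" using has_taylor_cong[OF assms] .
  then obtain \<epsilon> where \<epsilon>: "\<epsilon> > 0" "\<And>x. dist x 0 < \<epsilon> \<Longrightarrow> ((\<lambda>k. c k * monomial_fun k x) has_sum 0) UNIV"
    unfolding has_taylor_def eventually_nhds_metric by blast
  define d where "d = (LEAST d. \<exists>k. c k \<noteq> 0 \<and> deg k = d)"
  have exd: "\<exists>k. c k \<noteq> 0 \<and> deg k = d" unfolding d_def by (rule LeastI[of _ "deg k"]) (use \<open>c k \<noteq> 0\<close> in auto)
  have dmin: "d \<le> deg k" if "c k \<noteq> 0" for k unfolding d_def by (rule Least_le) (use that in auto)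
  obtain h :: "'n \<Rightarrow> nat" where h: "bij_betw h UNIV {..<CARD('n)}"
    using ex_bij_betw_finite_nat[of "UNIV :: 'n set"] by (auto simp: atLeast0LessThan)
  \<comment> \<open>Exponents of degree \<open>d\<close> have entries below \<open>b\<close>, so the
    base-\<open>b\<close> value \<open>v\<close> tells them apart. \<open>L\<close> exceeds
    \<open>v\<close> on degree \<open>d\<close>, so the weight \<open>e\<close> compares degrees
    first.\<close>
  define b where "b = Suc d"
  define v where "v k = (\<Sum>j\<in>UNIV. k $ j * b ^ h j)" for k :: "nat ^ 'n"
  define L where "L = Suc (d * b ^ CARD('n))"
  define w where "w j = L + b ^ h j" for j
  define e where "e k = (\<Sum>j\<in>UNIV. k $ j * w j)" for k
  have e_eq: "e k = L * deg k + v k" for k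
    by (simp add: e_def w_def v_def deg_def distrib_left sum.distrib sum_distrib_left mult.commute)
  have v_le: "v k \<le> deg k * b ^ CARD('n)" for k
  proof -
    have "v k \<le> (\<Sum>j\<in>UNIV. k $ j * b ^ CARD('n))"
      unfolding v_def
    proof (intro sum_mono mult_left_mono power_increasing)
      fix j :: 'n
      show "h j \<le> CARD('n)" using bij_betwE[OF h] by (auto intro: less_imp_le)
    qed (auto simp: b_def)
    then show ?thesis by (simp add: deg_def sum_distrib_right)
  qed
  define E where "E = (LEAST E. \<exists>k. c k \<noteq> 0 \<and> e k = E)"
  have "\<exists>k. c k \<noteq> 0 \<and> e k = E" unfolding E_def by (rule LeastI[of _ "e k"]) (use \<open>c k \<noteq> 0\<close> in auto)
  then obtain k0 where k0: "c k0 \<noteq> 0" "e k0 = E" by blast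
  have Emin: "E \<le> e k" if "c k \<noteq> 0" for k unfolding E_def by (rule Least_le) (use that in auto)
  have deg_d: "deg k = d" if "c k \<noteq> 0" "e k = E" for k
  proof (rule ccontr)
    assume "deg k \<noteq> d"
    then have "Suc d \<le> deg k" using dmin[OF that(1)] by simp
    then have "L * Suc d \<le> e k" unfolding e_eq by (intro trans_le_add1 mult_left_mono) auto
    moreover obtain k' where k': "c k' \<noteq> 0" "deg k' = d" using exd by blast
    have "E \<le> L * d + d * b ^ CARD('n)" using Emin[OF k'(1)] v_le[of k'] by (simp add: e_eq k'(2))
    ultimately show False using that(2) by (simp add: L_def)
  qed
  have uniq: "k = k0" if k: "c k \<noteq> 0" "e k = E" for k
  proof -
    have "deg k = d" "deg k0 = d" using deg_d k k0 by auto
    then have vv: "v k = v k0" using k k0 by (simp add: e_eq)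
    define g where "g = inv_into UNIV h"
    have v_sum: "v k = (\<Sum>j<CARD('n). (k $ g j) * b ^ j)" for k
      unfolding v_def by (rule sum.reindex_bij_witness[of _ g h])
        (use h in \<open>auto simp: g_def bij_betw_def inv_into_f_f f_inv_into_f\<close>)
    have "k $ j = k0 $ j" for j
    proof -
      have small: "l $ g j < b" if "deg l = d" for l :: "nat ^ 'n" and j
        using component_le_deg[of l "g j"] that by (simp add: b_def)
      have "k $ g (h j) = k0 $ g (h j)"
        by (rule digits_unique[of "\<lambda>j. k $ g j" b "CARD('n)" "\<lambda>j. k0 $ g j"])
          (use vv v_sum small \<open>deg k = d\<close> \<open>deg k0 = d\<close> bij_betwE[OF h] in auto)
      then show ?thesis using h by (simp add: g_def bij_betw_def inv_into_f_f)
    qed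
    then show ?thesis by (simp add: vec_eq_iff)
  qed
  define t0 where "t0 = min 1 (\<epsilon> / (2 * real CARD('n)))"
  have t0: "0 < t0" "t0 \<le> 1" "real CARD('n) * t0 < \<epsilon>"
  proof -
    show "0 < t0" "t0 \<le> 1" using \<epsilon>(1) by (auto simp: t0_def)
    have "real CARD('n) * t0 \<le> real CARD('n) * (\<epsilon> / (2 * real CARD('n)))" by (intro mult_left_mono) (auto simp: t0_def)
    then show "real CARD('n) * t0 < \<epsilon>" using \<epsilon>(1) by simp
  qed
  have hs: "((\<lambda>k. c k * of_real (t ^ e k)) has_sum 0) UNIV" if t: "0 < t" "t \<le> t0" for t
  proof -
    define x :: "complex ^ 'n" where "x = (\<chi> j. of_real (t ^ w j))"
    have "norm x \<le> (\<Sum>j\<in>(UNIV :: 'n set). t ^ w j)" using norm_vec_le_sum[of x] t by (simp add: x_def norm_power)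
    also have "\<dots> \<le> (\<Sum>j\<in>(UNIV :: 'n set). t0)"
    proof (rule sum_mono)
      fix j :: 'n
      have "t ^ w j \<le> t ^ 1" using t t0 by (intro power_decreasing) (auto simp: w_def L_def)
      then show "t ^ w j \<le> t0" using t by simp
    qed
    finally have "dist x 0 < \<epsilon>" using t0 by (simp add: dist_norm)
    moreover have "monomial_fun k x = of_real (t ^ e k)" for k
      by (simp add: monomial_fun_def x_def e_def power_sum power_mult[symmetric] mult.commute)
    ultimately show ?thesis using \<epsilon>(2)[of x] by simp
  qed
  define S where "S = infsum (\<lambda>k. norm (c k) * t0 ^ e k) (UNIV - {k0})"
  have sm: "(\<lambda>k. norm (c k) * t0 ^ e k) summable_on UNIV - {k0}"
  proof -
    have "(\<lambda>k. norm (c k * of_real (t0 ^ e k))) summable_on UNIV"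
      by (rule has_sum_norm_summable[OF hs[OF t0(1) order_refl]])
    then have "(\<lambda>k. norm (c k) * t0 ^ e k) summable_on UNIV" using t0 by (simp add: norm_mult norm_power)
    then show ?thesis by (rule summable_on_subset_banach) simp
  qed
  \<comment> \<open>Under the scaling \<open>t = \<tau> * t0\<close> every nonzero term other than
    \<open>k0\<close> gains at least \<open>\<tau> ^ Suc E\<close>, one power more than the term at
    \<open>k0\<close>, which the others must cancel.\<close>
  have main: "norm (c k0) * t0 ^ E \<le> \<tau> * S" if \<tau>: "0 < \<tau>" "\<tau> \<le> 1" for \<tau>
  proof -
    define t where "t = \<tau> * t0"
    have t: "0 < t" "t \<le> t0" using \<tau> t0 by (auto simp: t_def mult_left_le_one_le)
    let ?F = "\<lambda>k. c k * of_real (t ^ e k)"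
    have "(?F has_sum (0 - ?F k0)) (UNIV - {k0})"
      by (rule has_sum_Diff[OF hs[OF t]]) (auto intro: has_sum_finiteI)
    then have eq: "infsum ?F (UNIV - {k0}) = - ?F k0" by (simp add: infsumI)
    have as: "(\<lambda>k. norm (?F k)) summable_on UNIV - {k0}"
      by (rule summable_on_subset_banach[OF has_sum_norm_summable[OF hs[OF t]]]) simp
    have "norm (c k0) * t ^ E = norm (infsum ?F (UNIV - {k0}))"
      unfolding eq using t k0(2) by (simp add: norm_mult norm_power)
    also have "\<dots> \<le> infsum (\<lambda>k. norm (?F k)) (UNIV - {k0})" by (rule norm_infsum_bound[OF as])
    also have "\<dots> \<le> infsum (\<lambda>k. \<tau> ^ Suc E * (norm (c k) * t0 ^ e k)) (UNIV - {k0})"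
    proof (rule infsum_mono[OF as summable_on_cmult_right[OF sm]])
      fix k assume "k \<in> UNIV - {k0}"
      then have k: "k \<noteq> k0" by simp
      show "norm (?F k) \<le> \<tau> ^ Suc E * (norm (c k) * t0 ^ e k)"
      proof (cases "c k = 0")
        case False
        then have "Suc E \<le> e k" using Emin[OF False] uniq[OF False] k by (cases "e k = E") auto
        then have "\<tau> ^ e k \<le> \<tau> ^ Suc E" using \<tau> by (intro power_decreasing) auto
        then have "norm (c k) * (\<tau> ^ e k * t0 ^ e k) \<le> norm (c k) * (\<tau> ^ Suc E * t0 ^ e k)"
          using t0 by (intro mult_left_mono mult_right_mono) auto
        moreover have "norm (?F k) = norm (c k) * (\<tau> ^ e k * t0 ^ e k)"
          using \<tau> t0 by (simp add: norm_mult norm_power t_def power_mult_distrib)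
        ultimately show ?thesis by (simp only: mult_ac)
      qed simp
    qed
    also have "\<dots> = \<tau> ^ Suc E * S" by (simp add: S_def infsum_cmult_right' del: power_Suc)
    finally have "\<tau> ^ E * (norm (c k0) * t0 ^ E) \<le> \<tau> ^ E * (\<tau> * S)" by (simp add: t_def power_mult_distrib mult_ac)
    then show ?thesis using \<tau> by simp
  qed
  define D where "D = norm (c k0) * t0 ^ E"
  have Dpos: "D > 0" using k0 t0 by (simp add: D_def)
  have D1: "D \<le> S" using main[of 1] by (simp add: D_def)
  \<comment> \<open>This value of \<open>\<tau>\<close> is at most 1 because
    \<open>D \<le> S\<close>, and it turns \<open>main\<close> into
    \<open>D \<le> D / 2\<close>.\<close>
  have "D \<le> (D / (2 * S)) * S" unfolding D_def[symmetric]
    using main[of "D / (2 * S)"] D1 Dpos by (simp add: D_def[symmetric])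
  then show False using Dpos D1 by simp
qed

lemma has_taylor_unique:
  assumes "has_taylor f a" "has_taylor f b"
  shows "a = b"
proof
  fix k
  have "has_taylor (\<lambda>x. f x + (-1) * f x) (\<lambda>k. a k + (-1) * b k)"
    by (intro has_taylor_add has_taylor_cmult assms)
  from taylor_coeffs_zero[OF this, of k] show "a k = b k" by simp
qed

section \<open>Reciprocals\<close>

lemma deg_diff_less: "l \<le> k \<Longrightarrow> l \<noteq> 0 \<Longrightarrow> deg (k - l) < deg (k :: nat ^ 'n)"
proof -
  assume "l \<le> k" "l \<noteq> 0"
  then have "k = (k - l) + l" by (simp add: vec_eq_iff less_eq_vec_def)
  then have "deg k = deg (k - l) + deg l" by (metis deg_add)
  then show ?thesis using \<open>l \<noteq> 0\<close> deg_eq_0_iff[of l] by simp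
qed

text \<open>Solves the coefficient equations of \<open>a * b = 1\<close> in order of degree,
  isolating the summand with the constant term \<open>a 0\<close>.\<close>

function inverse_coeffs :: "(nat ^ 'n \<Rightarrow> complex) \<Rightarrow> nat ^ 'n \<Rightarrow> complex" where
  "inverse_coeffs a k = ((if k = 0 then 1 else 0) - (\<Sum>l\<in>{l. l \<le> k \<and> l \<noteq> 0}. a l * inverse_coeffs a (k - l))) / a 0"
  by auto
termination
  by (relation "Wellfounded.measure (\<lambda>(a, k). deg k)") (auto intro: deg_diff_less)

declare inverse_coeffs.simps [simp del]

lemma cauchy_prod_inverse_coeffs:
  assumes "a 0 \<noteq> 0"
  shows "cauchy_prod a (inverse_coeffs a) k = unit_coeffs 0 k"
proof -
  have "{l. l \<le> k} = insert 0 {l. l \<le> k \<and> l \<noteq> 0}" by (auto simp: less_eq_vec_def)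
  moreover have "finite {l. l \<le> k \<and> l \<noteq> 0}" by (rule finite_subset[OF _ finite_vec_le[of k]]) auto
  ultimately have "cauchy_prod a (inverse_coeffs a) k =
      a 0 * inverse_coeffs a k + (\<Sum>l\<in>{l. l \<le> k \<and> l \<noteq> 0}. a l * inverse_coeffs a (k - l))"
    by (simp add: cauchy_prod_def)
  then show ?thesis using assms inverse_coeffs.simps[of a k] by (simp add: unit_coeffs_def)
qed

text \<open>Induction on the degree with the bound \<open>M * B ^ deg k\<close>. It closes once
  \<open>B\<close> is so large that the recursion's sum is at most \<open>norm (a 0)\<close> times
  this bound.\<close>

lemma convergent_inverse_coeffs:
  fixes a :: "nat ^ 'n \<Rightarrow> complex"
  assumes a: "convergent_coeffs a" and a0: "a 0 \<noteq> 0"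
  shows "convergent_coeffs (inverse_coeffs a)"
proof -
  obtain C B0 where CB: "0 < C" "1 \<le> B0" "\<And>k. norm (a k) \<le> C * B0 ^ deg k"
    using a unfolding convergent_coeffs_def by blast
  define G where "G = infsum (\<lambda>k :: nat ^ 'n. (1 / 2 :: real) ^ deg k) UNIV"
  have G: "(\<Sum>k\<in>F. (1 / 2 :: real) ^ deg k) \<le> G" if "finite F" for F :: "(nat ^ 'n) set"
    unfolding G_def by (rule finite_sum_le_infsum[OF geometric_summable_on that]) auto
  have "G \<ge> 0" using G[of "{}"] by simp
  \<comment> \<open>Enlarging \<open>B0\<close> by the factor \<open>s\<close> gives every term with
    \<open>l \<noteq> 0\<close> a factor \<open>2 / s\<close> beside the summable weight
    \<open>(1 / 2) ^ deg l\<close>; this uses \<open>2 / s \<le> 1\<close>, whence the maximum with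
    2. The other entry makes the total at most \<open>norm (a 0)\<close>.\<close>
  define s where "s = max 2 (2 * C * G / norm (a 0))"
  have s: "s \<ge> 2" "2 * C * G / s \<le> norm (a 0)"
  proof -
    show "s \<ge> 2" by (simp add: s_def)
    have "2 * C * G / norm (a 0) \<le> s" by (simp add: s_def)
    then show "2 * C * G / s \<le> norm (a 0)" using \<open>s \<ge> 2\<close> a0 by (simp add: field_simps)
  qed
  define B where "B = B0 * s"
  have B: "B \<ge> 1" using CB(2) s(1) mult_mono[of 1 B0 1 s] by (simp add: B_def)
  have est: "norm (a l) * B ^ (deg k - deg l) \<le> (2 * C / s) * (1 / 2) ^ deg l * B ^ deg k"
    if "l \<le> k" "l \<noteq> 0" for k l
  proof -
    have dl: "deg l \<ge> 1" using that(2) deg_eq_0_iff[of l] by simp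
    have "k = (k - l) + l" using that(1) by (simp add: vec_eq_iff less_eq_vec_def)
    then have "deg k = deg (k - l) + deg l" by (metis deg_add)
    then have Bk: "B ^ deg k = B ^ (deg k - deg l) * B ^ deg l" by (simp flip: power_add)
    have "(2 / s) ^ deg l \<le> (2 / s) ^ 1" using s(1) dl by (intro power_decreasing) auto
    then have "C * B0 ^ deg l * ((2 / s) ^ deg l * (1 / 2) ^ deg l * s ^ deg l) \<le> C * B0 ^ deg l * ((2 / s) * (1 / 2) ^ deg l * s ^ deg l)"
      using CB s(1) by (intro mult_left_mono mult_right_mono) auto
    moreover have "(2 / s) ^ deg l * (1 / 2) ^ deg l * s ^ deg l = 1"
      using s(1) by (simp flip: power_mult_distrib)
    ultimately have "C * B0 ^ deg l \<le> (2 * C / s) * (1 / 2) ^ deg l * B ^ deg l"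
      by (simp add: B_def power_mult_distrib mult_ac)
    then have "norm (a l) \<le> (2 * C / s) * (1 / 2) ^ deg l * B ^ deg l" using CB(3)[of l] by linarith
    then have "norm (a l) * B ^ (deg k - deg l) \<le> (2 * C / s) * (1 / 2) ^ deg l * B ^ deg l * B ^ (deg k - deg l)"
      using B by (intro mult_right_mono) auto
    then show ?thesis by (simp add: Bk mult_ac)
  qed
  define M where "M = 1 / norm (a 0)"
  have M: "M > 0" using a0 by (simp add: M_def)
  have "norm (inverse_coeffs a k) \<le> M * B ^ deg k" for k
  proof (induction "deg k" arbitrary: k rule: less_induct)
    case less
    show ?case
    proof (cases "k = 0")
      case True
      have "{l :: nat ^ 'n. l \<le> 0 \<and> l \<noteq> 0} = {}" by (auto simp: less_eq_vec_def vec_eq_iff)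
      then have "inverse_coeffs a 0 = 1 / a 0"
        by (subst inverse_coeffs.simps) (simp only: sum.empty diff_0_right refl if_True)
      then show ?thesis using True by (simp add: norm_divide M_def)
    next
      case False
      let ?F = "{l. l \<le> k \<and> l \<noteq> 0}"
      have fin: "finite ?F" by (rule finite_subset[OF _ finite_vec_le[of k]]) auto
      have "norm (\<Sum>l\<in>?F. a l * inverse_coeffs a (k - l)) \<le> (\<Sum>l\<in>?F. M * ((2 * C / s) * (1 / 2) ^ deg l * B ^ deg k))"
      proof (rule sum_norm_le)
        fix l assume l: "l \<in> ?F"
        have "k = (k - l) + l" using l by (simp add: vec_eq_iff less_eq_vec_def)
        then have dk: "deg (k - l) = deg k - deg l" by (metis add_diff_cancel_right' deg_add)
        have "norm (a l * inverse_coeffs a (k - l)) \<le> norm (a l) * (M * B ^ deg (k - l))"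
          unfolding norm_mult using l by (intro mult_left_mono less deg_diff_less) auto
        also have "\<dots> = M * (norm (a l) * B ^ (deg k - deg l))" by (simp add: dk)
        also have "\<dots> \<le> M * ((2 * C / s) * (1 / 2) ^ deg l * B ^ deg k)"
          using l M by (intro mult_left_mono est) auto
        finally show "norm (a l * inverse_coeffs a (k - l)) \<le> M * ((2 * C / s) * (1 / 2) ^ deg l * B ^ deg k)" .
      qed
      also have "\<dots> = M * B ^ deg k * (2 * C / s) * (\<Sum>l\<in>?F. (1 / 2) ^ deg l)"
        by (simp add: sum_distrib_left mult_ac)
      also have "\<dots> \<le> M * B ^ deg k * (2 * C / s) * G"
        using G[OF fin] M B CB s(1) by (intro mult_left_mono) auto
      also have "\<dots> = M * B ^ deg k * (2 * C * G / s)" by simp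
      also have "\<dots> \<le> M * B ^ deg k * norm (a 0)" using s(2) M B by (intro mult_left_mono) auto
      finally have "norm (\<Sum>l\<in>?F. a l * inverse_coeffs a (k - l)) / norm (a 0) \<le> M * B ^ deg k"
        using a0 by (simp add: divide_le_eq)
      then show ?thesis using False inverse_coeffs.simps[of a k] by (simp add: norm_divide)
    qed
  qed
  then show ?thesis by (rule convergent_coeffsI) (use B in simp)
qed

section \<open>The ring of germs\<close>

lemma (in ring) idealI_closed:
  assumes "I \<subseteq> carrier R" "\<zero> \<in> I"
    and "\<And>a b. a \<in> I \<Longrightarrow> b \<in> I \<Longrightarrow> a \<oplus> b \<in> I"
    and "\<And>a x. a \<in> I \<Longrightarrow> x \<in> carrier R \<Longrightarrow> x \<otimes> a \<in> I"
    and "\<And>a x. a \<in> I \<Longrightarrow> x \<in> carrier R \<Longrightarrow> a \<otimes> x \<in> I"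
  shows "ideal I R"
proof (rule idealI)
  show "ring R" by (rule ring_axioms)
  show "subgroup I (add_monoid R)"
  proof (rule add.subgroupI)
    fix a assume a: "a \<in> I"
    then have "(\<ominus> \<one>) \<otimes> a = \<ominus> a" using assms(1) by (simp add: l_minus subsetD)
    then show "\<ominus> a \<in> I" using assms(4)[OF a, of "\<ominus> \<one>"] by simp
  qed (use assms in auto)
qed (use assms in auto)

type_synonym 'n germ = "(complex ^ 'n \<Rightarrow> complex) set"

lemma cring_analytic_fun_ring: "cring (analytic_fun_ring :: (complex ^ 'n \<Rightarrow> complex) ring)"
proof (rule cringI)
  show "abelian_group (analytic_fun_ring :: (complex ^ 'n \<Rightarrow> complex) ring)"
  proof (rule abelian_groupI)
    fix f :: "complex ^ 'n \<Rightarrow> complex" assume "f \<in> carrier analytic_fun_ring"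
    then obtain a where "has_taylor f a" by (auto simp: analytic_fun_ring_def)
    from has_taylor_cmult[OF this, of "-1"]
    show "\<exists>g\<in>carrier analytic_fun_ring. g \<oplus>\<^bsub>analytic_fun_ring\<^esub> f = \<zero>\<^bsub>analytic_fun_ring\<^esub>"
      by (intro bexI[of _ "\<lambda>x. -1 * f x"]) (auto simp: analytic_fun_ring_def)
  qed (auto simp: analytic_fun_ring_def add_ac intro: has_taylor_add has_taylor_zero)
  show "Group.comm_monoid (analytic_fun_ring :: (complex ^ 'n \<Rightarrow> complex) ring)"
  proof (rule comm_monoidI)
    have "(monomial_fun 0 :: complex ^ 'n \<Rightarrow> complex) = (\<lambda>x. 1)" by (simp add: fun_eq_iff)
    then show "\<one>\<^bsub>analytic_fun_ring\<^esub> \<in> carrier (analytic_fun_ring :: (complex ^ 'n \<Rightarrow> complex) ring)"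
      using has_taylor_monomial_fun[of "0 :: nat ^ 'n"] by (auto simp: analytic_fun_ring_def)
  qed (auto simp: analytic_fun_ring_def mult_ac intro: has_taylor_mult)
qed (auto simp: analytic_fun_ring_def distrib_right)

interpretation analytic: cring "analytic_fun_ring :: (complex ^ 'n :: finite \<Rightarrow> complex) ring"
  by (rule cring_analytic_fun_ring)

lemma ideal_null_germ_ideal: "ideal null_germ_ideal (analytic_fun_ring :: (complex ^ 'n \<Rightarrow> complex) ring)"
proof (rule analytic.idealI_closed)
  show "null_germ_ideal \<subseteq> carrier (analytic_fun_ring :: (complex ^ 'n \<Rightarrow> complex) ring)"
  proof
    fix f :: "complex ^ 'n \<Rightarrow> complex" assume "f \<in> null_germ_ideal"
    then have "\<forall>\<^sub>F x in nhds 0. 0 = f x" by (auto simp: null_germ_ideal_def elim: eventually_mono)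
    then show "f \<in> carrier analytic_fun_ring"
      using has_taylor_cong[OF has_taylor_zero] by (auto simp: analytic_fun_ring_def)
  qed
next
  fix a b :: "complex ^ 'n \<Rightarrow> complex" assume "a \<in> null_germ_ideal" "b \<in> null_germ_ideal"
  then show "a \<oplus>\<^bsub>analytic_fun_ring\<^esub> b \<in> null_germ_ideal"
    by (auto simp: null_germ_ideal_def analytic_fun_ring_def elim: eventually_elim2)
next
  fix a x :: "complex ^ 'n \<Rightarrow> complex" assume "a \<in> null_germ_ideal"
  then show "x \<otimes>\<^bsub>analytic_fun_ring\<^esub> a \<in> null_germ_ideal" "a \<otimes>\<^bsub>analytic_fun_ring\<^esub> x \<in> null_germ_ideal"
    by (auto simp: null_germ_ideal_def analytic_fun_ring_def elim: eventually_mono)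
qed (simp add: null_germ_ideal_def analytic_fun_ring_def)

interpretation germ: cring "germ_ring :: ('n :: finite) germ ring"
  unfolding germ_ring_def by (rule ideal.quotient_is_cring[OF ideal_null_germ_ideal cring_analytic_fun_ring])

lemma mem_germ_of: "g \<in> germ_of f \<longleftrightarrow> (\<forall>\<^sub>F x in nhds 0. g x = f x)"
proof
  assume "g \<in> germ_of f"
  then obtain z where z: "z \<in> null_germ_ideal" "g = (\<lambda>x. z x + f x)"
    by (auto simp: germ_of_def a_r_coset_def' analytic_fun_ring_def)
  then show "\<forall>\<^sub>F x in nhds 0. g x = f x" by (auto simp: null_germ_ideal_def elim: eventually_mono)
next
  assume "\<forall>\<^sub>F x in nhds 0. g x = f x"
  then have "(\<lambda>x. g x - f x) \<in> null_germ_ideal" by (auto simp: null_germ_ideal_def elim: eventually_mono)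
  then show "g \<in> germ_of f" unfolding germ_of_def a_r_coset_def'
    by (rule UN_I) (simp add: analytic_fun_ring_def)
qed

lemma germ_of_eq:
  assumes "\<forall>\<^sub>F x in nhds 0. f x = g x"
  shows "germ_of f = germ_of g"
proof -
  have "h \<in> germ_of f \<longleftrightarrow> h \<in> germ_of g" for h unfolding mem_germ_of
    using assms by (auto elim: eventually_elim2)
  then show ?thesis by blast
qed

lemma taylor_germ_of:
  assumes "has_taylor f a"
  shows "taylor (germ_of f) = a"
  unfolding taylor_def
proof (rule the_equality)
  show "\<exists>g\<in>germ_of f. has_taylor g a" using assms by (intro bexI[of _ f]) (auto simp: mem_germ_of)
  fix b assume "\<exists>g\<in>germ_of f. has_taylor g b"
  then obtain g where g: "\<forall>\<^sub>F x in nhds 0. g x = f x" "has_taylor g b" by (auto simp: mem_germ_of)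
  then have "has_taylor f b" using has_taylor_cong by blast
  then show "b = a" using has_taylor_unique[OF assms] by simp
qed

lemma carrier_germ_ring: "carrier germ_ring = {germ_of f | f. \<exists>a. has_taylor f a}"
  by (auto simp: germ_ring_def FactRing_def A_RCOSETS_def' germ_of_def analytic_fun_ring_def)

lemma germ_cases:
  assumes "h \<in> carrier germ_ring"
  obtains f where "h = germ_of f" "has_taylor f (taylor h)"
  using assms taylor_germ_of by (auto simp: carrier_germ_ring)

lemma germ_of_closed: "has_taylor f a \<Longrightarrow> germ_of f \<in> carrier germ_ring"
  by (auto simp: carrier_germ_ring)

lemma germ_hom: "germ_of \<in> ring_hom (analytic_fun_ring :: (complex ^ 'n \<Rightarrow> complex) ring) germ_ring"
  using ideal.rcos_ring_hom[OF ideal_null_germ_ideal] by (simp add: germ_of_def[abs_def] germ_ring_def)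

lemma analytic_carrierI: "has_taylor f a \<Longrightarrow> f \<in> carrier analytic_fun_ring"
  by (auto simp: analytic_fun_ring_def)

lemma taylor_convergent: "h \<in> carrier germ_ring \<Longrightarrow> convergent_coeffs (taylor h)"
  by (elim germ_cases) (rule has_taylor_convergent_coeffs)

lemma taylor_inj:
  assumes "g \<in> carrier germ_ring" "h \<in> carrier germ_ring" "taylor g = taylor h"
  shows "g = h"
proof -
  obtain f1 f2 where f: "g = germ_of f1" "has_taylor f1 (taylor h)" "h = germ_of f2" "has_taylor f2 (taylor h)"
    using assms by (metis germ_cases)
  have "\<forall>\<^sub>F x in nhds 0. f1 x = f2 x"
    using f(2,4) unfolding has_taylor_def by eventually_elim (rule has_sum_unique)
  then show ?thesis using f germ_of_eq by simp
qed

lemma taylor_surj: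
  assumes "convergent_coeffs a"
  obtains h where "h \<in> carrier germ_ring" "taylor h = a"
  using convergent_coeffs_has_taylor[OF assms] germ_of_closed taylor_germ_of by blast

lemma taylor_add:
  assumes "g \<in> carrier germ_ring" "h \<in> carrier germ_ring"
  shows "taylor (g \<oplus>\<^bsub>germ_ring\<^esub> h) = (\<lambda>k. taylor g k + taylor h k)"
proof -
  obtain f1 where f1: "g = germ_of f1" "has_taylor f1 (taylor g)" using germ_cases[OF assms(1)] .
  obtain f2 where f2: "h = germ_of f2" "has_taylor f2 (taylor h)" using germ_cases[OF assms(2)] .
  have "g \<oplus>\<^bsub>germ_ring\<^esub> h = germ_of (\<lambda>x. f1 x + f2 x)"
    using ring_hom_add[OF germ_hom analytic_carrierI[OF f1(2)] analytic_carrierI[OF f2(2)]] f1(1) f2(1)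
    by (simp add: analytic_fun_ring_def)
  then show ?thesis using taylor_germ_of[OF has_taylor_add[OF f1(2) f2(2)]] by simp
qed

lemma taylor_mult:
  assumes "g \<in> carrier germ_ring" "h \<in> carrier germ_ring"
  shows "taylor (g \<otimes>\<^bsub>germ_ring\<^esub> h) = cauchy_prod (taylor g) (taylor h)"
proof -
  obtain f1 where f1: "g = germ_of f1" "has_taylor f1 (taylor g)" using germ_cases[OF assms(1)] .
  obtain f2 where f2: "h = germ_of f2" "has_taylor f2 (taylor h)" using germ_cases[OF assms(2)] .
  have "g \<otimes>\<^bsub>germ_ring\<^esub> h = germ_of (\<lambda>x. f1 x * f2 x)"
    using ring_hom_mult[OF germ_hom analytic_carrierI[OF f1(2)] analytic_carrierI[OF f2(2)]] f1(1) f2(1)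
    by (simp add: analytic_fun_ring_def)
  then show ?thesis using taylor_germ_of[OF has_taylor_mult[OF f1(2) f2(2)]] by simp
qed

definition germ_monomial :: "nat ^ 'n \<Rightarrow> ('n :: finite) germ" where
  "germ_monomial k = germ_of (monomial_fun k)"

lemma germ_monomial_closed [simp]: "germ_monomial k \<in> carrier germ_ring"
  by (simp add: germ_monomial_def germ_of_closed[OF has_taylor_monomial_fun])

lemma taylor_germ_monomial [simp]: "taylor (germ_monomial k) = unit_coeffs k"
  by (simp add: germ_monomial_def taylor_germ_of[OF has_taylor_monomial_fun])

lemma taylor_zero: "taylor (\<zero>\<^bsub>germ_ring\<^esub> :: ('n :: finite) germ) = (\<lambda>k. 0)"
proof -
  have "taylor (\<zero>\<^bsub>germ_ring\<^esub> :: ('n :: finite) germ) k + taylor (\<zero>\<^bsub>germ_ring\<^esub> :: ('n :: finite) germ) k = taylor (\<zero>\<^bsub>germ_ring\<^esub> :: ('n :: finite) germ) k" for k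
    using fun_cong[OF taylor_add[of "\<zero>\<^bsub>germ_ring\<^esub> :: 'n germ" "\<zero>\<^bsub>germ_ring\<^esub>"], of k] by simp
  then show ?thesis by (simp add: fun_eq_iff)
qed

lemma cauchy_prod_unit_coeffs: "cauchy_prod (unit_coeffs k) b s = (if k \<le> s then b (s - k) else 0)"
proof -
  have "cauchy_prod (unit_coeffs k) b s = (\<Sum>l\<in>{l. l \<le> s}. if l = k then b (s - k) else 0)"
    unfolding cauchy_prod_def by (rule sum.cong) (auto simp: unit_coeffs_def)
  then show ?thesis using finite_vec_le[of s] by simp
qed

lemma germ_monomial_zero: "germ_monomial 0 = (\<one>\<^bsub>germ_ring\<^esub> :: ('n :: finite) germ)"
proof -
  have "germ_monomial 0 \<otimes>\<^bsub>germ_ring\<^esub> h = h" if h: "h \<in> carrier germ_ring" for h :: "('n :: finite) germ"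
  proof (rule taylor_inj)
    have "(0 :: nat ^ 'n) \<le> s" for s by (simp add: less_eq_vec_def)
    then show "taylor (germ_monomial 0 \<otimes>\<^bsub>germ_ring\<^esub> h) = taylor h"
      using h by (simp add: taylor_mult cauchy_prod_unit_coeffs fun_eq_iff)
  qed (use h in auto)
  from this[of "\<one>\<^bsub>germ_ring\<^esub>"] show ?thesis by simp
qed

lemma germ_monomial_add:
  fixes k l :: "nat ^ 'n"
  shows "germ_monomial (k + l) = germ_monomial k \<otimes>\<^bsub>germ_ring\<^esub> germ_monomial l"
proof (rule taylor_inj)
  have e: "k + (s - k) = s" if "k \<le> s" for s using that by (simp add: vec_eq_iff less_eq_vec_def)
  have "k \<le> k + l" "k + l - k = l" by (simp_all add: vec_eq_iff less_eq_vec_def)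
  then have "k \<le> s \<and> s - k = l \<longleftrightarrow> s = k + l" for s using e[of s] by auto
  then show "taylor (germ_monomial (k + l)) = taylor (germ_monomial k \<otimes>\<^bsub>germ_ring\<^esub> germ_monomial l)"
    by (auto simp: taylor_mult cauchy_prod_unit_coeffs fun_eq_iff unit_coeffs_def)
qed auto

text \<open>Constants act as germs, so ideals are complex subspaces; this permits elimination of
  leading terms inside an ideal.\<close>

lemma germ_scalar:
  assumes "h \<in> carrier (germ_ring :: ('n :: finite) germ ring)"
  obtains u where "u \<in> carrier germ_ring" "taylor (u \<otimes>\<^bsub>germ_ring\<^esub> h) = (\<lambda>k. c * taylor h k)"
proof -
  have "convergent_coeffs (\<lambda>k :: nat ^ 'n. c * unit_coeffs 0 k)"
    by (rule convergent_coeffsI[of _ "norm c" 1]) (auto simp: unit_coeffs_def)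
  then obtain u :: "('n :: finite) germ" where u: "u \<in> carrier germ_ring" "taylor u = (\<lambda>k. c * unit_coeffs 0 k)"
    by (rule taylor_surj)
  have "cauchy_prod (\<lambda>k. c * unit_coeffs 0 k) b s = c * b s" for b :: "nat ^ 'n \<Rightarrow> complex" and s
  proof -
    have "cauchy_prod (\<lambda>k. c * unit_coeffs 0 k) b s = c * cauchy_prod (unit_coeffs 0) b s"
      by (simp add: cauchy_prod_def sum_distrib_left mult.assoc)
    moreover have "(0 :: nat ^ 'n) \<le> s" by (simp add: less_eq_vec_def)
    ultimately show ?thesis by (simp add: cauchy_prod_unit_coeffs)
  qed
  then show ?thesis using that[OF u(1)] u assms by (simp add: taylor_mult fun_eq_iff)
qed

section \<open>Monomial ideals\<close>

text \<open>Defined by supports so that membership can be read off the Taylor coefficients. For an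
  upset with finite complement it is the ideal generated by the monomials, by
  \<open>mideal_subset_ideal\<close>.\<close>

definition mideal :: "(nat ^ 'n) set \<Rightarrow> ('n :: finite) germ set" where
  "mideal U = {h \<in> carrier germ_ring. \<forall>k. taylor h k \<noteq> 0 \<longrightarrow> k \<in> U}"

lemma ideal_mideal:
  fixes U :: "(nat ^ 'n) set"
  assumes "upset U"
  shows "ideal (mideal U) germ_ring"
proof (rule germ.idealI_closed)
  show "mideal U \<subseteq> carrier germ_ring" by (auto simp: mideal_def)
  show "\<zero>\<^bsub>germ_ring\<^esub> \<in> mideal U" by (simp add: mideal_def taylor_zero)
next
  fix a b assume "a \<in> mideal U" "b \<in> mideal U"
  then show "a \<oplus>\<^bsub>germ_ring\<^esub> b \<in> mideal U" by (force simp: mideal_def taylor_add)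
next
  fix a x :: "'n germ" assume a: "a \<in> mideal U" and x: "x \<in> carrier germ_ring"
  have "s \<in> U" if "taylor (x \<otimes>\<^bsub>germ_ring\<^esub> a) s \<noteq> 0" for s
  proof -
    have "(\<Sum>k\<in>{k. k \<le> s}. taylor x k * taylor a (s - k)) \<noteq> 0"
      using that a x by (simp add: taylor_mult mideal_def cauchy_prod_def)
    then obtain k where k: "k \<le> s" "taylor a (s - k) \<noteq> 0" by (auto elim: sum.not_neutral_contains_not_neutral)
    then have "s - k \<in> U" using a by (auto simp: mideal_def)
    moreover have "s - k \<le> s" by (simp add: less_eq_vec_def)
    ultimately show ?thesis using upset_le[OF assms] by blast
  qed
  then show xa: "x \<otimes>\<^bsub>germ_ring\<^esub> a \<in> mideal U" using a x by (auto simp: mideal_def)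
  then show "a \<otimes>\<^bsub>germ_ring\<^esub> x \<in> mideal U" using a x germ.m_comm[of a x] by (auto simp: mideal_def)
qed

lemma germ_monomial_mem_mideal: "germ_monomial k \<in> mideal U \<longleftrightarrow> k \<in> U"
  by (auto simp: mideal_def unit_coeffs_def)

lemma mideal_mono: "U \<subseteq> V \<Longrightarrow> mideal U \<subseteq> mideal V"
  by (auto simp: mideal_def)

lemma mideal_subset_iff: "mideal U \<subseteq> mideal V \<longleftrightarrow> U \<subseteq> V"
  using germ_monomial_mem_mideal mideal_mono by blast

lemma mideal_UNIV: "mideal UNIV = carrier germ_ring"
  by (auto simp: mideal_def)

text \<open>Collect the terms of \<open>h\<close> divisible by the monomial of \<open>ka\<close>
  into a multiple of that monomial. Both the quotient series and the rest still converge, and the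
  rest is covered by the other generators.\<close>

lemma mem_ideal_if_covered:
  assumes Q: "ideal Q germ_ring" and "finite A"
    and "\<And>ka. ka \<in> A \<Longrightarrow> germ_monomial ka \<in> Q"
    and "h \<in> carrier germ_ring" "\<And>k. taylor h k \<noteq> 0 \<Longrightarrow> \<exists>ka\<in>A. ka \<le> k"
  shows "h \<in> Q"
  using assms(2-)
proof (induction A arbitrary: h rule: finite_induct)
  case empty
  then have "taylor h = taylor \<zero>\<^bsub>germ_ring\<^esub>" by (auto simp: taylor_zero fun_eq_iff)
  then have "h = \<zero>\<^bsub>germ_ring\<^esub>" using taylor_inj empty by blast
  then show ?case using additive_subgroup.zero_closed[OF ideal.axioms(1)[OF Q]] by simp
next
  case (insert ka A)
  have conv: "convergent_coeffs (taylor h)" using taylor_convergent insert.prems(2) by blast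
  obtain g where g: "g \<in> carrier germ_ring" "taylor g = (\<lambda>l. taylor h (ka + l))"
    using taylor_surj[OF convergent_coeffs_shift[OF conv]] by blast
  have "convergent_coeffs (\<lambda>k. if ka \<le> k then 0 else taylor h k)"
    by (rule convergent_coeffs_restrict[OF conv]) auto
  then obtain f where f: "f \<in> carrier germ_ring" "taylor f = (\<lambda>k. if ka \<le> k then 0 else taylor h k)"
    by (rule taylor_surj)
  have fQ: "f \<in> Q"
  proof (rule insert.IH)
    fix k assume "taylor f k \<noteq> 0"
    then have "\<not> ka \<le> k" "taylor h k \<noteq> 0" by (auto simp: f(2) split: if_splits)
    then show "\<exists>ka\<in>A. ka \<le> k" using insert.prems(3) by blast
  qed (use insert.prems f in auto)
  have gQ: "germ_monomial ka \<otimes>\<^bsub>germ_ring\<^esub> g \<in> Q"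
    by (rule ideal.I_r_closed[OF Q]) (use insert.prems g in auto)
  have "h = (germ_monomial ka \<otimes>\<^bsub>germ_ring\<^esub> g) \<oplus>\<^bsub>germ_ring\<^esub> f"
  proof (rule taylor_inj)
    have "ka + (s - ka) = s" if "ka \<le> s" for s using that by (simp add: vec_eq_iff less_eq_vec_def)
    then show "taylor h = taylor ((germ_monomial ka \<otimes>\<^bsub>germ_ring\<^esub> g) \<oplus>\<^bsub>germ_ring\<^esub> f)"
      using g f by (auto simp: taylor_add taylor_mult cauchy_prod_unit_coeffs fun_eq_iff)
  qed (use insert.prems g f in auto)
  then show ?case using additive_subgroup.a_closed[OF ideal.axioms(1)[OF Q] gQ fQ] by simp
qed

lemma mideal_subset_ideal:
  fixes U :: "(nat ^ 'n) set"
  assumes "ideal Q germ_ring" "finite A" "\<And>ka. ka \<in> A \<Longrightarrow> germ_monomial ka \<in> Q" "\<And>k. k \<in> U \<Longrightarrow> \<exists>ka\<in>A. ka \<le> k"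
  shows "mideal U \<subseteq> Q"
  using mem_ideal_if_covered[OF assms(1-3)] assms(4) by (auto simp: mideal_def)

lemma cofinite_generators:
  fixes U :: "(nat ^ 'n) set"
  assumes "upset U" "finite (- U)"
  obtains A where "finite A" "A \<subseteq> U" "\<And>k. k \<in> U \<Longrightarrow> \<exists>ka\<in>A. ka \<le> k"
proof -
  obtain d where d: "mm d \<subseteq> U" using finite_Compl_iff[OF assms(1)] assms(2) by blast
  show ?thesis
  proof (rule that[of "{k \<in> U. deg k \<le> d}"])
    show "finite {k \<in> U. deg k \<le> d}" by (rule finite_subset[OF _ card_deg_less(1)[of "Suc d"]]) auto
    show "\<exists>ka\<in>{k \<in> U. deg k \<le> d}. ka \<le> k" if "k \<in> U" for k
      using generator_le[OF assms(1) d that] vec_le_iff_add by fastforce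
  qed auto
qed

lemma set_add_mideal:
  fixes U V :: "(nat ^ 'n) set"
  assumes "upset U" "finite (- U)" "upset V" "finite (- V)"
  shows "mideal U <+>\<^bsub>germ_ring\<^esub> mideal V = mideal (U \<union> V)"
proof
  have UV: "upset (U \<union> V)" using assms upset_Un by blast
  have id: "ideal (mideal U <+>\<^bsub>germ_ring\<^esub> mideal V) germ_ring"
    using assms by (intro germ.add_ideals ideal_mideal)
  show "mideal U <+>\<^bsub>germ_ring\<^esub> mideal V \<subseteq> mideal (U \<union> V)"
  proof
    fix h assume "h \<in> mideal U <+>\<^bsub>germ_ring\<^esub> mideal V"
    then obtain f g where "f \<in> mideal U" "g \<in> mideal V" "h = f \<oplus>\<^bsub>germ_ring\<^esub> g" by (auto simp: set_add_def')
    moreover have "mideal U \<subseteq> mideal (U \<union> V)" "mideal V \<subseteq> mideal (U \<union> V)" by (auto intro: mideal_mono[THEN subsetD])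
    ultimately show "h \<in> mideal (U \<union> V)"
      using additive_subgroup.a_closed[OF ideal.axioms(1)[OF ideal_mideal[OF UV]]] by blast
  qed
  have fin: "finite (- (U \<union> V))" by (rule finite_subset[OF _ assms(2)]) auto
  obtain A where A: "finite A" "A \<subseteq> U \<union> V" "\<And>k. k \<in> U \<union> V \<Longrightarrow> \<exists>ka\<in>A. ka \<le> k"
    using cofinite_generators[OF UV fin] by blast
  show "mideal (U \<union> V) \<subseteq> mideal U <+>\<^bsub>germ_ring\<^esub> mideal V"
  proof (rule mideal_subset_ideal[OF id A(1) _ A(3)])
    fix ka assume "ka \<in> A"
    then have "ka \<in> U \<or> ka \<in> V" using A(2) by blast
    then show "germ_monomial ka \<in> mideal U <+>\<^bsub>germ_ring\<^esub> mideal V"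
    proof
      assume "ka \<in> U"
      then have "germ_monomial ka \<in> mideal U" by (simp add: germ_monomial_mem_mideal)
      moreover have "\<zero>\<^bsub>germ_ring\<^esub> \<in> mideal V" by (simp add: mideal_def taylor_zero)
      moreover have "germ_monomial ka = germ_monomial ka \<oplus>\<^bsub>germ_ring\<^esub> \<zero>\<^bsub>germ_ring\<^esub>" by simp
      ultimately show ?thesis unfolding set_add_def' by blast
    next
      assume "ka \<in> V"
      then have "germ_monomial ka \<in> mideal V" by (simp add: germ_monomial_mem_mideal)
      moreover have "\<zero>\<^bsub>germ_ring\<^esub> \<in> mideal U" by (simp add: mideal_def taylor_zero)
      moreover have "germ_monomial ka = \<zero>\<^bsub>germ_ring\<^esub> \<oplus>\<^bsub>germ_ring\<^esub> germ_monomial ka" by simp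
      ultimately show ?thesis unfolding set_add_def' by blast
    qed
  qed
qed

lemma upset_msum_cofinite:
  fixes U V :: "(nat ^ 'n) set"
  assumes "upset U" "finite (- U)" "upset V" "finite (- V)"
  shows "finite (- msum U V)"
proof -
  obtain d e where "mm d \<subseteq> U" "mm e \<subseteq> V" using assms finite_Compl_iff by blast
  then have "mm (d + e) \<subseteq> msum U V" using msum_mono[of "mm d" U "mm e" V] by (simp add: msum_mm)
  then show ?thesis using finite_Compl_iff[OF upset_msum[OF assms(3), of U]] by blast
qed

lemma ideal_prod_mideal:
  fixes U V :: "(nat ^ 'n) set"
  assumes "upset U" "finite (- U)" "upset V" "finite (- V)"
  shows "ideal_prod germ_ring (mideal U) (mideal V) = mideal (msum U V)"
proof
  have up: "upset (msum U V)" by (rule upset_msum[OF assms(3)])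
  show "ideal_prod germ_ring (mideal U) (mideal V) \<subseteq> mideal (msum U V)"
  proof
    fix h assume "h \<in> ideal_prod germ_ring (mideal U) (mideal V)"
    then show "h \<in> mideal (msum U V)"
    proof (induction h rule: ideal_prod.induct)
      case (prod f g)
      have "s \<in> msum U V" if "taylor (f \<otimes>\<^bsub>germ_ring\<^esub> g) s \<noteq> 0" for s
      proof -
        have "(\<Sum>k\<in>{k. k \<le> s}. taylor f k * taylor g (s - k)) \<noteq> 0"
          using that prod by (simp add: taylor_mult mideal_def cauchy_prod_def)
        then obtain k where k: "k \<le> s" "taylor f k \<noteq> 0" "taylor g (s - k) \<noteq> 0"
          by (auto elim: sum.not_neutral_contains_not_neutral)
        then have "k \<in> U" "s - k \<in> V" using prod by (auto simp: mideal_def)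
        then have "k + (s - k) \<in> msum U V" by (intro msumI)
        moreover have "k + (s - k) = s" using k(1) by (simp add: vec_eq_iff less_eq_vec_def)
        ultimately show ?thesis by simp
      qed
      then show ?case using prod by (auto simp: mideal_def)
    next
      case (sum f g)
      then show ?case using additive_subgroup.a_closed[OF ideal.axioms(1)[OF ideal_mideal[OF up]]] by blast
    qed
  qed
  obtain A where A: "finite A" "A \<subseteq> msum U V" "\<And>k. k \<in> msum U V \<Longrightarrow> \<exists>ka\<in>A. ka \<le> k"
    using cofinite_generators[OF up upset_msum_cofinite[OF assms]] by blast
  show "mideal (msum U V) \<subseteq> ideal_prod germ_ring (mideal U) (mideal V)"
  proof (rule mideal_subset_ideal[OF _ A(1) _ A(3)])
    show "ideal (ideal_prod germ_ring (mideal U) (mideal V)) germ_ring"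
      by (intro germ.ideal_prod_is_ideal ideal_mideal assms)
    fix ka assume "ka \<in> A"
    then have "ka \<in> msum U V" using A(2) by blast
    then obtain u v where uv: "ka = u + v" "u \<in> U" "v \<in> V" by (rule msumE)
    show "germ_monomial ka \<in> ideal_prod germ_ring (mideal U) (mideal V)"
      unfolding uv(1) germ_monomial_add by (rule ideal_prod.prod) (use uv in \<open>simp_all add: germ_monomial_mem_mideal\<close>)
  qed
qed

lemma ideal_pow_mideal:
  fixes U :: "(nat ^ 'n) set"
  assumes "upset U" "finite (- U)"
  shows "ideal_pow germ_ring (mideal U) k = mideal (npow U k) \<and> finite (- npow U k)"
proof (induction k)
  case 0
  then show ?case by (simp add: ideal_pow_def nat_pow_def ideals_set_def mideal_UNIV)
next
  case (Suc k)
  have "ideal_pow germ_ring (mideal U) (Suc k) = ideal_prod germ_ring (ideal_pow germ_ring (mideal U) k) (mideal U)"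
    by (simp add: ideal_pow_def nat_pow_def ideals_set_def)
  then show ?case
    using Suc ideal_prod_mideal[of "npow U k" U] upset_msum_cofinite[of "npow U k" U] assms by simp
qed

text \<open>A germ with nonzero constant term has a convergent reciprocal series; this is why the
  ring is local.\<close>

lemma germ_unit:
  assumes "h \<in> carrier germ_ring" "taylor h 0 \<noteq> 0" "ideal Q germ_ring" "h \<in> Q"
  shows "Q = carrier germ_ring"
proof -
  obtain g where g: "g \<in> carrier germ_ring" "taylor g = inverse_coeffs (taylor h)"
    using taylor_surj[OF convergent_inverse_coeffs[OF taylor_convergent[OF assms(1)] assms(2)]] by blast
  have "h \<otimes>\<^bsub>germ_ring\<^esub> g = \<one>\<^bsub>germ_ring\<^esub>"
    unfolding germ_monomial_zero[symmetric]
    by (rule taylor_inj) (use assms g in \<open>auto simp: taylor_mult cauchy_prod_inverse_coeffs\<close>)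
  moreover have "h \<otimes>\<^bsub>germ_ring\<^esub> g \<in> Q" by (rule ideal.I_r_closed[OF assms(3,4) g(1)])
  ultimately show ?thesis using ideal.one_imp_carrier[OF assms(3)] by simp
qed

lemma mm_1_eq: "k \<in> mm 1 \<longleftrightarrow> k \<noteq> 0"
  using deg_eq_0_iff[of k] by (auto simp: mm_def Suc_le_eq)

lemma mem_mideal_mm_1: "h \<in> mideal (mm 1) \<longleftrightarrow> h \<in> carrier germ_ring \<and> taylor h 0 = 0"
  unfolding mideal_def mem_Collect_eq mm_1_eq by blast

lemma max_ideal_germ_ring: "max_ideal (germ_ring :: ('n :: finite) germ ring) = mideal (mm 1)"
  unfolding max_ideal_def
proof (rule the_equality)
  have ne: "\<one>\<^bsub>germ_ring\<^esub> \<notin> mideal (mm 1 :: (nat ^ 'n) set)"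
    unfolding germ_monomial_zero[symmetric] germ_monomial_mem_mideal mm_1_eq by simp
  show m: "maximalideal (mideal (mm 1)) (germ_ring :: ('n :: finite) germ ring)"
  proof (rule maximalidealI)
    show "ideal (mideal (mm 1)) (germ_ring :: ('n :: finite) germ ring)" by (simp add: ideal_mideal)
    show "carrier germ_ring \<noteq> mideal (mm 1 :: (nat ^ 'n) set)" using ne germ.one_closed by metis
    fix Q assume Q: "ideal Q (germ_ring :: ('n :: finite) germ ring)" "mideal (mm 1) \<subseteq> Q" "Q \<subseteq> carrier germ_ring"
    show "Q = mideal (mm 1) \<or> Q = carrier germ_ring"
    proof (cases "Q \<subseteq> mideal (mm 1)")
      case False
      then obtain h where h: "h \<in> Q" "h \<notin> mideal (mm 1)" by blast
      then have "h \<in> carrier germ_ring" "taylor h 0 \<noteq> 0" using Q(3) mem_mideal_mm_1 by blast+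
      then show ?thesis using germ_unit Q(1) h(1) by blast
    qed (use Q in auto)
  qed
  fix M assume M: "maximalideal M (germ_ring :: ('n :: finite) germ ring)"
  then have idM: "ideal M germ_ring" by (simp add: maximalideal.axioms)
  have Mc: "M \<subseteq> carrier germ_ring" using ideal.Icarr[OF idM] by blast
  have "M \<subseteq> mideal (mm 1)"
  proof
    fix h assume h: "h \<in> M"
    then have "taylor h 0 = 0" using germ_unit[OF _ _ idM h] Mc maximalideal.I_notcarr[OF M] by blast
    then show "h \<in> mideal (mm 1)" using h Mc mem_mideal_mm_1 by blast
  qed
  moreover have "ideal (mideal (mm 1)) (germ_ring :: ('n :: finite) germ ring)" by (simp add: ideal_mideal)
  moreover have "mideal (mm 1 :: (nat ^ 'n) set) \<subseteq> carrier germ_ring" by (auto simp: mideal_def)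
  ultimately have "mideal (mm 1) = M \<or> mideal (mm 1 :: (nat ^ 'n) set) = carrier germ_ring"
    by (intro maximalideal.I_maximal[OF M])
  moreover have "mideal (mm 1 :: (nat ^ 'n) set) \<noteq> carrier germ_ring" using ne germ.one_closed by auto
  ultimately show "M = mideal (mm 1)" by simp
qed

lemma mideal_psubset_iff: "mideal U \<subset> mideal V \<longleftrightarrow> U \<subset> V"
  by (simp only: less_le_not_le mideal_subset_iff)

section \<open>Colengths\<close>

text \<open>A chain of ideals above \<open>Q\<close> maps to the quotient; it stays strict because
  an ideal containing \<open>Q\<close> is a union of cosets of \<open>Q\<close>.\<close>

lemma (in ring) colength_ge:
  assumes Q: "ideal Q R" and D: "\<And>j. j \<le> k \<Longrightarrow> ideal (D j) R" "Q \<subseteq> D 0" "\<And>j. j < k \<Longrightarrow> D j \<subset> D (Suc j)"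
  shows "enat k \<le> colength R Q"
  unfolding colength_def ring_length_def
proof (rule Sup_upper, intro CollectI exI conjI allI impI)
  show "enat k = enat k" ..
  show "ideal ((+>) Q ` D j) (R Quot Q)" if "j \<le> k" for j
    by (rule ring_ideal_imp_quot_ideal[OF Q D(1)[OF that]])
  fix j assume j: "j < k"
  have Qj: "Q \<subseteq> D j" using j
  proof (induction j)
    case (Suc j)
    then show ?case using D(3)[of j] by auto
  qed (use D(2) in simp)
  obtain x where x: "x \<in> D (Suc j)" "x \<notin> D j" using D(3)[OF j] by blast
  have "Q +> x \<notin> (+>) Q ` D j"
  proof
    assume "Q +> x \<in> (+>) Q ` D j"
    then obtain y where y: "y \<in> D j" "Q +> x = Q +> y" by blast
    have "x \<in> carrier R" using ideal.Icarr[OF D(1), of "Suc j"] x(1) j by simp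
    then have "x \<in> Q +> x"
      using additive_subgroup.zero_closed[OF ideal.axioms(1)[OF Q]] unfolding a_r_coset_def' by (intro UN_I[of \<zero>]) auto
    then have "x \<in> Q +> y" using y(2) by simp
    then obtain q where q: "q \<in> Q" "x = q \<oplus> y" by (auto simp: a_r_coset_def')
    have Dj: "ideal (D j) R" using D(1) j by simp
    have "q \<in> D j" using Qj q(1) by (rule subsetD)
    then have "x \<in> D j" unfolding q(2)
      by (rule additive_subgroup.a_closed[OF ideal.axioms(1)[OF Dj] _ y(1)])
    then show False using x(2) by simp
  qed
  then show "(+>) Q ` D j \<subset> (+>) Q ` D (Suc j)" using D(3)[OF j] x(1) by blast
qed

text \<open>Chains in the quotient are pulled back to chains of ideals above \<open>Q\<close>, with
  strictness preserved by surjectivity of the projection.\<close>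

lemma (in ring) colength_le:
  assumes Q: "ideal Q R"
    and bound: "\<And>D k. (\<And>j. j \<le> k \<Longrightarrow> ideal (D j) R \<and> Q \<subseteq> D j) \<Longrightarrow> (\<And>j. j < k \<Longrightarrow> D j \<subset> D (Suc j)) \<Longrightarrow> k \<le> N"
  shows "colength R Q \<le> enat N"
  unfolding colength_def ring_length_def
proof (rule Sup_least)
  fix e assume "e \<in> {enat k |k. \<exists>C. (\<forall>j\<le>k. ideal (C j) (R Quot Q)) \<and> (\<forall>j<k. C j \<subset> C (Suc j))}"
  then obtain k C where C: "e = enat k" "\<And>j. j \<le> k \<Longrightarrow> ideal (C j) (R Quot Q)" "\<And>j. j < k \<Longrightarrow> C j \<subset> C (Suc j)"
    by blast
  define D where "D j = {r \<in> carrier R. Q +> r \<in> C j}" for j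
  have "k \<le> N"
  proof (rule bound)
    fix j assume j: "j \<le> k"
    have "ideal (D j) R" unfolding D_def
      by (rule ring_hom_ring.ideal_vimage[OF ideal.rcos_ring_hom_ring[OF Q] C(2)[OF j]])
    moreover have "Q \<subseteq> D j"
    proof
      fix q assume q: "q \<in> Q"
      then have "Q +> q = \<zero>\<^bsub>R Quot Q\<^esub>" using a_rcos_zero[OF Q q] by (simp add: FactRing_def)
      then show "q \<in> D j"
        using additive_subgroup.zero_closed[OF ideal.axioms(1)[OF C(2)[OF j]]] ideal.Icarr[OF Q q] by (simp add: D_def)
    qed
    ultimately show "ideal (D j) R \<and> Q \<subseteq> D j" by blast
  next
    fix j assume j: "j < k"
    obtain c where c: "c \<in> C (Suc j)" "c \<notin> C j" using C(3)[OF j] by blast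
    have "c \<in> carrier (R Quot Q)" using ideal.Icarr[OF C(2)[of "Suc j"] c(1)] j by simp
    then obtain r where r: "r \<in> carrier R" "c = Q +> r" by (auto simp: FactRing_def A_RCOSETS_def')
    show "D j \<subset> D (Suc j)"
    proof
      show "D j \<subseteq> D (Suc j)" using C(3)[OF j] by (auto simp: D_def)
      have "r \<in> D (Suc j)" "r \<notin> D j" using r c by (simp_all add: D_def)
      then show "D j \<noteq> D (Suc j)" by blast
    qed
  qed
  then show "e \<le> enat N" by (simp add: C(1))
qed

text \<open>Adding a missing monomial of maximal degree keeps an upset, since all its proper
  multiples are already present.\<close>

lemma upset_chain:
  fixes U :: "(nat ^ 'n) set"
  assumes "upset U" "finite (- U)" "card (- U) = N"
  shows "\<exists>D. D 0 = U \<and> (\<forall>j\<le>N. upset (D j)) \<and> (\<forall>j<N. D j \<subset> D (Suc j))"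
  using assms
proof (induction N arbitrary: U)
  case 0
  then show ?case by (intro exI[of _ "\<lambda>_. U"]) simp
next
  case (Suc N)
  have ne: "- U \<noteq> {}" using Suc.prems(3) by auto
  have "Max (deg ` (- U)) \<in> deg ` (- U)" by (rule Max_in) (use Suc.prems ne in auto)
  then obtain ka where ka: "ka \<notin> U" "deg ka = Max (deg ` (- U))" by auto
  have big: "deg l \<le> deg ka" if "l \<notin> U" for l unfolding ka(2) by (rule Max_ge) (use Suc.prems that in auto)
  have up: "upset (insert ka U)"
    unfolding upset_def
  proof (intro ballI allI)
    fix k l assume k: "k \<in> insert ka U"
    show "k + l \<in> insert ka U"
    proof (cases "k \<in> U")
      case True
      then show ?thesis using Suc.prems(1) by (simp add: upset_def)
    next
      case False
      then have kk: "k = ka" using k by simp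
      show ?thesis
      proof (cases "l = 0")
        case False
        then have "deg ka < deg (ka + l)" using deg_eq_0_iff[of l] by simp
        then show ?thesis using big[of "ka + l"] kk by (cases "ka + l \<in> U") auto
      qed (simp add: kk)
    qed
  qed
  have c: "- insert ka U = - U - {ka}" by auto
  have "card (- insert ka U) = N" unfolding c using Suc.prems ka(1) by simp
  then obtain D where D: "D 0 = insert ka U" "\<forall>j\<le>N. upset (D j)" "\<forall>j<N. D j \<subset> D (Suc j)"
    using Suc.IH[OF up] Suc.prems(2) c by auto
  have "upset (case j of 0 \<Rightarrow> U | Suc j' \<Rightarrow> D j')" if "j \<le> Suc N" for j
    using that D(2) Suc.prems(1) by (cases j) auto
  moreover have "(case j of 0 \<Rightarrow> U | Suc j' \<Rightarrow> D j') \<subset> (case Suc j of 0 \<Rightarrow> U | Suc j' \<Rightarrow> D j')" if "j < Suc N" for j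
    using that D(1,3) ka(1) by (cases j) auto
  ultimately show ?case by (intro exI[of _ "\<lambda>j. case j of 0 \<Rightarrow> U | Suc j' \<Rightarrow> D j'"]) auto
qed

text \<open>With respect to an enumeration \<open>en\<close> of the monomials outside \<open>U\<close>, an ideal containing
  \<open>mideal U\<close> is determined among larger ideals by the indices of its leading terms.\<close>

lemma ideal_subset_if_leading_indices:
  fixes U :: "(nat ^ 'n) set" and en :: "nat \<Rightarrow> nat ^ 'n" and N :: nat
  assumes en: "- U \<subseteq> en ` {..<N}"
    and D: "ideal D germ_ring" "mideal U \<subseteq> D" and D': "ideal D' germ_ring" "D \<subseteq> D'"
    and lead: "\<And>m h. m < N \<Longrightarrow> h \<in> D' \<Longrightarrow> taylor h (en m) \<noteq> 0 \<Longrightarrow> (\<And>l. m < l \<Longrightarrow> l < N \<Longrightarrow> taylor h (en l) = 0) \<Longrightarrow>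
        \<exists>g\<in>D. taylor g (en m) \<noteq> 0 \<and> (\<forall>l. m < l \<and> l < N \<longrightarrow> taylor g (en l) = 0)"
  shows "D' \<subseteq> D"
proof -
  have carD: "h \<in> carrier germ_ring" if "h \<in> D'" for h using ideal.Icarr[OF D'(1) that] .
  have main: "h \<in> D" if "h \<in> D'" "M \<le> N" "\<And>l. M \<le> l \<Longrightarrow> l < N \<Longrightarrow> taylor h (en l) = 0" for M h
    using that
  proof (induction M arbitrary: h)
    case 0
    have "k \<in> U" if "taylor h k \<noteq> 0" for k
    proof (rule ccontr)
      assume "k \<notin> U"
      then obtain l where "l < N" "k = en l" using en by auto
      then show False using 0(3)[of l] that by simp
    qed
    then have "h \<in> mideal U" using carD[OF 0(1)] by (auto simp: mideal_def)
    then show ?case using D(2) by blast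
  next
    case (Suc M)
    show ?case
    proof (cases "taylor h (en M) = 0")
      case True
      have "taylor h (en l) = 0" if "M \<le> l" "l < N" for l using True Suc.prems(3)[of l] that by (cases "l = M") auto
      then show ?thesis using Suc.IH[of h] Suc.prems by simp
    next
      case False
      have "\<exists>g\<in>D. taylor g (en M) \<noteq> 0 \<and> (\<forall>l. M < l \<and> l < N \<longrightarrow> taylor g (en l) = 0)"
        by (rule lead[of M h]) (use Suc.prems False in auto)
      then obtain g where g: "g \<in> D" "taylor g (en M) \<noteq> 0" "\<And>l. M < l \<Longrightarrow> l < N \<Longrightarrow> taylor g (en l) = 0" by blast
      have gc: "g \<in> carrier germ_ring" using carD g(1) D'(2) by blast
      have hc: "h \<in> carrier germ_ring" using carD Suc.prems(1) .
      \<comment> \<open>Subtracting \<open>c\<close> times \<open>g\<close> cancels the coefficient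
        at \<open>en M\<close> without creating later ones; \<open>u\<close> and \<open>w\<close>
        provide the multiples by \<open>- c\<close> and \<open>c\<close>, the second to restore
        \<open>h\<close> from \<open>h'\<close>.\<close>
      define c where "c = taylor h (en M) / taylor g (en M)"
      obtain u where u: "u \<in> carrier germ_ring" "taylor (u \<otimes>\<^bsub>germ_ring\<^esub> g) = (\<lambda>k. - c * taylor g k)"
        using germ_scalar[OF gc] .
      obtain w where w: "w \<in> carrier germ_ring" "taylor (w \<otimes>\<^bsub>germ_ring\<^esub> g) = (\<lambda>k. c * taylor g k)"
        using germ_scalar[OF gc] .
      have ug: "u \<otimes>\<^bsub>germ_ring\<^esub> g \<in> D" by (rule ideal.I_l_closed[OF D(1) g(1) u(1)])
      have wg: "w \<otimes>\<^bsub>germ_ring\<^esub> g \<in> D" by (rule ideal.I_l_closed[OF D(1) g(1) w(1)])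
      define h' where "h' = h \<oplus>\<^bsub>germ_ring\<^esub> (u \<otimes>\<^bsub>germ_ring\<^esub> g)"
      have t: "taylor h' k = taylor h k - c * taylor g k" for k
        unfolding h'_def using hc u gc by (simp add: taylor_add)
      have "h' \<in> D'" unfolding h'_def
        using additive_subgroup.a_closed[OF ideal.axioms(1)[OF D'(1)]] Suc.prems(1) ug D'(2) by blast
      moreover have "taylor h' (en l) = 0" if "M \<le> l" "l < N" for l
        using that g Suc.prems(3)[of l] by (cases "l = M") (auto simp: t c_def)
      ultimately have h'D: "h' \<in> D" using Suc.IH[of h'] Suc.prems(2) by simp
      have "h = h' \<oplus>\<^bsub>germ_ring\<^esub> (w \<otimes>\<^bsub>germ_ring\<^esub> g)"
      proof (rule taylor_inj)
        have "h' \<in> carrier germ_ring" unfolding h'_def using hc u gc by simp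
        then show "taylor h = taylor (h' \<oplus>\<^bsub>germ_ring\<^esub> (w \<otimes>\<^bsub>germ_ring\<^esub> g))"
          using w gc by (simp add: taylor_add t fun_eq_iff)
      qed (use hc u w gc h'_def in auto)
      then show ?thesis using additive_subgroup.a_closed[OF ideal.axioms(1)[OF D(1)] h'D wg] by simp
    qed
  qed
  show ?thesis
  proof
    fix h assume "h \<in> D'"
    then show "h \<in> D" by (rule main[where M = N]) auto
  qed
qed

text \<open>Along any chain above \<open>mideal U\<close> the set of leading indices grows strictly
  inside \<open>N\<close> elements, which bounds the length. Adding the missing monomials one at a
  time gives a chain of length \<open>N\<close>.\<close>

lemma colength_mideal:
  fixes U :: "(nat ^ 'n) set"
  assumes "upset U" "finite (- U)"
  shows "colength germ_ring (mideal U) = enat (card (- U))"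
proof (rule antisym)
  define N where "N = card (- U)"
  obtain en where en: "bij_betw en {..<N} (- U)"
    using ex_bij_betw_nat_finite[OF assms(2)] by (auto simp: N_def atLeast0LessThan)
  show "colength germ_ring (mideal U) \<le> enat (card (- U))"
    unfolding N_def[symmetric]
  proof (rule germ.colength_le[OF ideal_mideal[OF assms(1)]])
    fix D :: "nat \<Rightarrow> 'n germ set" and k
    assume D: "\<And>j. j \<le> k \<Longrightarrow> ideal (D j) germ_ring \<and> mideal U \<subseteq> D j" "\<And>j. j < k \<Longrightarrow> D j \<subset> D (Suc j)"
    define L where "L j = {m. m < N \<and> (\<exists>h\<in>D j. taylor h (en m) \<noteq> 0 \<and> (\<forall>l. m < l \<and> l < N \<longrightarrow> taylor h (en l) = 0))}" for j
    have step: "L j \<subset> L (Suc j)" if j: "j < k" for j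
    proof
      have sub: "D j \<subseteq> D (Suc j)" using D(2)[OF j] by blast
      show "L j \<subseteq> L (Suc j)" using sub by (auto simp: L_def)
      show "L j \<noteq> L (Suc j)"
      proof
        assume eq: "L j = L (Suc j)"
        have "D (Suc j) \<subseteq> D j"
        proof (rule ideal_subset_if_leading_indices[of U en N])
          show "- U \<subseteq> en ` {..<N}" using en by (auto simp: bij_betw_def)
          fix m h assume "m < N" "h \<in> D (Suc j)" "taylor h (en m) \<noteq> 0" "\<And>l. m < l \<Longrightarrow> l < N \<Longrightarrow> taylor h (en l) = 0"
          then have "m \<in> L (Suc j)" by (auto simp: L_def)
          then have "m \<in> L j" using eq by simp
          then show "\<exists>g\<in>D j. taylor g (en m) \<noteq> 0 \<and> (\<forall>l. m < l \<and> l < N \<longrightarrow> taylor g (en l) = 0)"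
            by (simp add: L_def)
        qed (use D(1)[of j] D(1)[of "Suc j"] j sub in auto)
        then show False using D(2)[OF j] by blast
      qed
    qed
    have finL: "finite (L j)" for j by (rule finite_subset[of _ "{..<N}"]) (auto simp: L_def)
    have "j \<le> card (L j)" if "j \<le> k" for j
      using that
    proof (induction j)
      case (Suc j)
      then have "card (L j) < card (L (Suc j))" by (intro psubset_card_mono finL step) simp
      then show ?case using Suc by simp
    qed simp
    then have "k \<le> card (L k)" by simp
    also have "\<dots> \<le> card {..<N}" by (intro card_mono) (auto simp: L_def)
    finally show "k \<le> N" by simp
  qed
  obtain D where D: "D 0 = U" "\<forall>j\<le>N. upset (D j)" "\<forall>j<N. D j \<subset> D (Suc j)"
    using upset_chain[OF assms N_def[symmetric]] by (elim exE conjE)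
  show "enat (card (- U)) \<le> colength germ_ring (mideal U)"
    unfolding N_def[symmetric]
  proof (rule germ.colength_ge[of _ N "\<lambda>j. mideal (D j)"])
    show "mideal (D j) \<subset> mideal (D (Suc j))" if "j < N" for j
      unfolding mideal_psubset_iff using D(3) that by blast
    show "ideal (mideal (D j)) germ_ring" if "j \<le> N" for j using D(2) that ideal_mideal by blast
  qed (simp_all add: D(1) ideal_mideal assms(1))
qed

text \<open>If infinitely many monomials were missing, there would be missing ones in every degree,
  and the upsets \<open>U \<union> mm t\<close> would give chains of any length above
  \<open>Q\<close>.\<close>

lemma finite_Compl_if_finite_colength:
  fixes U :: "(nat ^ 'n) set"
  assumes "upset U" "ideal Q germ_ring" "Q \<subseteq> mideal U" "finite_colength germ_ring Q"
  shows "finite (- U)"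
proof (rule ccontr)
  assume inf: "infinite (- U)"
  have ex: "\<exists>l. l \<notin> U \<and> deg l = t" for t
  proof -
    have "\<not> - U \<subseteq> {k. deg k < t}" using inf finite_subset[OF _ card_deg_less(1)] by blast
    then obtain k where "k \<notin> U" "\<not> deg k < t" by blast
    then have k: "k \<notin> U" "t \<le> deg k" by simp_all
    then obtain l m where "k = l + m" "deg l = t" using exists_le_deg_eq[of t k] by auto
    then show ?thesis using k(1) assms(1) by (auto simp: upset_def)
  qed
  have ge: "enat k \<le> colength germ_ring Q" for k
  proof (rule germ.colength_ge[OF assms(2), of k "\<lambda>j. mideal (U \<union> mm (k - j))"])
    show "ideal (mideal (U \<union> mm (k - j))) germ_ring" for j by (intro ideal_mideal upset_Un assms upset_mm)
    show "Q \<subseteq> mideal (U \<union> mm (k - 0))" using assms(3) mideal_mono[of U "U \<union> mm (k - 0)"] by auto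
    fix j assume "j < k"
    then have kj: "k - j = Suc (k - Suc j)" by simp
    obtain l where l: "l \<notin> U" "deg l = k - Suc j" using ex by blast
    have "U \<union> mm (k - j) \<subset> U \<union> mm (k - Suc j)"
    proof
      show "U \<union> mm (k - j) \<subseteq> U \<union> mm (k - Suc j)" using mm_antimono[OF diff_le_mono2[of j "Suc j" k]] by auto
      show "U \<union> mm (k - j) \<noteq> U \<union> mm (k - Suc j)"
        using l unfolding kj by (auto simp: set_eq_iff mm_def intro!: exI[of _ l])
    qed
    then show "mideal (U \<union> mm (k - j)) \<subset> mideal (U \<union> mm (k - Suc j))"
      by (simp only: mideal_psubset_iff)
  qed
  then have "colength germ_ring Q = \<infinity>"
  proof (cases "colength germ_ring Q")
    case (enat m)
    then show ?thesis using ge[of "Suc m"] by simp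
  qed
  then show False using assms(4) by (simp add: finite_colength_def)
qed

text \<open>The order matters: the inclusion of \<open>I\<close> in \<open>mideal U\<close> and
  finite colength make the complement of \<open>U\<close> finite, and only then is \<open>U\<close>
  covered by finitely many generators, as the reverse inclusion needs.\<close>

lemma monomial_ideal_eq_mideal:
  fixes I :: "('n :: finite) germ set"
  assumes "ideal I germ_ring" "I \<noteq> carrier germ_ring" "monomial_ideal I" "finite_colength germ_ring I"
  obtains U where "upset U" "finite (- U)" "I = mideal U" "U \<subseteq> mm 1"
proof -
  obtain K where K: "I = Idl\<^bsub>germ_ring\<^esub> ((\<lambda>k. germ_of (monomial_fun k)) ` K)" using assms(3) by (auto simp: monomial_ideal_def)
  then have K: "I = Idl\<^bsub>germ_ring\<^esub> (germ_monomial ` K)" by (simp add: germ_monomial_def[abs_def])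
  define U where "U = {k + l | k l. k \<in> K}"
  have up: "upset U" unfolding upset_def
  proof (intro ballI allI)
    fix u l assume "u \<in> U"
    then obtain k m where "u = k + m" "k \<in> K" by (auto simp: U_def)
    then have "u + l = k + (m + l)" "k \<in> K" by (simp_all add: add.assoc)
    then show "u + l \<in> U" unfolding U_def by blast
  qed
  have KU: "K \<subseteq> U" 
  proof
    fix k assume "k \<in> K"
    moreover have "k = k + 0" by simp
    ultimately show "k \<in> U" unfolding U_def by blast
  qed
  have sub: "I \<subseteq> mideal U" unfolding K
    by (rule germ.genideal_minimal[OF ideal_mideal[OF up]]) (use KU in \<open>auto simp: germ_monomial_mem_mideal\<close>)
  have fin: "finite (- U)" by (rule finite_Compl_if_finite_colength[OF up assms(1) sub assms(4)])
  obtain A where A: "finite A" "A \<subseteq> U" "\<And>k. k \<in> U \<Longrightarrow> \<exists>ka\<in>A. ka \<le> k"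
    using cofinite_generators[OF up fin] by blast
  have "mideal U \<subseteq> I"
  proof (rule mideal_subset_ideal[OF assms(1) A(1) _ A(3)])
    fix ka assume "ka \<in> A"
    then obtain k l where kl: "ka = k + l" "k \<in> K" using A(2) by (auto simp: U_def)
    have "germ_monomial ` K \<subseteq> I" unfolding K by (rule germ.genideal_self) auto
    then show "germ_monomial ka \<in> I" unfolding kl(1) germ_monomial_add using kl(2)
      by (intro ideal.I_r_closed[OF assms(1)]) auto
  qed
  then have eq: "I = mideal U" using sub by blast
  have "0 \<notin> U"
  proof
    assume "0 \<in> U"
    then have "k \<in> U" for k using upsetD(1)[OF up, of 0 k] by simp
    then have "U = UNIV" by blast
    then show False using eq assms(2) by (simp add: mideal_UNIV)
  qed
  then have "k \<in> mm 1" if "k \<in> U" for k unfolding mm_1_eq using that by auto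
  then have "U \<subseteq> mm 1" by blast
  then show ?thesis using that up fin eq by blast
qed

section \<open>Relative Lojasiewicz exponents of monomial ideals\<close>

lemma foldr_msum_const:
  assumes "\<And>j. j \<in> set js \<Longrightarrow> V j = J" "upset J" "upset X"
  shows "foldr (\<lambda>j X. msum (npow (V j) (r j)) X) js X = msum (npow J (\<Sum>j\<leftarrow>js. r j)) X"
  using assms(1)
proof (induction js)
  case (Cons j js)
  then show ?case using assms by (simp add: msum_assoc[symmetric] npow_add)
qed (use assms in simp)

lemma ideal_power_prod_mideal:
  fixes V :: "nat \<Rightarrow> (nat ^ 'n) set"
  assumes "\<And>j. j < length Is \<Longrightarrow> Is ! j = mideal (V j) \<and> upset (V j) \<and> finite (- V j)"
  shows "ideal_power_prod germ_ring Is r = mideal (foldr (\<lambda>j X. msum (npow (V j) (r j)) X) [0..<length Is] UNIV)"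
proof -
  have main: "foldr (\<lambda>j X. ideal_prod germ_ring (ideal_pow germ_ring (Is ! j) (r j)) X) js (carrier germ_ring)
      = mideal (foldr (\<lambda>j X. msum (npow (V j) (r j)) X) js UNIV)
      \<and> upset (foldr (\<lambda>j X. msum (npow (V j) (r j)) X) js UNIV) \<and> finite (- foldr (\<lambda>j X. msum (npow (V j) (r j)) X) js UNIV)"
    if "set js \<subseteq> {..<length Is}" for js
    using that
  proof (induction js)
    case (Cons j js)
    have j: "Is ! j = mideal (V j)" "upset (V j)" "finite (- V j)" using assms[of j] Cons.prems by auto
    define X where "X = foldr (\<lambda>j X. msum (npow (V j) (r j)) X) js UNIV"
    have X: "upset X" "finite (- X)" using Cons by (auto simp: X_def)
    have "ideal_prod germ_ring (ideal_pow germ_ring (Is ! j) (r j)) (mideal X) = mideal (msum (npow (V j) (r j)) X)"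
      using ideal_pow_mideal[OF j(2,3), of "r j"] ideal_prod_mideal[OF upset_npow[OF j(2)] _ X, of "r j"] j(1) by simp
    then show ?case
      using Cons upset_msum[OF X(1)] upset_msum_cofinite[OF upset_npow[OF j(2)] _ X, of "r j"] ideal_pow_mideal[OF j(2,3), of "r j"]
      by (simp add: X_def)
  qed (simp add: mideal_UNIV)
  show ?thesis unfolding ideal_power_prod_def using main[of "[0..<length Is]"] by (simp add: atLeast0LessThan)
qed

lemma mixed_mult_mideal:
  fixes J :: "(nat ^ 'n) set"
  assumes up: "upset J" and fin: "finite (- J)" and J: "t = 0 \<or> J \<subseteq> mm 1" and i: "1 \<le> i" "i \<le> CARD('n)"
  shows "mixed_mult germ_ring (replicate i (mideal J) @ replicate (CARD('n) - i) (mideal (mm t))) = of_nat (hlead J t i)"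
proof (rule mixed_mult_eq_hlead[OF up fin J _ i])
  let ?Is = "replicate i (mideal J) @ replicate (CARD('n) - i) (mideal (mm t))"
  show len: "length ?Is = CARD('n)" using i by simp
  fix r :: "nat \<Rightarrow> nat"
  define V where "V j = (if j < i then J else mm t)" for j
  have "ideal_power_prod germ_ring ?Is r = mideal (foldr (\<lambda>j X. msum (npow (V j) (r j)) X) [0..<length ?Is] UNIV)"
    by (rule ideal_power_prod_mideal) (use up fin finite_Compl_mm in \<open>auto simp: V_def nth_append\<close>)
  also have "[0..<length ?Is] = [0..<i] @ [i..<CARD('n)]" unfolding len using i upt_add_eq_append[of 0 i "CARD('n) - i"] by simp
  also have "foldr (\<lambda>j X. msum (npow (V j) (r j)) X) ([0..<i] @ [i..<CARD('n)]) UNIV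
     = foldr (\<lambda>j X. msum (npow (V j) (r j)) X) [0..<i] (foldr (\<lambda>j X. msum (npow (V j) (r j)) X) [i..<CARD('n)] UNIV)" by simp
  also have "foldr (\<lambda>j X. msum (npow (V j) (r j)) X) [i..<CARD('n)] UNIV = msum (npow (mm t) (\<Sum>j\<leftarrow>[i..<CARD('n)]. r j)) UNIV"
    by (rule foldr_msum_const) (auto simp: V_def)
  also have "\<dots> = mm (t * (\<Sum>j=i..<CARD('n). r j))" by (simp add: npow_mm interv_sum_list_conv_sum_set_nat)
  also have "foldr (\<lambda>j X. msum (npow (V j) (r j)) X) [0..<i] (mm (t * (\<Sum>j=i..<CARD('n). r j)))
     = msum (npow J (\<Sum>j\<leftarrow>[0..<i]. r j)) (mm (t * (\<Sum>j=i..<CARD('n). r j)))"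
    by (rule foldr_msum_const) (auto simp: V_def up)
  also have "(\<Sum>j\<leftarrow>[0..<i]. r j) = (\<Sum>j<i. r j)" by (simp add: interv_sum_list_conv_sum_set_nat atLeast0LessThan)
  finally show "colength germ_ring (ideal_power_prod germ_ring ?Is r)
      = enat (card (- msum (npow J (\<Sum>j<i. r j)) (mm (t * (\<Sum>j=i..<CARD('n). r j)))))"
    using colength_mideal[OF upset_msum[OF upset_mm] finite_Compl_msum_npow[OF up fin]] by simp
qed

lemma npow_multiple:
  assumes "k \<in> U" "\<And>w. w \<in> W \<Longrightarrow> k $ w = 0"
  shows "\<exists>l\<in>npow U s. (\<forall>w\<in>W. l $ w = 0) \<and> deg l = s * deg k"
proof (induction s)
  case 0
  then show ?case by (intro bexI[of _ 0]) auto
next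
  case (Suc s)
  then obtain l where l: "l \<in> npow U s" "\<forall>w\<in>W. l $ w = 0" "deg l = s * deg k" by blast
  then show ?case using assms by (intro bexI[of _ "l + k"]) (auto intro: msumI)
qed

text \<open>The power \<open>r\<close> is added to the copies of \<open>mm s\<close> as well. For
  \<open>r \<ge> s\<close> it leaves them unchanged and \<open>hlead_eq_iff\<close> decides; for
  \<open>r < s\<close> equality has to be excluded by other means.\<close>

lemma r0_mideal:
  fixes U :: "(nat ^ 'n) set"
  assumes up: "upset U" and fin: "finite (- U)" and U1: "U \<subseteq> mm 1" and i: "1 \<le> i" "i \<le> CARD('n)" and s: "1 \<le> s"
    and M1: "\<And>W. card W < i \<Longrightarrow> \<exists>k\<in>U. (\<forall>w\<in>W. k $ w = 0) \<and> deg k \<le> M"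
    and M2: "card W0 < i" "\<And>k. k \<in> U \<Longrightarrow> (\<forall>w\<in>W0. k $ w = 0) \<Longrightarrow> M \<le> deg k"
  shows "r0 germ_ring (map (\<lambda>I. ideal_pow germ_ring I s)
     (replicate i (mideal U) @ replicate (CARD('n) - i) (max_ideal germ_ring))) = s * M"
proof -
  define J where "J = npow U s"
  have upJ: "upset J" and finJ: "finite (- J)" using up ideal_pow_mideal[OF up fin, of s] by (auto simp: J_def)
  have Js: "J \<subseteq> mm s" unfolding J_def using npow_mono[OF U1, of s] by (simp add: npow_mm)
  then have J1: "J \<subseteq> mm 1" using mm_antimono[OF s] by blast
  have M: "1 \<le> M"
  proof -
    obtain k where "k \<in> U" "deg k \<le> M" using M1[OF M2(1)] by blast
    then show ?thesis using U1 by (auto simp: mm_def)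
  qed
  have pm: "ideal_pow germ_ring (mideal (mm 1 :: (nat ^ 'n) set)) a = mideal (mm a)" for a
    using ideal_pow_mideal[OF upset_mm finite_Compl_mm[of 1, where 'n = 'n], of a] by (simp add: npow_mm)
  have am: "mideal (mm a) <+>\<^bsub>germ_ring\<^esub> mideal (mm b) = mideal (mm a \<union> mm b :: (nat ^ 'n) set)" for a b
    by (intro set_add_mideal upset_mm finite_Compl_mm)
  have Is: "map (\<lambda>I. ideal_pow germ_ring I s) (replicate i (mideal U) @ replicate (CARD('n) - i) (max_ideal germ_ring))
     = replicate i (mideal J) @ replicate (CARD('n) - i) (mideal (mm s))"
    using ideal_pow_mideal[OF up fin, of s]
    by (simp add: max_ideal_germ_ring pm J_def map_replicate del: One_nat_def)
  have Ir: "map (\<lambda>I. I <+>\<^bsub>germ_ring\<^esub> ideal_pow germ_ring (max_ideal germ_ring) r) (replicate i (mideal J) @ replicate (CARD('n) - i) (mideal (mm s)))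
     = replicate i (mideal (J \<union> mm r)) @ replicate (CARD('n) - i) (mideal (mm s \<union> mm r))" for r
    using set_add_mideal[OF upJ finJ upset_mm finite_Compl_mm, of r]
    by (simp add: max_ideal_germ_ring pm am map_replicate del: One_nat_def)
  have e: "mixed_mult germ_ring (replicate i (mideal J) @ replicate (CARD('n) - i) (mideal (mm s))) = of_nat (hlead J s i)"
    by (rule mixed_mult_mideal[OF upJ finJ _ i]) (use J1 in simp)
  have er: "mixed_mult germ_ring (replicate i (mideal J) @ replicate (CARD('n) - i) (mideal (mm s)))
     = mixed_mult germ_ring (replicate i (mideal (J \<union> mm r)) @ replicate (CARD('n) - i) (mideal (mm s \<union> mm r)))
     \<longleftrightarrow> s * M \<le> r" for r
  proof (cases "r < s")
    case True
    \<comment> \<open>Here \<open>mm r\<close> swallows both \<open>J\<close> and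
      \<open>mm s\<close>, so all the ideals coincide and their multiplicity is strictly below that
      for \<open>mm s\<close>, hence below that for \<open>J\<close>. The unit ideal,
      \<open>r = 0\<close>, is included.\<close>
    then have eq: "J \<union> mm r = mm r" "mm s \<union> mm r = (mm r :: (nat ^ 'n) set)" using Js mm_antimono[of r s] by auto
    have "mixed_mult germ_ring (replicate i (mideal (mm r :: (nat ^ 'n) set)) @ replicate (CARD('n) - i) (mideal (mm r))) = of_nat (hlead (mm r :: (nat ^ 'n) set) r i)"
      by (rule mixed_mult_mideal[OF upset_mm finite_Compl_mm _ i]) (use mm_antimono[of 1 r] in \<open>cases r; auto\<close>)
    moreover have "hlead (mm r :: (nat ^ 'n) set) r i < hlead (mm s :: (nat ^ 'n) set) s i" by (rule hlead_mm_less[OF True i(2)])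
    moreover have "hlead (mm s :: (nat ^ 'n) set) s i \<le> hlead J s i" by (rule hlead_mono[OF upJ finJ upset_mm Js i(2)])
    moreover have "\<not> s * M \<le> r" using mult_le_mono2[OF M, of s] True by linarith
    ultimately show ?thesis using e by (simp add: eq)
  next
    case False
    then have eq: "mm s \<union> mm r = (mm s :: (nat ^ 'n) set)" using mm_antimono[of s r] by auto
    have "J \<union> mm r \<subseteq> mm 1" using J1 mm_antimono[of 1 r] False s by auto
    then have "mixed_mult germ_ring (replicate i (mideal (J \<union> mm r)) @ replicate (CARD('n) - i) (mideal (mm s))) = of_nat (hlead (J \<union> mm r) s i)"
      by (intro mixed_mult_mideal upset_Un upJ upset_mm i finite_subset[OF _ finJ]) auto
    then have "?thesis \<longleftrightarrow> (hlead J s i = hlead (J \<union> mm r) s i \<longleftrightarrow> s * M \<le> r)" using e by (simp add: eq)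
    moreover have "hlead J s i = hlead (J \<union> mm r) s i \<longleftrightarrow> (\<forall>W. card W < i \<longrightarrow> (\<exists>ka\<in>J. (\<forall>w\<in>W. ka $ w = 0) \<and> deg ka \<le> r))"
      by (rule hlead_eq_iff[OF upJ finJ s i]) (use False s in simp)
    moreover have "(\<forall>W. card W < i \<longrightarrow> (\<exists>ka\<in>J. (\<forall>w\<in>W. ka $ w = 0) \<and> deg ka \<le> r)) \<longleftrightarrow> s * M \<le> r"
    proof
      assume "\<forall>W. card W < i \<longrightarrow> (\<exists>ka\<in>J. (\<forall>w\<in>W. ka $ w = 0) \<and> deg ka \<le> r)"
      then obtain ka where ka: "ka \<in> J" "\<forall>w\<in>W0. ka $ w = 0" "deg ka \<le> r" using M2(1) by blast
      \<comment> \<open>Elements of \<open>U\<close> vanishing on \<open>W0\<close> have degree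
        above \<open>M - 1\<close>, and the sum over \<open>W0\<close> is zero for
        \<open>ka\<close>.\<close>
      have "s * Suc (M - 1) \<le> deg ka + (\<Sum>w\<in>W0. ka $ w) * Suc (M - 1)"
        by (rule npow_deg_lower[where J = U]) (use M2(2) M ka(1) in \<open>force simp: J_def\<close>)+
      then show "s * M \<le> r" using ka M by simp
    next
      assume le: "s * M \<le> r"
      show "\<forall>W. card W < i \<longrightarrow> (\<exists>ka\<in>J. (\<forall>w\<in>W. ka $ w = 0) \<and> deg ka \<le> r)"
      proof (intro allI impI)
        fix W :: "'n set" assume "card W < i"
        then obtain k where k: "k \<in> U" "\<forall>w\<in>W. k $ w = 0" "deg k \<le> M" using M1 by blast
        obtain l where l: "l \<in> J" "\<forall>w\<in>W. l $ w = 0" "deg l = s * deg k"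
          using npow_multiple[of k U W s] k(1,2) by (auto simp: J_def)
        have "deg l \<le> r" using l(3) le mult_le_mono2[OF k(3), of s] by linarith
        then show "\<exists>ka\<in>J. (\<forall>w\<in>W. ka $ w = 0) \<and> deg ka \<le> r" using l by blast
      qed
    qed
    ultimately show ?thesis by blast
  qed
  show ?thesis unfolding r0_def Is Ir er by (rule Least_equality) auto
qed

section \<open>Newton polyhedra of monomial ideals\<close>

definition upset_polyhedron :: "(nat ^ 'n) set \<Rightarrow> (real ^ 'n) set" where
  "upset_polyhedron U = convex hull {exponent_vec k + u | k u. k \<in> U \<and> (\<forall>j. 0 \<le> u $ j)}"

lemma exponent_vec_add: "exponent_vec (k + l) = exponent_vec k + exponent_vec l"
  by (simp add: exponent_vec_def vec_eq_iff)

lemma newton_germ_subset: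
  assumes "g \<in> mideal U"
  shows "newton_germ g \<subseteq> upset_polyhedron U"
  unfolding newton_germ_def upset_polyhedron_def
  by (rule hull_mono) (use assms in \<open>auto simp: mideal_def\<close>)

text \<open>A minimal exponent of \<open>U\<close> must occur in some member of any generating
  system: otherwise the generated ideal would miss its monomial. So every system yields all vertices
  of the polyhedron, which makes the definite description in \<open>newton_polyhedron\<close>
  well-defined.\<close>

lemma hull_newton_germ:
  fixes U :: "(nat ^ 'n) set"
  assumes up: "upset U" and G: "G \<subseteq> carrier germ_ring" "mideal U = Idl\<^bsub>germ_ring\<^esub> G"
  shows "convex hull (\<Union>g\<in>G. newton_germ g) = upset_polyhedron U"
proof (rule antisym)
  have GU: "G \<subseteq> mideal U" unfolding G(2) by (rule germ.genideal_self[OF G(1)])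
  show "convex hull (\<Union>g\<in>G. newton_germ g) \<subseteq> upset_polyhedron U"
  proof (rule hull_minimal)
    show "(\<Union>g\<in>G. newton_germ g) \<subseteq> upset_polyhedron U" using GU newton_germ_subset by blast
  qed (simp add: upset_polyhedron_def convex_convex_hull)
  show "upset_polyhedron U \<subseteq> convex hull (\<Union>g\<in>G. newton_germ g)"
    unfolding upset_polyhedron_def
  proof (rule hull_minimal[OF subsetI])
    fix x assume "x \<in> {exponent_vec k + u | k u. k \<in> U \<and> (\<forall>j. 0 \<le> u $ j)}"
    then obtain k u where x: "x = exponent_vec k + u" "k \<in> U" "\<And>j. 0 \<le> u $ j" by blast
    define d where "d = (LEAST d. \<exists>l\<in>U. l \<le> k \<and> deg l = d)"
    have "\<exists>l\<in>U. l \<le> k \<and> deg l = d" unfolding d_def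
      by (rule LeastI[of _ "deg k"]) (use x in \<open>auto simp: less_eq_vec_def\<close>)
    then obtain ka where ka: "ka \<in> U" "ka \<le> k" "deg ka = d" by blast
    have min: "d \<le> deg l" if "l \<in> U" "l \<le> k" for l unfolding d_def by (rule Least_le) (use that in auto)
    have "\<exists>g\<in>G. taylor g ka \<noteq> 0"
    proof (rule ccontr)
      assume no: "\<not> (\<exists>g\<in>G. taylor g ka \<noteq> 0)"
      \<comment> \<open>\<open>ka\<close> has least degree among the elements of \<open>U\<close>
        below \<open>k\<close>, hence is minimal in \<open>U\<close>, and removing it leaves an
        upset.\<close>
      have up': "upset (U - {ka})"
        unfolding upset_def
      proof (intro ballI allI)
        fix l m assume l: "l \<in> U - {ka}"
        have "l + m \<noteq> ka"
        proof
          assume e: "l + m = ka"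
          then have "l + m \<le> k" using ka(2) by simp
          then have "l \<le> k" unfolding less_eq_vec_def using add_leD1 by fastforce
          then have "d \<le> deg l" using min l by blast
          moreover have "deg l + deg m = d" using e ka(3) by auto
          ultimately have "deg m = 0" by linarith
          then have "m = 0" by (simp only: deg_eq_0_iff)
          then show False using e l by simp
        qed
        then show "l + m \<in> U - {ka}" using l up by (auto simp: upset_def)
      qed
      have "G \<subseteq> mideal (U - {ka})" using GU no by (auto simp: mideal_def)
      then have "mideal U \<subseteq> mideal (U - {ka})" unfolding G(2)
        by (rule germ.genideal_minimal[OF ideal_mideal[OF up']])
      then show False using ka(1) by (auto simp: mideal_subset_iff)
    qed
    then obtain g where g: "g \<in> G" "taylor g ka \<noteq> 0" by blast
    obtain l where l: "k = ka + l" using ka(2) by (auto simp: vec_le_iff_add)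
    have "x = exponent_vec ka + (exponent_vec l + u)" by (simp add: x(1) l exponent_vec_add add.assoc)
    moreover have "0 \<le> (exponent_vec l + u) $ j" for j using x(3)[of j] by (simp add: exponent_vec_def)
    ultimately have "x \<in> {exponent_vec k + u | k u. taylor g k \<noteq> 0 \<and> (\<forall>j. 0 \<le> u $ j)}" using g(2) by blast
    then have "x \<in> newton_germ g" unfolding newton_germ_def by (rule hull_inc)
    then have "x \<in> (\<Union>g\<in>G. newton_germ g)" using g(1) by blast
    then show "x \<in> convex hull (\<Union>g\<in>G. newton_germ g)" by (rule hull_inc)
  qed (rule convex_convex_hull)
qed

lemma newton_polyhedron_mideal:
  fixes U :: "(nat ^ 'n) set"
  assumes up: "upset U" and fin: "finite (- U)"
  shows "newton_polyhedron (mideal U) = upset_polyhedron U"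
  unfolding newton_polyhedron_def
proof (rule the_equality)
  obtain A where A: "finite A" "A \<subseteq> U" "\<And>k. k \<in> U \<Longrightarrow> \<exists>ka\<in>A. ka \<le> k"
    using cofinite_generators[OF up fin] by blast
  let ?G = "germ_monomial ` A"
  have G: "?G \<subseteq> carrier germ_ring" by auto
  have "mideal U = Idl\<^bsub>germ_ring\<^esub> ?G"
  proof
    show "mideal U \<subseteq> Idl\<^bsub>germ_ring\<^esub> ?G"
      by (rule mideal_subset_ideal[OF germ.genideal_ideal[OF G] A(1) _ A(3)]) (use germ.genideal_self[OF G] in auto)
    show "Idl\<^bsub>germ_ring\<^esub> ?G \<subseteq> mideal U"
      by (rule germ.genideal_minimal[OF ideal_mideal[OF up]]) (use A(2) in \<open>auto simp: germ_monomial_mem_mideal\<close>)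
  qed
  then show "\<exists>G. finite G \<and> G \<subseteq> carrier germ_ring \<and> mideal U = Idl\<^bsub>germ_ring\<^esub> G \<and>
      upset_polyhedron U = convex hull (\<Union>g\<in>G. newton_germ g)"
    using A(1) G hull_newton_germ[OF up G] by (intro exI[of _ ?G]) auto
next
  fix \<Gamma> assume "\<exists>G. finite G \<and> G \<subseteq> carrier germ_ring \<and> mideal U = Idl\<^bsub>germ_ring\<^esub> G \<and>
      \<Gamma> = convex hull (\<Union>g\<in>G. newton_germ g)"
  then obtain G where "G \<subseteq> carrier germ_ring" "mideal U = Idl\<^bsub>germ_ring\<^esub> G"
    "\<Gamma> = convex hull (\<Union>g\<in>G. newton_germ g)" by blast
  then show "\<Gamma> = upset_polyhedron U" using hull_newton_germ[OF up] by simp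
qed

lemma newton_ell_eqI:
  fixes U :: "(nat ^ 'n) set"
  assumes up: "upset U" and fin: "finite (- U)" and v: "\<And>j. 0 \<le> v $ j"
    and k0: "k0 \<in> U" and min: "\<And>k. k \<in> U \<Longrightarrow> v \<bullet> exponent_vec k0 \<le> v \<bullet> exponent_vec k"
  shows "newton_ell v (mideal U) = v \<bullet> exponent_vec k0"
  unfolding newton_ell_def newton_polyhedron_mideal[OF up fin]
proof (rule Least_equality)
  have "exponent_vec k0 + 0 \<in> upset_polyhedron U" unfolding upset_polyhedron_def
    by (rule hull_inc, intro CollectI exI[of _ k0] exI[of _ "0 :: real ^ 'n"]) (simp add: k0)
  then show "\<exists>k\<in>upset_polyhedron U. v \<bullet> exponent_vec k0 = v \<bullet> k" by (intro bexI[of _ "exponent_vec k0"]) auto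
next
  fix c assume "\<exists>k\<in>upset_polyhedron U. c = v \<bullet> k"
  then obtain x where x: "x \<in> upset_polyhedron U" "c = v \<bullet> x" by blast
  have "upset_polyhedron U \<subseteq> {x. v \<bullet> x \<ge> v \<bullet> exponent_vec k0}"
    unfolding upset_polyhedron_def
  proof (rule hull_minimal[OF subsetI])
    fix x assume "x \<in> {exponent_vec k + u | k u. k \<in> U \<and> (\<forall>j. 0 \<le> u $ j)}"
    then obtain k u where ku: "x = exponent_vec k + u" "k \<in> U" "\<And>j. 0 \<le> u $ j" by blast
    have "0 \<le> v \<bullet> u" unfolding inner_vec_def by (intro sum_nonneg) (use v ku(3) in simp)
    then show "x \<in> {x. v \<bullet> x \<ge> v \<bullet> exponent_vec k0}" using min[OF ku(2)] by (simp add: ku(1) inner_add_right)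
  qed (rule convex_halfspace_ge)
  then show "v \<bullet> exponent_vec k0 \<le> c" using x by auto
qed

lemma newton_ell_le:
  fixes U :: "(nat ^ 'n) set"
  assumes up: "upset U" and fin: "finite (- U)" and v: "\<And>j. 0 \<le> v $ j" and k: "k \<in> U"
  shows "newton_ell v (mideal U) \<le> v \<bullet> exponent_vec k"
proof -
  obtain A where A: "finite A" "A \<subseteq> U" "\<And>k. k \<in> U \<Longrightarrow> \<exists>ka\<in>A. ka \<le> k"
    using cofinite_generators[OF up fin] by blast
  define k0 where "k0 = arg_min_on (\<lambda>k. v \<bullet> exponent_vec k) A"
  have ne: "A \<noteq> {}" using A(3)[OF k] by auto
  have k0: "k0 \<in> A" unfolding k0_def by (rule arg_min_if_finite(1)[OF A(1) ne])
  have min: "v \<bullet> exponent_vec k0 \<le> v \<bullet> exponent_vec l" if "l \<in> U" for l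
  proof -
    obtain ka where ka: "ka \<in> A" "ka \<le> l" using A(3)[OF \<open>l \<in> U\<close>] by blast
    obtain m where m: "l = ka + m" using ka(2) by (auto simp: vec_le_iff_add)
    have "0 \<le> v \<bullet> exponent_vec m" unfolding inner_vec_def by (intro sum_nonneg) (use v in \<open>simp add: exponent_vec_def\<close>)
    moreover have "v \<bullet> exponent_vec k0 \<le> v \<bullet> exponent_vec ka"
      unfolding k0_def by (rule arg_min_least[OF A(1) ne ka(1)])
    ultimately show ?thesis by (simp add: m exponent_vec_add inner_add_right)
  qed
  have "newton_ell v (mideal U) = v \<bullet> exponent_vec k0"
    by (rule newton_ell_eqI[OF up fin v]) (use k0 A(2) min in auto)
  then show ?thesis using min[OF k] by simp
qed

section \<open>The maximum over weight vectors\<close>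

lemma vec_min_le: "vec_min v \<le> v $ j"
  unfolding vec_min_def by (rule Min_le) auto

lemma vec_min_mem: "\<exists>j. vec_min v = v $ j"
proof -
  have "Min (range (\<lambda>j. v $ j)) \<in> range (\<lambda>j. v $ j)" by (rule Min_in) auto
  then show ?thesis unfolding vec_min_def by (elim imageE) blast
qed

text \<open>Fewer than \<open>i\<close> positions lie outside \<open>argmin_set v\<close>, so some
  \<open>k\<close> in \<open>U\<close> of degree at most \<open>M\<close> is supported on
  \<open>argmin_set v\<close>; there \<open>v\<close> is constant, and the product with
  \<open>k\<close> is \<open>vec_min v * deg k\<close>.\<close>

lemma newton_ell_over_vec_min_le:
  fixes U :: "(nat ^ 'n) set"
  assumes up: "upset U" and fin: "finite (- U)" and i: "1 \<le> i" "i \<le> CARD('n)"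
    and M1: "\<And>W. card W < i \<Longrightarrow> \<exists>k\<in>U. (\<forall>w\<in>W. k $ w = 0) \<and> deg k \<le> M"
    and v: "v \<in> S_set i"
  shows "newton_ell v (mideal U) / vec_min v \<le> real M"
proof -
  have pos: "0 < v $ j" for j using v by (simp add: S_set_def)
  then have mpos: "0 < vec_min v" using vec_min_mem[of v] by auto
  have "card (- argmin_set v) < i"
  proof -
    have "CARD('n) + 1 - i \<le> card (argmin_set v)" using v by (simp add: S_set_def)
    moreover have "card (- argmin_set v) + card (argmin_set v) = CARD('n)"
      by (simp add: Compl_eq_Diff_UNIV card_Diff_subset card_mono)
    ultimately show ?thesis using i by linarith
  qed
  then obtain k where k: "k \<in> U" "\<forall>w\<in>- argmin_set v. k $ w = 0" "deg k \<le> M" using M1 by blast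
  have "newton_ell v (mideal U) \<le> v \<bullet> exponent_vec k"
    by (rule newton_ell_le[OF up fin _ k(1)]) (use pos in \<open>simp add: less_imp_le\<close>)
  also have "\<dots> = (\<Sum>j\<in>UNIV. vec_min v * real (k $ j))"
    unfolding inner_vec_def
  proof (rule sum.cong)
    fix j
    show "v $ j \<bullet> exponent_vec k $ j = vec_min v * real (k $ j)"
      using k(2) by (cases "j \<in> argmin_set v") (auto simp: exponent_vec_def argmin_set_def)
  qed simp
  also have "\<dots> = vec_min v * real (deg k)" by (simp add: deg_def sum_distrib_left)
  also have "\<dots> \<le> vec_min v * real M" using k(3) mpos by simp
  finally show ?thesis using mpos by (simp add: divide_le_eq mult.commute)
qed

lemma newton_ell_over_vec_min_attained:
  fixes U :: "(nat ^ 'n) set"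
  assumes up: "upset U" and fin: "finite (- U)" and i: "1 \<le> i" "i \<le> CARD('n)" and M: "1 \<le> M"
    and k0: "k0 \<in> U" "\<forall>w\<in>W. k0 $ w = 0" "deg k0 = M"
    and W: "card W < i" "\<And>k. k \<in> U \<Longrightarrow> (\<forall>w\<in>W. k $ w = 0) \<Longrightarrow> M \<le> deg k"
  shows "\<exists>v\<in>S_set i. real M = newton_ell v (mideal U) / vec_min v"
proof -
  \<comment> \<open>With weight \<open>M\<close> on \<open>W\<close>, any exponent that meets
    \<open>W\<close> costs at least \<open>M\<close>; one that avoids \<open>W\<close> costs its
    degree, again at least \<open>M\<close>.\<close>
  define v :: "real ^ 'n" where "v = (\<chi> j. if j \<in> W then real M else 1)"
  have "card (- W) + card W = CARD('n)" by (simp add: Compl_eq_Diff_UNIV card_Diff_subset card_mono)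
  then have cW: "CARD('n) + 1 - i \<le> card (- W)" using W(1) by linarith
  then have "- W \<noteq> {}" using i by auto
  then obtain j0 where j0: "j0 \<notin> W" by blast
  have vm: "vec_min v = 1"
  proof (rule antisym)
    show "vec_min v \<le> 1" using vec_min_le[of v j0] j0 by (simp add: v_def)
    obtain j where "vec_min v = v $ j" using vec_min_mem by blast
    then show "1 \<le> vec_min v" using M by (simp add: v_def)
  qed
  have "- W \<subseteq> argmin_set v" unfolding argmin_set_def vm by (auto simp: v_def)
  then have "card (- W) \<le> card (argmin_set v)" by (intro card_mono) auto
  then have vS: "v \<in> S_set i" using cW M by (simp add: S_set_def v_def)
  have val: "v \<bullet> exponent_vec k = real M * (\<Sum>w\<in>W. real (k $ w)) + (\<Sum>w\<in>- W. real (k $ w))" for k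
  proof -
    have "v \<bullet> exponent_vec k = (\<Sum>j\<in>W. v $ j * real (k $ j)) + (\<Sum>j\<in>- W. v $ j * real (k $ j))"
      unfolding inner_vec_def by (subst sum.union_disjoint[symmetric]) (auto simp: exponent_vec_def)
    also have "(\<Sum>j\<in>W. v $ j * real (k $ j)) = real M * (\<Sum>w\<in>W. real (k $ w))"
      unfolding sum_distrib_left by (rule sum.cong) (auto simp: v_def)
    also have "(\<Sum>j\<in>- W. v $ j * real (k $ j)) = (\<Sum>w\<in>- W. real (k $ w))"
      by (rule sum.cong) (auto simp: v_def)
    finally show ?thesis .
  qed
  have deg_split: "deg k = (\<Sum>w\<in>W. k $ w) + (\<Sum>w\<in>- W. k $ w)" for k :: "nat ^ 'n"
    unfolding deg_def by (subst sum.union_disjoint[symmetric]) auto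
  have val0: "v \<bullet> exponent_vec k0 = real M"
    using deg_split[of k0] k0(2,3) by (simp add: val flip: of_nat_sum)
  have low: "real M \<le> v \<bullet> exponent_vec k" if k: "k \<in> U" for k
  proof (cases "\<forall>w\<in>W. k $ w = 0")
    case True
    then have "M \<le> (\<Sum>w\<in>- W. k $ w)" using W(2)[OF k] deg_split[of k] by simp
    then show ?thesis using True by (simp add: val flip: of_nat_sum)
  next
    case False
    then have "(\<Sum>w\<in>W. k $ w) \<noteq> 0" by simp
    then have "1 \<le> (\<Sum>w\<in>W. k $ w)" by linarith
    then have "real M * 1 \<le> real M * real (\<Sum>w\<in>W. k $ w)" by (intro mult_left_mono) (simp_all del: of_nat_sum)
    moreover have "0 \<le> (\<Sum>w\<in>- W. real (k $ w))" by (intro sum_nonneg) simp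
    ultimately show ?thesis by (simp add: val)
  qed
  have "newton_ell v (mideal U) = v \<bullet> exponent_vec k0"
    by (rule newton_ell_eqI[OF up fin _ k0(1)]) (use low val0 in \<open>auto simp: v_def\<close>)
  then show ?thesis using vS val0 vm by (intro bexI[of _ v]) auto
qed

theorem theorem5p1:
  fixes I :: "(complex ^ 'n \<Rightarrow> complex) set set" and i :: nat
  assumes "ideal I germ_ring" and "I \<noteq> carrier germ_ring"
    and "monomial_ideal I"
    and "finite_colength germ_ring I"
    and "1 \<le> i" and "i \<le> CARD('n)"
  shows "(\<exists>v\<in>S_set i. rel_lojasiewicz germ_ring CARD('n) i I = newton_ell v I / vec_min v) \<and>
         (\<forall>v\<in>S_set i. newton_ell v I / vec_min v \<le> rel_lojasiewicz germ_ring CARD('n) i I)"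
proof -
  obtain U :: "(nat ^ 'n) set" where U: "upset U" "finite (- U)" "I = mideal U" "U \<subseteq> mm 1"
    using monomial_ideal_eq_mideal[OF assms(1-4)] .
  define ordW where "ordW W = (LEAST m. \<exists>k\<in>U. (\<forall>w\<in>W. k $ w = 0) \<and> deg k = m)" for W
  have ex: "\<exists>k\<in>U. (\<forall>w\<in>W. k $ w = 0) \<and> deg k = ordW W" if "card W < i" for W
  proof -
    have "W \<noteq> UNIV" using that assms(6) by auto
    then obtain j where j: "j \<notin> W" by blast
    \<comment> \<open>A pure power of a variable outside \<open>W\<close> lies in the ideal, so the
      minimum in \<open>ordW\<close> exists.\<close>
    obtain d where d: "mm d \<subseteq> U" using finite_Compl_iff[OF U(1)] U(2) by blast
    have "axis j d \<in> U" using d by (auto simp: mm_def)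
    moreover have "\<forall>w\<in>W. axis j d $ w = 0" using j by (auto simp: axis_def)
    ultimately have "\<exists>k\<in>U. (\<forall>w\<in>W. k $ w = 0) \<and> deg k = d" by (intro bexI[of _ "axis j d"]) auto
    then show ?thesis unfolding ordW_def by (rule LeastI)
  qed
  have least: "ordW W \<le> deg k" if "k \<in> U" "\<forall>w\<in>W. k $ w = 0" for W k
    unfolding ordW_def by (rule Least_le) (use that in auto)
  define M where "M = Max (ordW ` {W. card W < i})"
  have "M \<in> ordW ` {W. card W < i}" unfolding M_def
    by (rule Max_in) (use assms(5) in \<open>auto intro: exI[of _ "{}"]\<close>)
  then obtain W0 where W0: "card W0 < i" "ordW W0 = M" by auto
  have "ordW W \<le> M" if "card W < i" for W unfolding M_def by (rule Max_ge) (use that in auto)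
  then have M1: "\<exists>k\<in>U. (\<forall>w\<in>W. k $ w = 0) \<and> deg k \<le> M" if "card W < i" for W
    using ex[OF that] that by fastforce
  have M2: "M \<le> deg k" if "k \<in> U" "\<forall>w\<in>W0. k $ w = 0" for k using least[OF that] W0(2) by simp
  obtain k0 where k0: "k0 \<in> U" "\<forall>w\<in>W0. k0 $ w = 0" "deg k0 = M" using ex[OF W0(1)] W0(2) by auto
  have M: "1 \<le> M" using k0(1,3) U(4) by (auto simp: mm_def)
  have r0: "r0 germ_ring (map (\<lambda>I. ideal_pow germ_ring I s) (replicate i I @ replicate (CARD('n) - i) (max_ideal germ_ring))) = s * M"
    if "1 \<le> s" for s
    unfolding U(3) by (rule r0_mideal[OF U(1,2,4) assms(5,6) that M1 W0(1) M2])
  \<comment> \<open>Since \<open>r0\<close> is exactly \<open>s * M\<close>, the infimum runs over a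
    constant family.\<close>
  have "(\<lambda>s. real (r0 germ_ring (map (\<lambda>I. ideal_pow germ_ring I s) (replicate i I @ replicate (CARD('n) - i) (max_ideal germ_ring)))) / real s) ` {1..} = {real M}"
    using r0 by (force simp: image_iff)
  then have L: "rel_lojasiewicz germ_ring CARD('n) i I = real M"
    by (simp add: rel_lojasiewicz_def lojasiewicz_def)
  show ?thesis unfolding L unfolding U(3)
    using newton_ell_over_vec_min_attained[OF U(1,2) assms(5,6) M k0 W0(1) M2]
      newton_ell_over_vec_min_le[OF U(1,2) assms(5,6) M1] by blast
qed

end
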